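(* The space $\operatorname{scf}(U)$ of superclass functions on $U$ is a commutative semisimple algebra (over $\mathbb{C}$) with respect to the convolution product $(\xi\star\zeta)(z)=\sum_{x\in U}\xi(x)\zeta(zx^{-1})$, $z\in U$.
   Context: Let $p$ be an odd prime, $q=p^{e}$ ($e\ge 1$), $\mathbb{F}_q$ the field with $q$ elements, $\mathbb{F}_q^{\times}=\mathbb{F}_q\setminus\{0\}$, and $n\ge 1$. Let $G$ be one of $Sp_{2n}(q)$, $O_{2n}(q)$, $O_{2n+1}(q)$; put $m=2n$ in the first two cases and $m=2n+1$ in the third. $U_m(q)$ is the group of unipotent upper-triangular $m\times m$ matrices over $\mathbb{F}_q$, and $U=G\cap U_m(q)$. Explicitly, with $J$ the $n\times n$ matrix with $1$'s on the anti-diagonal and $0$'s elsewhere, $U$ consists of all block matrices $\begin{pmatrix} x & xv & xw\\ 0 & I_r & -v^{T}J\\ 0&0&Jx^{-T}J\end{pmatrix}$ with $x\in U_n(q)$, $v$ an $n\times r$ matrix, $w$ an $n\times n$ matrix over $\mathbb{F}_q$, where: $r=0$ and $Jw^T-wJ=0$ if $G=Sp_{2n}(q)$; $r=0$ and $Jw^T+wJ=0$ if $G=O_{2n}(q)$; $r=1$ and $Jw^T+wJ=-vv^T$ if $G=O_{2n+1}(q)$. Indexing. Rows and columns of $m\times m$ matrices are indexed by $1\prec 2\prec\cdots\prec n\prec 0\prec -n\prec\cdots\prec -2\prec -1$ (index $0$ present only if $G=O_{2n+1}(q)$); $e_{i,j}$ denotes a matrix unit. Roots. $\varepsilon_1,\dots,\varepsilon_n$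 are formal independent symbols; $\Phi=\{\varepsilon_i\pm\varepsilon_j:1\le i<j\le n\}\cup\Phi'$ with $\Phi'=\{2\varepsilon_i:1\le i\le n\}$ if $G=Sp_{2n}(q)$, $\Phi'=\emptyset$ if $G=O_{2n}(q)$, $\Phi'=\{\varepsilon_i:1\le i\le n\}$ if $G=O_{2n+1}(q)$. For $\alpha\in\Phi$ let $\mathcal{E}(\alpha)$ be: $\{(i,j),(-j,-i)\}$ if $\alpha=\varepsilon_i-\varepsilon_j$; $\{(i,-j),(j,-i)\}$ if $\alpha=\varepsilon_i+\varepsilon_j$ ($i<j$); $\{(i,-i)\}$ if $\alpha=2\varepsilon_i$; $\{(i,0),(0,-i)\}$ if $\alpha=\varepsilon_i$. For $\Psi\subseteq\Phi$, $\mathcal{E}(\Psi)=\bigcup_{\alpha\in\Psi}\mathcal{E}(\alpha)$. Basic pairs. $D\subseteq\Phi$ is basic if $\mathcal{E}(D)$ contains at most one entry from each row and at most one from each column. A basic pair for $U$ is $(D,\phi)$ with $D\subseteq\Phi$ basic (possibly empty) and $\phi:D\to\mathbb{F}_q^\times$ a map. Superclasses. Let $e_\alpha$ be: $e_{i,j}-e_{-j,-i}$ if $\alpha=\varepsilon_i-\varepsilon_j$; $e_{i,-j}+e_{j,-i}$ if $\alpha=\varepsilon_i+\varepsilon_j$ and $G=Sp_{2n}(q)$; $e_{i,-j}-e_{j,-i}$ if $\alpha=\varepsilon_i+\varepsilon_j$ and $G$ is orthogonal; $e_{i,-i}$ if $\alpha=2\varepsilon_i$; $e_{i,0}-e_{0,-i}$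 if $\alpha=\varepsilon_i$. Put $e_{D,\phi}=\sum_{\alpha\in D}\phi(\alpha)e_\alpha$, $V_{D,\phi}=U_m(q)\,e_{D,\phi}\,U_m(q)$ and $K_{D,\phi}=\{x\in U: x-1\in V_{D,\phi}\}$ (so $K_{D,\phi}=\{1\}$ if $D=\emptyset$). The sets $K_{D,\phi}$, for $(D,\phi)$ a basic pair, are the superclasses of $U$. A function $\eta:U\to\mathbb{C}$ is a superclass function if it is constant on each superclass; $\operatorname{scf}(U)$ is the complex vector space of all superclass functions. *)

theory Defs
  imports
    "HOL-Algebra.Ideal"
    "Jordan_Normal_Form.Determinant"
    "Jordan_Normal_Form.VS_Connect"
begin

section \<open>The groups\<close>

datatype gtype = Sp | O_even | O_odd

definition msize :: "gtype \<Rightarrow> nat \<Rightarrow> nat" where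
  "msize T n = (case T of Sp \<Rightarrow> 2 * n | O_even \<Rightarrow> 2 * n | O_odd \<Rightarrow> 2 * n + 1)"

definition unitri :: "nat \<Rightarrow> 'a::field mat set" where
  "unitri m = {A \<in> carrier_mat m m. upper_triangular A \<and> (\<forall>i<m. A $$ (i, i) = 1)}"

text \<open>
  The Gram matrix of the form defining the group: the antidiagonal matrix with entries \<open>1\<close>, except
  that for \<open>Sp\<close> those in the lower half are \<open>-1\<close>.  The resulting block form of the elements of
  \<open>Uset\<close> is proved below as \<open>Uset_explicit\<close>.
\<close>

definition gram :: "gtype \<Rightarrow> nat \<Rightarrow> 'a::field mat" where
  "gram T n = mat (msize T n) (msize T n)
     (\<lambda>(i, j). if i + j + 1 = msize T n then (if T = Sp \<and> n \<le> i then - 1 else 1) else 0)"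

definition isometries :: "gtype \<Rightarrow> nat \<Rightarrow> 'a::field mat set" where
  "isometries T n = {g \<in> carrier_mat (msize T n) (msize T n).
     transpose_mat g * gram T n * g = gram T n}"

definition Uset :: "gtype \<Rightarrow> nat \<Rightarrow> 'a::field mat set" where
  "Uset T n = isometries T n \<inter> unitri (msize T n)"

definition Ugrp :: "gtype \<Rightarrow> nat \<Rightarrow> 'a::field mat monoid" where
  "Ugrp T n = \<lparr>carrier = Uset T n, monoid.mult = (*), monoid.one = 1\<^sub>m (msize T n)\<rparr>"


section \<open>Roots and superclasses\<close>

text \<open>
  A root is a formal expression: \<open>Minus i j\<close> is \<open>\<epsilon>\<^sub>i - \<epsilon>\<^sub>j\<close>, \<open>Plus i j\<close> is \<open>\<epsilon>\<^sub>i + \<epsilon>\<^sub>j\<close>, \<open>Double i\<close> is \<open>2\<epsilon>\<^sub>i\<close> and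
  \<open>Single i\<close> is \<open>\<epsilon>\<^sub>i\<close>.  With \<open>i < j\<close> in the first two cases, distinct expressions are distinct roots.
\<close>

datatype root = Minus nat nat | Plus nat nat | Double nat | Single nat

definition roots :: "gtype \<Rightarrow> nat \<Rightarrow> root set" where
  "roots T n =
     {Minus i j | i j. 1 \<le> i \<and> i < j \<and> j \<le> n} \<union> {Plus i j | i j. 1 \<le> i \<and> i < j \<and> j \<le> n} \<union>
     (case T of Sp \<Rightarrow> Double ` {1..n} | O_even \<Rightarrow> {} | O_odd \<Rightarrow> Single ` {1..n})"

fun entries :: "root \<Rightarrow> (int \<times> int) set" where
  "entries (Minus i j) = {(int i, int j), (- int j, - int i)}"
| "entries (Plus i j) = {(int i, - int j), (int j, - int i)}"
| "entries (Double i) = {(int i, - int i)}"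
| "entries (Single i) = {(int i, 0), (0, - int i)}"

definition basic_set :: "gtype \<Rightarrow> nat \<Rightarrow> root set \<Rightarrow> bool" where
  "basic_set T n D \<longleftrightarrow> D \<subseteq> roots T n \<and>
     (\<forall>i j j'. (i, j) \<in> \<Union> (entries ` D) \<and> (i, j') \<in> \<Union> (entries ` D) \<longrightarrow> j = j') \<and>
     (\<forall>i i' j. (i, j) \<in> \<Union> (entries ` D) \<and> (i', j) \<in> \<Union> (entries ` D) \<longrightarrow> i = i')"

text \<open>Only the values of \<open>\<phi>\<close> on \<open>D\<close> are relevant.\<close>

definition basic_pair :: "gtype \<Rightarrow> nat \<Rightarrow> root set \<Rightarrow> (root \<Rightarrow> 'a::field) \<Rightarrow> bool" where
  "basic_pair T n D \<phi> \<longleftrightarrow> basic_set T n D \<and> (\<forall>\<alpha>\<in>D. \<phi> \<alpha> \<noteq> 0)"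

text \<open>
  Rows and columns are labelled by \<open>1, 2, \<dots>, n, 0, -n, \<dots>, -2, -1\<close> in this order (without the label \<open>0\<close>
  unless the type is \<open>O_odd\<close>), whereas matrix positions are counted from \<open>0\<close>.
\<close>

definition position :: "gtype \<Rightarrow> nat \<Rightarrow> int \<Rightarrow> nat" where
  "position T n i = (if 0 < i then nat i - 1 else if i = 0 then n else msize T n - nat (- i))"

definition munit :: "gtype \<Rightarrow> nat \<Rightarrow> int \<Rightarrow> int \<Rightarrow> 'a::field mat" where
  "munit T n i j = mat (msize T n) (msize T n)
     (\<lambda>(k, l). if k = position T n i \<and> l = position T n j then 1 else 0)"

fun root_mat :: "gtype \<Rightarrow> nat \<Rightarrow> root \<Rightarrow> 'a::field mat" where
  "root_mat T n (Minus i j) = munit T n i j - munit T n (- int j) (- int i)"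
| "root_mat T n (Plus i j) =
     (if T = Sp then munit T n i (- int j) + munit T n j (- int i)
      else munit T n i (- int j) - munit T n j (- int i))"
| "root_mat T n (Double i) = munit T n i (- int i)"
| "root_mat T n (Single i) = munit T n i 0 - munit T n 0 (- int i)"

definition pair_mat :: "gtype \<Rightarrow> nat \<Rightarrow> root set \<Rightarrow> (root \<Rightarrow> 'a::field) \<Rightarrow> 'a mat" where
  "pair_mat T n D \<phi> = mat (msize T n) (msize T n)
     (\<lambda>(k, l). \<Sum>\<alpha>\<in>D. \<phi> \<alpha> * root_mat T n \<alpha> $$ (k, l))"

definition Vset :: "gtype \<Rightarrow> nat \<Rightarrow> root set \<Rightarrow> (root \<Rightarrow> 'a::field) \<Rightarrow> 'a mat set" where
  "Vset T n D \<phi> =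
     {a * pair_mat T n D \<phi> * b | a b. a \<in> unitri (msize T n) \<and> b \<in> unitri (msize T n)}"

definition superclass :: "gtype \<Rightarrow> nat \<Rightarrow> root set \<Rightarrow> (root \<Rightarrow> 'a::field) \<Rightarrow> 'a mat set" where
  "superclass T n D \<phi> = {x \<in> Uset T n. x - 1\<^sub>m (msize T n) \<in> Vset T n D \<phi>}"


section \<open>The space of superclass functions and its convolution product\<close>

text \<open>Functions on \<open>U\<close> are represented by functions on all matrices that are \<open>undefined\<close> outside \<open>U\<close>.\<close>

definition scf :: "gtype \<Rightarrow> nat \<Rightarrow> ('a::field mat \<Rightarrow> complex) set" where
  "scf T n = {\<eta> \<in> Uset T n \<rightarrow>\<^sub>E UNIV.
     \<forall>D \<phi>. basic_pair T n D \<phi> \<longrightarrow> (\<forall>x\<in>superclass T n D \<phi>. \<forall>y\<in>superclass T n D \<phi>. \<eta> x = \<eta> y)}"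

definition convolution :: "gtype \<Rightarrow> nat \<Rightarrow>
    ('a::field mat \<Rightarrow> complex) \<Rightarrow> ('a mat \<Rightarrow> complex) \<Rightarrow> 'a mat \<Rightarrow> complex" where
  "convolution T n \<xi> \<zeta> = (\<lambda>z\<in>Uset T n. \<Sum>x\<in>Uset T n. \<xi> x * \<zeta> (z * inv\<^bsub>Ugrp T n\<^esub> x))"

definition scf_algebra :: "gtype \<Rightarrow> nat \<Rightarrow> (complex, 'a::field mat \<Rightarrow> complex) module" where
  "scf_algebra T n =
     \<lparr>carrier = scf T n,
      monoid.mult = convolution T n,
      monoid.one = (\<lambda>z\<in>Uset T n. if z = 1\<^sub>m (msize T n) then 1 else 0),
      ring.zero = (\<lambda>z\<in>Uset T n. 0),
      ring.add = (\<lambda>\<xi> \<zeta>. \<lambda>z\<in>Uset T n. \<xi> z + \<zeta> z),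
      module.smult = (\<lambda>c \<xi>. \<lambda>z\<in>Uset T n. c * \<xi> z)\<rparr>"


section \<open>Semisimple rings\<close>

definition left_ideal :: "'b set \<Rightarrow> ('b, 'c) ring_scheme \<Rightarrow> bool" where
  "left_ideal I R \<longleftrightarrow> additive_subgroup I R \<and> (\<forall>a\<in>carrier R. \<forall>x\<in>I. a \<otimes>\<^bsub>R\<^esub> x \<in> I)"

definition minimal_left_ideal :: "'b set \<Rightarrow> ('b, 'c) ring_scheme \<Rightarrow> bool" where
  "minimal_left_ideal I R \<longleftrightarrow> left_ideal I R \<and> I \<noteq> {\<zero>\<^bsub>R\<^esub>} \<and>
     (\<forall>J. left_ideal J R \<and> J \<subseteq> I \<longrightarrow> J = {\<zero>\<^bsub>R\<^esub>} \<or> J = I)"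

text \<open>
  A ring is semisimple if its left regular module is a direct sum of simple submodules.  Since the ring
  is unital, such a direct sum is necessarily finite, and for a unital algebra the submodules of the
  regular module are exactly the left ideals.
\<close>

definition semisimple_ring :: "('b, 'c) ring_scheme \<Rightarrow> bool" where
  "semisimple_ring R \<longleftrightarrow> ring R \<and>
     (\<exists>(k::nat) L. (\<forall>i<k. minimal_left_ideal (L i) R) \<and>
        (\<forall>x\<in>carrier R. \<exists>!f. f \<in> (\<Pi>\<^sub>E i\<in>{..<k}. L i) \<and> x = (\<Oplus>\<^bsub>R\<^esub>i\<in>{..<k}. f i)))"


section \<open>The explicit block form of the elements of \<open>Uset\<close>\<close>

definition block3 :: "nat \<Rightarrow> nat \<Rightarrow> 'a mat \<Rightarrow> 'a mat \<Rightarrow> 'a mat \<Rightarrow> 'a mat \<Rightarrow> 'a mat \<Rightarrow> 'a mat \<Rightarrow>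
    'a mat \<Rightarrow> 'a mat \<Rightarrow> 'a mat \<Rightarrow> 'a mat" where
  "block3 n r A B C D E F G H K = mat (n + r + n) (n + r + n) (\<lambda>(i, j).
     if i < n then
       (if j < n then A $$ (i, j) else if j < n + r then B $$ (i, j - n) else C $$ (i, j - n - r))
     else if i < n + r then
       (if j < n then D $$ (i - n, j) else if j < n + r then E $$ (i - n, j - n)
        else F $$ (i - n, j - n - r))
     else
       (if j < n then G $$ (i - n - r, j) else if j < n + r then H $$ (i - n - r, j - n)
        else K $$ (i - n - r, j - n - r)))"

lemma sum_three:
  fixes f :: "nat \<Rightarrow> 'a::comm_monoid_add"
  shows "sum f {0..<a+b+c} = sum f {0..<a} + (\<Sum>k=0..<b. f (a + k)) + (\<Sum>k=0..<c. f (a + b + k))"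
proof -
  have "sum f {0..<a+b+c} = sum f {0..<a+b} + sum f {a+b..<a+b+c}"
    by (simp add: sum.atLeastLessThan_concat)
  moreover have "sum f {0..<a+b} = sum f {0..<a} + sum f {a..<a+b}"
    by (simp add: sum.atLeastLessThan_concat)
  moreover have "sum f {a..<a+b} = (\<Sum>k=0..<b. f (a + k))"
    using sum.shift_bounds_nat_ivl[of f 0 a b] by (simp add: add.commute)
  moreover have "sum f {a+b..<a+b+c} = (\<Sum>k=0..<c. f (a + b + k))"
    using sum.shift_bounds_nat_ivl[of f 0 "a+b" c] by (simp add: add.commute)
  ultimately show ?thesis by simp
qed

lemma mult_entry:
  assumes "A \<in> carrier_mat a b" "B \<in> carrier_mat b c" "i < a" "j < c"
  shows "(A * B) $$ (i, j) = (\<Sum>k=0..<b. A $$ (i, k) * B $$ (k, j))"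
  using assms by (simp add: scalar_prod_def)

lemma block3_carrier [simp]: "block3 n r A B C D E F G H K \<in> carrier_mat (n + r + n) (n + r + n)"
  by (simp add: block3_def)

lemma block3_mult:
  fixes A :: "'a::comm_ring_1 mat"
  assumes c: "A \<in> carrier_mat n n" "B \<in> carrier_mat n r" "C \<in> carrier_mat n n"
    "D \<in> carrier_mat r n" "E \<in> carrier_mat r r" "F \<in> carrier_mat r n"
    "G \<in> carrier_mat n n" "H \<in> carrier_mat n r" "K \<in> carrier_mat n n"
    "A' \<in> carrier_mat n n" "B' \<in> carrier_mat n r" "C' \<in> carrier_mat n n"
    "D' \<in> carrier_mat r n" "E' \<in> carrier_mat r r" "F' \<in> carrier_mat r n"
    "G' \<in> carrier_mat n n" "H' \<in> carrier_mat n r" "K' \<in> carrier_mat n n"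
  shows "block3 n r A B C D E F G H K * block3 n r A' B' C' D' E' F' G' H' K' =
    block3 n r (A * A' + B * D' + C * G') (A * B' + B * E' + C * H') (A * C' + B * F' + C * K')
      (D * A' + E * D' + F * G') (D * B' + E * E' + F * H') (D * C' + E * F' + F * K')
      (G * A' + H * D' + K * G') (G * B' + H * E' + K * H') (G * C' + H * F' + K * K')"
    (is "?X * ?Y = ?Z")
proof (rule eq_matI)
  fix i j assume "i < dim_row ?Z" "j < dim_col ?Z"
  then have i: "i < n + r + n" and j: "j < n + r + n" by (simp_all add: block3_def)
  have i': "\<not> i < n \<Longrightarrow> i < n + r \<Longrightarrow> i - n < r" "\<not> i < n + r \<Longrightarrow> i - n - r < n"
    and j': "\<not> j < n \<Longrightarrow> j < n + r \<Longrightarrow> j - n < r" "\<not> j < n + r \<Longrightarrow> j - n - r < n"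
    using i j by auto
  have dims: "dim_row A' = n" "dim_row B' = n" "dim_row C' = n" "dim_row D' = r" "dim_row E' = r"
    "dim_row F' = r" "dim_row G' = n" "dim_row H' = n" "dim_row K' = n"
    "dim_col A = n" "dim_col D = n" "dim_col G = n" "dim_col B = r" "dim_col E = r" "dim_col H = r"
    "dim_col C = n" "dim_col F = n" "dim_col K = n" 
    "dim_row A = n" "dim_row B = n" "dim_row C = n" "dim_row D = r" "dim_row E = r"
    "dim_row F = r" "dim_row G = n" "dim_row H = n" "dim_row K = n"
    "dim_col A' = n" "dim_col D' = n" "dim_col G' = n" "dim_col B' = r" "dim_col E' = r"
    "dim_col H' = r" "dim_col C' = n" "dim_col F' = n" "dim_col K' = n"
    using c by auto
  have "(?X * ?Y) $$ (i, j) = (\<Sum>k=0..<n+r+n. ?X $$ (i, k) * ?Y $$ (k, j))"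
    by (rule mult_entry[OF block3_carrier block3_carrier i j])
  also have "\<dots> = ?Z $$ (i, j)"
    unfolding sum_three using i j i' j'
    by (cases "i < n"; cases "i < n + r"; cases "j < n"; cases "j < n + r")
      (simp_all add: block3_def scalar_prod_def dims)
  finally show "(?X * ?Y) $$ (i, j) = ?Z $$ (i, j)" .
qed (simp_all add: block3_def)

lemma block3_transpose:
  assumes c: "A \<in> carrier_mat n n" "B \<in> carrier_mat n r" "C \<in> carrier_mat n n"
    "D \<in> carrier_mat r n" "E \<in> carrier_mat r r" "F \<in> carrier_mat r n"
    "G \<in> carrier_mat n n" "H \<in> carrier_mat n r" "K \<in> carrier_mat n n"
  shows "transpose_mat (block3 n r A B C D E F G H K) =
    block3 n r (transpose_mat A) (transpose_mat D) (transpose_mat G) (transpose_mat B)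
      (transpose_mat E) (transpose_mat H) (transpose_mat C) (transpose_mat F) (transpose_mat K)"
  by (rule eq_matI) (use c in \<open>auto simp: block3_def\<close>)

lemma block3_eq_iff:
  assumes c: "A \<in> carrier_mat n n" "B \<in> carrier_mat n r" "C \<in> carrier_mat n n"
    "D \<in> carrier_mat r n" "E \<in> carrier_mat r r" "F \<in> carrier_mat r n"
    "G \<in> carrier_mat n n" "H \<in> carrier_mat n r" "K \<in> carrier_mat n n"
    "A' \<in> carrier_mat n n" "B' \<in> carrier_mat n r" "C' \<in> carrier_mat n n"
    "D' \<in> carrier_mat r n" "E' \<in> carrier_mat r r" "F' \<in> carrier_mat r n"
    "G' \<in> carrier_mat n n" "H' \<in> carrier_mat n r" "K' \<in> carrier_mat n n"
  shows "block3 n r A B C D E F G H K = block3 n r A' B' C' D' E' F' G' H' K' \<longleftrightarrow>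
    A = A' \<and> B = B' \<and> C = C' \<and> D = D' \<and> E = E' \<and> F = F' \<and> G = G' \<and> H = H' \<and> K = K'"
    (is "?X = ?Y \<longleftrightarrow> ?R")
proof
  assume eq: "?X = ?Y"
  have e: "?X $$ (i, j) = ?Y $$ (i, j)" for i j by (simp add: eq)
  have *: "X = Y" if "X \<in> carrier_mat a b" "Y \<in> carrier_mat a b"
     "\<And>i j. i < a \<Longrightarrow> j < b \<Longrightarrow> X $$ (i, j) = Y $$ (i, j)" for X Y :: "'a mat" and a b
    using that by (intro eq_matI) auto
  have "A = A'" by (rule *[OF c(1) c(10)]) (subgoal_tac "?X $$ (i, j) = ?Y $$ (i, j)", simp add: block3_def, rule e)
  moreover have "B = B'"
    by (rule *[OF c(2) c(11)]) (subgoal_tac "?X $$ (i, n + j) = ?Y $$ (i, n + j)", simp add: block3_def, rule e)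
  moreover have "C = C'"
    by (rule *[OF c(3) c(12)]) (subgoal_tac "?X $$ (i, n + r + j) = ?Y $$ (i, n + r + j)", simp add: block3_def, rule e)
  moreover have "D = D'"
    by (rule *[OF c(4) c(13)]) (subgoal_tac "?X $$ (n + i, j) = ?Y $$ (n + i, j)", simp add: block3_def, rule e)
  moreover have "E = E'"
    by (rule *[OF c(5) c(14)]) (subgoal_tac "?X $$ (n + i, n + j) = ?Y $$ (n + i, n + j)", simp add: block3_def, rule e)
  moreover have "F = F'"
    by (rule *[OF c(6) c(15)]) (subgoal_tac "?X $$ (n + i, n + r + j) = ?Y $$ (n + i, n + r + j)", simp add: block3_def, rule e)
  moreover have "G = G'"
    by (rule *[OF c(7) c(16)]) (subgoal_tac "?X $$ (n + r + i, j) = ?Y $$ (n + r + i, j)", simp add: block3_def, rule e)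
  moreover have "H = H'"
    by (rule *[OF c(8) c(17)]) (subgoal_tac "?X $$ (n + r + i, n + j) = ?Y $$ (n + r + i, n + j)", simp add: block3_def, rule e)
  moreover have "K = K'"
    by (rule *[OF c(9) c(18)]) (subgoal_tac "?X $$ (n + r + i, n + r + j) = ?Y $$ (n + r + i, n + r + j)", simp add: block3_def, rule e)
  ultimately show ?R by simp
qed simp


definition antidiag :: "nat \<Rightarrow> 'a::field mat" where
  "antidiag n = mat n n (\<lambda>(i, j). if i + j + 1 = n then 1 else 0)"

lemma antidiag_carrier [simp]: "antidiag n \<in> carrier_mat n n"
  by (simp add: antidiag_def)

lemma antidiag_transpose [simp]: "transpose_mat (antidiag n) = antidiag n"
  by (rule eq_matI) (auto simp: antidiag_def add.commute)

lemma antidiag_mult_entry: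
  assumes A: "A \<in> carrier_mat n m" and "i < n" "j < m"
  shows "(antidiag n * A) $$ (i, j) = A $$ (n - 1 - i, j)"
proof -
  have "(antidiag n * A) $$ (i, j) = (\<Sum>k=0..<n. antidiag n $$ (i, k) * A $$ (k, j))"
    by (rule mult_entry[OF antidiag_carrier A assms(2,3)])
  also have "\<dots> = (\<Sum>k=0..<n. if k = n - 1 - i then A $$ (k, j) else 0)"
    by (rule sum.cong) (use assms in \<open>auto simp: antidiag_def\<close>)
  also have "\<dots> = A $$ (n - 1 - i, j)" using assms by simp
  finally show ?thesis .
qed

lemma mult_antidiag_entry:
  assumes A: "A \<in> carrier_mat m n" and "i < m" "j < n"
  shows "(A * antidiag n) $$ (i, j) = A $$ (i, n - 1 - j)"
proof -
  have "(A * antidiag n) $$ (i, j) = (\<Sum>k=0..<n. A $$ (i, k) * antidiag n $$ (k, j))"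
    by (rule mult_entry[OF A antidiag_carrier assms(2,3)])
  also have "\<dots> = (\<Sum>k=0..<n. if k = n - 1 - j then A $$ (i, k) else 0)"
    by (rule sum.cong) (use assms in \<open>auto simp: antidiag_def\<close>)
  also have "\<dots> = A $$ (i, n - 1 - j)" using assms by simp
  finally show ?thesis .
qed

lemma antidiag_square [simp]: "antidiag n * antidiag n = 1\<^sub>m n"
proof (rule eq_matI)
  fix i j assume "i < dim_row (1\<^sub>m n :: 'a mat)" "j < dim_col (1\<^sub>m n :: 'a mat)"
  then show "(antidiag n * antidiag n) $$ (i, j) = (1\<^sub>m n :: 'a mat) $$ (i, j)"
    by (subst antidiag_mult_entry[of _ n n]) (auto simp: antidiag_def)
qed (simp_all add: antidiag_def)

lemma antidiag_cancel: 
  assumes "A \<in> carrier_mat n m"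
  shows "antidiag n * (antidiag n * A) = A"
  by (subst assoc_mult_mat[symmetric, of _ n n _ n _ m]) (use assms in simp_all)

lemma unitri_flip:
  assumes y: "y \<in> unitri n"
  shows "antidiag n * transpose_mat y * antidiag n \<in> unitri n" (is "?z \<in> _")
proof -
  have yc: "y \<in> carrier_mat n n" and ut: "upper_triangular y" and d: "\<And>i. i < n \<Longrightarrow> y $$ (i, i) = 1"
    using y by (auto simp: unitri_def)
  have yt: "transpose_mat y \<in> carrier_mat n n" using yc by simp
  have ent: "?z $$ (i, j) = y $$ (n - 1 - j, n - 1 - i)" if "i < n" "j < n" for i j
    using that yc by (simp add: mult_antidiag_entry[of _ n n] antidiag_mult_entry[OF yt] mult_carrier_mat[OF antidiag_carrier yt] del: index_mult_mat)
  have "upper_triangular ?z"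
  proof (rule upper_triangularI)
    fix i j assume "j < i" "i < dim_row ?z"
    then have "i < n" by (simp add: antidiag_def)
    then show "?z $$ (i, j) = 0" using \<open>j < i\<close> yc
      by (subst ent) (auto intro!: upper_triangularD[OF ut])
  qed
  moreover have "?z \<in> carrier_mat n n"
    by (rule mult_carrier_mat[OF mult_carrier_mat[OF antidiag_carrier yt] antidiag_carrier])
  ultimately show ?thesis using ent d by (auto simp: unitri_def simp del: index_mult_mat(1))
qed

lemma gram_block3:
  assumes r: "r = (if T = O_odd then 1 else 0)" and s: "s = (if T = Sp then - 1 else 1)"
  shows "gram T n = block3 n r (0\<^sub>m n n) (0\<^sub>m n r) (antidiag n) (0\<^sub>m r n) (1\<^sub>m r) (0\<^sub>m r n)
    (s \<cdot>\<^sub>m antidiag n) (0\<^sub>m n r) (0\<^sub>m n n)"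
  by (rule eq_matI) (cases T; auto simp: gram_def block3_def msize_def antidiag_def r s)+

lemma isometry_block3:
  fixes x :: "'a::field mat"
  assumes r: "r = (if T = O_odd then 1 else 0)" and s: "s = (if T = Sp then - 1 else 1)"
    and c [simp]: "x \<in> carrier_mat n n" "b \<in> carrier_mat n r" "c \<in> carrier_mat n n"
      "f \<in> carrier_mat r n" "k \<in> carrier_mat n n"
  defines "J \<equiv> antidiag n"
  shows "block3 n r x b c (0\<^sub>m r n) (1\<^sub>m r) f (0\<^sub>m n n) (0\<^sub>m n r) k \<in> isometries T n \<longleftrightarrow>
    transpose_mat x * (J * k) = J \<and>
    transpose_mat b * (J * k) + f = 0\<^sub>m r n \<and>
    s \<cdot>\<^sub>m (transpose_mat k * (J * x)) = s \<cdot>\<^sub>m J \<and>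
    transpose_mat f + s \<cdot>\<^sub>m (transpose_mat k * (J * b)) = 0\<^sub>m n r \<and>
    transpose_mat c * (J * k) + transpose_mat f * f + s \<cdot>\<^sub>m (transpose_mat k * (J * c)) = 0\<^sub>m n n"
    (is "?u \<in> _ \<longleftrightarrow> _")
proof -
  have J [simp]: "J \<in> carrier_mat n n" by (simp add: J_def)
  have m: "msize T n = n + r + n" by (cases T) (auto simp: msize_def r)
  have J1: "J * x \<in> carrier_mat n n" "J * b \<in> carrier_mat n r" "J * c \<in> carrier_mat n n"
     "J * k \<in> carrier_mat n n"
    by (rule mult_carrier_mat[OF J c(1)] mult_carrier_mat[OF J c(2)] mult_carrier_mat[OF J c(3)]
        mult_carrier_mat[OF J c(5)])+
  have t: "transpose_mat x \<in> carrier_mat n n" "transpose_mat b \<in> carrier_mat r n"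
    "transpose_mat c \<in> carrier_mat n n" "transpose_mat f \<in> carrier_mat n r"
    "transpose_mat k \<in> carrier_mat n n"
    by simp_all
  let ?g = "block3 n r (0\<^sub>m n n) (0\<^sub>m n r) J (0\<^sub>m r n) (1\<^sub>m r) (0\<^sub>m r n) (s \<cdot>\<^sub>m J) (0\<^sub>m n r) (0\<^sub>m n n)"
  have g: "gram T n = ?g" unfolding J_def by (rule gram_block3[OF r s])
  have gu: "?g * ?u = block3 n r (0\<^sub>m n n) (0\<^sub>m n r) (J * k) (0\<^sub>m r n) (1\<^sub>m r) f
      (s \<cdot>\<^sub>m (J * x)) (s \<cdot>\<^sub>m (J * b)) (s \<cdot>\<^sub>m (J * c))"
    by (subst block3_mult) (simp_all add: J1 left_mult_zero_mat[OF c(1)] left_mult_zero_mat[OF c(2)]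
        left_mult_zero_mat[OF c(3)] left_mult_zero_mat[OF c(4)] left_mult_zero_mat[OF c(5)]
        mult_smult_assoc_mat[of _ n n _ n] mult_smult_assoc_mat[of _ n n _ r] smult_carrier_mat
        right_mult_zero_mat[of _ n n] right_mult_zero_mat[of _ n r] left_add_zero_mat[of _ n n]
        right_add_zero_mat[of _ n n] left_add_zero_mat[of _ r n] right_add_zero_mat[of _ r n]
        left_add_zero_mat[of _ n r] right_add_zero_mat[of _ n r] left_mult_one_mat[of _ r n])
  have ut: "transpose_mat ?u = block3 n r (transpose_mat x) (0\<^sub>m n r) (0\<^sub>m n n) (transpose_mat b) (1\<^sub>m r)
      (0\<^sub>m r n) (transpose_mat c) (transpose_mat f) (transpose_mat k)"
    by (subst block3_transpose) simp_all
  have P: "transpose_mat x * (J * k) \<in> carrier_mat n n" "transpose_mat b * (J * k) \<in> carrier_mat r n"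
     "transpose_mat c * (J * k) \<in> carrier_mat n n" "transpose_mat f * f \<in> carrier_mat n n"
     "transpose_mat k * (J * x) \<in> carrier_mat n n" "transpose_mat k * (J * b) \<in> carrier_mat n r"
     "transpose_mat k * (J * c) \<in> carrier_mat n n"
    by (rule mult_carrier_mat[OF t(1) J1(4)] mult_carrier_mat[OF t(2) J1(4)]
        mult_carrier_mat[OF t(3) J1(4)] mult_carrier_mat[OF t(4) c(4)]
        mult_carrier_mat[OF t(5) J1(1)] mult_carrier_mat[OF t(5) J1(2)] mult_carrier_mat[OF t(5) J1(3)])+
  have ugu: "transpose_mat ?u * (?g * ?u) = block3 n r
      (0\<^sub>m n n) (0\<^sub>m n r) (transpose_mat x * (J * k))
      (0\<^sub>m r n) (1\<^sub>m r) (transpose_mat b * (J * k) + f)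
      (s \<cdot>\<^sub>m (transpose_mat k * (J * x))) (transpose_mat f + s \<cdot>\<^sub>m (transpose_mat k * (J * b)))
      (transpose_mat c * (J * k) + transpose_mat f * f + s \<cdot>\<^sub>m (transpose_mat k * (J * c)))"
    unfolding gu ut
    by (subst block3_mult) (simp_all add: J1 t P left_mult_zero_mat[OF c(4)] left_mult_zero_mat[OF J1(1)]
        left_mult_zero_mat[OF J1(2)] left_mult_zero_mat[OF J1(3)] left_mult_zero_mat[OF J1(4)]
        left_mult_zero_mat[OF smult_carrier_mat[OF J1(1)]]
        left_mult_zero_mat[OF smult_carrier_mat[OF J1(2)]]
        left_mult_zero_mat[OF smult_carrier_mat[OF J1(3)]]
        mult_smult_distrib[of _ n n _ n] mult_smult_distrib[of _ n n _ r]
        right_mult_zero_mat[of _ n n] right_mult_zero_mat[of _ n r] right_mult_zero_mat[of _ r n]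
        left_add_zero_mat[of _ n n]
        right_add_zero_mat[of _ n n] left_add_zero_mat[of _ r n] right_add_zero_mat[of _ r n]
        left_add_zero_mat[of _ n r] right_add_zero_mat[of _ n r] left_mult_one_mat[of _ r n]
        right_mult_one_mat[of _ n r])
  have "transpose_mat ?u * ?g * ?u = transpose_mat ?u * (?g * ?u)"
    by (rule assoc_mult_mat[of _ "n + r + n" "n + r + n" _ "n + r + n" _ "n + r + n"]) simp_all
  then have "?u \<in> isometries T n \<longleftrightarrow> transpose_mat ?u * (?g * ?u) = ?g"
    by (simp add: isometries_def m g)
  also have "\<dots> \<longleftrightarrow> transpose_mat x * (J * k) = J \<and>
    transpose_mat b * (J * k) + f = 0\<^sub>m r n \<and>
    s \<cdot>\<^sub>m (transpose_mat k * (J * x)) = s \<cdot>\<^sub>m J \<and>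
    transpose_mat f + s \<cdot>\<^sub>m (transpose_mat k * (J * b)) = 0\<^sub>m n r \<and>
    transpose_mat c * (J * k) + transpose_mat f * f + s \<cdot>\<^sub>m (transpose_mat k * (J * c)) = 0\<^sub>m n n"
    unfolding ugu by (subst block3_eq_iff) (use P in auto)
  finally show ?thesis .
qed


lemma mat_add_uminus: "A \<in> carrier_mat a b \<Longrightarrow> A + - A = 0\<^sub>m a b" for A :: "'a::ab_group_add mat"
  by (intro eq_matI) auto

lemma isometry_block3_iff:
  fixes x :: "'a::field mat"
  assumes r: "r = (if T = O_odd then 1 else 0)" and s: "s = (if T = Sp then - 1 else 1)"
    and c: "x \<in> carrier_mat n n" "v \<in> carrier_mat n r" "w \<in> carrier_mat n n"
      "f \<in> carrier_mat r n" "k \<in> carrier_mat n n"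
  defines "J \<equiv> antidiag n"
  shows "block3 n r x (x * v) (x * w) (0\<^sub>m r n) (1\<^sub>m r) f (0\<^sub>m n n) (0\<^sub>m n r) k \<in> isometries T n \<longleftrightarrow>
    transpose_mat x * (J * k) = J \<and>
    f = - (transpose_mat v * J) \<and>
    J * transpose_mat w + s \<cdot>\<^sub>m (w * J) = - (v * transpose_mat v)"
proof -
  have J: "J \<in> carrier_mat n n" "transpose_mat J = J" "J * J = 1\<^sub>m n" by (simp_all add: J_def)
  have s0: "s * s = 1" by (simp add: s)
  have Jk: "J * k \<in> carrier_mat n n" using J c by simp
  have xv: "x * v \<in> carrier_mat n r" "x * w \<in> carrier_mat n n" using c by simp_all
  have tc: "transpose_mat x \<in> carrier_mat n n" "transpose_mat v \<in> carrier_mat r n"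
    "transpose_mat w \<in> carrier_mat n n" "transpose_mat f \<in> carrier_mat n r"
    "transpose_mat k \<in> carrier_mat n n" using c by simp_all
  note iso = isometry_block3[OF r s c(1) xv c(4,5), folded J_def]
  show ?thesis
  proof (cases "transpose_mat x * (J * k) = J")
    case False
    then show ?thesis unfolding iso by simp
  next
    case True
    have kJx: "transpose_mat k * (J * x) = J"
    proof -
      have "transpose_mat (transpose_mat x * (J * k)) = transpose_mat (J * k) * x"
        by (subst transpose_mult[OF tc(1) Jk]) simp
      also have "transpose_mat (J * k) = transpose_mat k * J"
        by (subst transpose_mult[OF J(1) c(5)]) (simp add: J)
      also have "transpose_mat k * J * x = transpose_mat k * (J * x)"
        by (rule assoc_mult_mat[OF tc(5) J(1) c(1)])
      finally show ?thesis using True J by simp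
    qed
    have kJxA: "transpose_mat k * (J * (x * A)) = J * A" if A: "A \<in> carrier_mat n q" for A q
    proof -
      have "J * (x * A) = J * x * A" by (rule assoc_mult_mat[symmetric, OF J(1) c(1) A])
      also have "transpose_mat k * (J * x * A) = transpose_mat k * (J * x) * A"
        by (rule assoc_mult_mat[symmetric, OF tc(5) _ A]) (use J c in simp)
      finally show ?thesis by (simp add: kJx)
    qed
    have xAJk: "transpose_mat (x * A) * (J * k) = transpose_mat A * J"
      if A: "A \<in> carrier_mat n q" for A q
    proof -
      have "transpose_mat (x * A) * (J * k) = transpose_mat A * transpose_mat x * (J * k)"
        by (subst transpose_mult[OF c(1) A]) simp
      also have "\<dots> = transpose_mat A * (transpose_mat x * (J * k))"
        by (rule assoc_mult_mat[OF _ tc(1) Jk]) (use A in simp)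
      finally show ?thesis by (simp add: True)
    qed
    have vJ: "transpose_mat v * J \<in> carrier_mat r n" and Jv: "J * v \<in> carrier_mat n r"
      using c J by simp_all
    have f1: "transpose_mat v * J + f = 0\<^sub>m r n \<longleftrightarrow> f = - (transpose_mat v * J)"
    proof
      assume a: "transpose_mat v * J + f = 0\<^sub>m r n"
      show "f = - (transpose_mat v * J)"
      proof (rule eq_matI)
        fix i j assume "i < dim_row (- (transpose_mat v * J))" "j < dim_col (- (transpose_mat v * J))"
        then have ij: "i < r" "j < n" using vJ c J by auto
        then have "(transpose_mat v * J + f) $$ (i, j) = 0" using a by simp
        then show "f $$ (i, j) = (- (transpose_mat v * J)) $$ (i, j)"
          using ij vJ c J by (simp del: index_mult_mat(1) add: eq_neg_iff_add_eq_0 add.commute)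
      qed (use vJ c J in auto)
    next
      assume "f = - (transpose_mat v * J)"
      then show "transpose_mat v * J + f = 0\<^sub>m r n"
        using mat_add_uminus[OF vJ] by simp
    qed
    show ?thesis
    proof (cases "f = - (transpose_mat v * J)")
      case False
      then show ?thesis unfolding iso xAJk[OF c(2)] f1 by simp
    next
      case f: True
      have tf: "transpose_mat f = - (J * v)"
      proof -
        have "transpose_mat f = - transpose_mat (transpose_mat v * J)"
          unfolding f by (rule eq_matI) (use vJ in \<open>auto simp del: index_mult_mat(1)\<close>)
        then show ?thesis by (subst (asm) transpose_mult[OF tc(2) J(1)]) (simp add: J)
      qed
      have s_eq: "transpose_mat f + s \<cdot>\<^sub>m (J * v) = 0\<^sub>m n r"
      proof (cases "T = O_odd")
        case True
        have "1 \<cdot>\<^sub>m (J * v) = J * v" by (intro eq_matI) (auto simp del: index_mult_mat(1))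
        then show ?thesis unfolding tf using uminus_l_inv_mat[OF Jv] True by (simp add: s)
      next
        case False
        then show ?thesis unfolding tf using c J(1) by (intro eq_matI) (auto simp: r)
      qed
      have ff: "transpose_mat f * f = J * (v * transpose_mat v) * J"
      proof -
        have "transpose_mat f * f = (J * v) * (transpose_mat v * J)"
          unfolding tf unfolding f using Jv vJ by (subst uminus_mult_left_mat uminus_mult_right_mat; simp)+
        also have "\<dots> = (J * v) * transpose_mat v * J"
          by (rule assoc_mult_mat[symmetric, OF Jv tc(2) J(1)])
        also have "(J * v) * transpose_mat v = J * (v * transpose_mat v)"
          by (rule assoc_mult_mat[OF J(1) c(2) tc(2)])
        finally show ?thesis .
      qed
      let ?A = "J * transpose_mat w" and ?B = "v * transpose_mat v" and ?C = "s \<cdot>\<^sub>m (w * J)"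
      have ABC: "?A \<in> carrier_mat n n" "?B \<in> carrier_mat n n" "?C \<in> carrier_mat n n"
        using J c tc by simp_all
      let ?S = "?A + ?B + ?C"
      have S: "?S \<in> carrier_mat n n" using ABC by simp
      have JSJ: "J * (J * A * J) * J = A" if A: "A \<in> carrier_mat n n" for A
      proof -
        have "J * (J * A * J) * J = J * (J * A * J * J)"
          by (rule assoc_mult_mat[of _ n n _ n _ n]) (use A J in simp_all)
        also have "J * A * J * J = J * A * (J * J)"
          by (rule assoc_mult_mat[of _ n n _ n _ n]) (use A J in simp_all)
        also have "J * A * (J * J) = J * A" using A J by simp
        also have "J * (J * A) = A" unfolding J_def by (rule antidiag_cancel[OF A])
        finally show ?thesis .
      qed
      have "J * ?S * J = J * ?A * J + J * ?B * J + J * ?C * J"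
      proof -
        have M: "J * ?A \<in> carrier_mat n n" "J * ?B \<in> carrier_mat n n" "J * ?C \<in> carrier_mat n n"
          "?A + ?B \<in> carrier_mat n n" "J * ?A + J * ?B \<in> carrier_mat n n"
          by (rule mult_carrier_mat[OF J(1) ABC(1)] mult_carrier_mat[OF J(1) ABC(2)]
            mult_carrier_mat[OF J(1) ABC(3)] add_carrier_mat[OF ABC(2)]
            add_carrier_mat[OF mult_carrier_mat[OF J(1) ABC(2)]])+
        show ?thesis
          unfolding mult_add_distrib_mat[OF J(1) M(4) ABC(3)] mult_add_distrib_mat[OF J(1) ABC(1,2)]
            add_mult_distrib_mat[OF M(5,3) J(1)] add_mult_distrib_mat[OF M(1,2) J(1)] ..
      qed
      also have "J * ?A = transpose_mat w" unfolding J_def by (rule antidiag_cancel[OF tc(3)])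
      also have "J * ?C * J = s \<cdot>\<^sub>m (J * w)"
      proof -
        have "J * ?C * J = s \<cdot>\<^sub>m (J * (w * J) * J)"
          using J c by (simp add: mult_smult_distrib[of _ n n _ n] mult_smult_assoc_mat[of _ n n _ n])
        also have "J * (w * J) = J * w * J" by (rule assoc_mult_mat[symmetric, OF J(1) c(3) J(1)])
        also have "J * w * J * J = J * w * (J * J)"
          by (rule assoc_mult_mat[of _ n n _ n _ n]) (use c J in simp_all)
        also have "\<dots> = J * w" using J c by simp
        finally show ?thesis .
      qed
      finally have e: "J * ?S * J = transpose_mat w * J + transpose_mat f * f + s \<cdot>\<^sub>m (J * w)"
        unfolding ff .
      have "J * ?S * J = 0\<^sub>m n n \<longleftrightarrow> ?S = 0\<^sub>m n n"
      proof
        assume a: "J * ?S * J = 0\<^sub>m n n"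
        have "?S = J * (J * ?S * J) * J" by (rule JSJ[OF S, symmetric])
        also have "\<dots> = 0\<^sub>m n n" unfolding a using J by simp
        finally show "?S = 0\<^sub>m n n" .
      next
        assume a: "?S = 0\<^sub>m n n"
        show "J * ?S * J = 0\<^sub>m n n" unfolding a using J by simp
      qed
      also have "\<dots> \<longleftrightarrow> ?A + ?C = - ?B"
      proof
        assume a: "?S = 0\<^sub>m n n"
        show "?A + ?C = - ?B"
        proof (rule eq_matI)
          fix i j assume "i < dim_row (- ?B)" "j < dim_col (- ?B)"
          then have ij: "i < n" "j < n" using ABC by auto
          then have "?S $$ (i, j) = 0" using a by simp
          then show "(?A + ?C) $$ (i, j) = (- ?B) $$ (i, j)"
            using ij ABC J c by (simp del: index_mult_mat(1) index_smult_mat(1) add: eq_neg_iff_add_eq_0 ac_simps)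
        qed (use ABC J c in auto)
      next
        assume a: "?A + ?C = - ?B"
        show "?S = 0\<^sub>m n n"
        proof (rule eq_matI)
          fix i j assume "i < dim_row (0\<^sub>m n n :: 'a mat)" "j < dim_col (0\<^sub>m n n :: 'a mat)"
          then have ij: "i < n" "j < n" by auto
          then have "(?A + ?C) $$ (i, j) = (- ?B) $$ (i, j)" using a by simp
          then show "?S $$ (i, j) = (0\<^sub>m n n) $$ (i, j)"
            using ij ABC J c by (simp del: index_mult_mat(1) index_smult_mat(1) add: eq_neg_iff_add_eq_0 ac_simps)
        qed (use ABC J c in auto)
      qed
      finally have S0: "transpose_mat w * J + transpose_mat f * f + s \<cdot>\<^sub>m (J * w) = 0\<^sub>m n n \<longleftrightarrow> ?A + ?C = - ?B"
        unfolding e .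
      show ?thesis
        unfolding iso xAJk[OF c(2)] xAJk[OF c(3)] kJxA[OF c(2)] kJxA[OF c(3)] f1 kJx S0 s_eq
        using True f by simp
    qed
  qed
qed


lemma unitri_inverse:
  assumes x: "x \<in> unitri n"
  shows "\<exists>y\<in>carrier_mat n n. y * x = 1\<^sub>m n \<and> x * y = 1\<^sub>m n"
proof -
  have xc: "x \<in> carrier_mat n n" and ut: "upper_triangular x" and d: "\<And>i. i < n \<Longrightarrow> x $$ (i, i) = 1"
    using x by (auto simp: unitri_def)
  have "det x = prod_list (diag_mat x)" by (rule det_upper_triangular[OF ut xc])
  also have "\<dots> = 1" using xc d by (simp add: prod_list_diag_prod)
  finally have "x \<in> Units (ring_mat TYPE('a) n ())" by (intro det_non_zero_imp_unit[OF xc]) simp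
  then show ?thesis unfolding Units_def by (auto simp: ring_mat_simps)
qed

lemma unitri_block3:
  assumes r: "r \<le> 1" and u: "u \<in> unitri (n + r + n)"
  obtains x b c f k where "u = block3 n r x b c (0\<^sub>m r n) (1\<^sub>m r) f (0\<^sub>m n n) (0\<^sub>m n r) k"
    "x \<in> unitri n" "b \<in> carrier_mat n r" "c \<in> carrier_mat n n" "f \<in> carrier_mat r n" "k \<in> unitri n"
proof -
  have uc: "u \<in> carrier_mat (n + r + n) (n + r + n)"
    and ut: "\<And>i j. j < i \<Longrightarrow> i < n + r + n \<Longrightarrow> u $$ (i, j) = 0"
    and d: "\<And>i. i < n + r + n \<Longrightarrow> u $$ (i, i) = 1"
    using u by (auto simp: unitri_def)
  define x where "x = mat n n (\<lambda>(i, j). u $$ (i, j))"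
  define b where "b = mat n r (\<lambda>(i, j). u $$ (i, n + j))"
  define c where "c = mat n n (\<lambda>(i, j). u $$ (i, n + r + j))"
  define f where "f = mat r n (\<lambda>(i, j). u $$ (n + i, n + r + j))"
  define k where "k = mat n n (\<lambda>(i, j). u $$ (n + r + i, n + r + j))"
  show ?thesis
  proof (rule that)
    show "u = block3 n r x b c (0\<^sub>m r n) (1\<^sub>m r) f (0\<^sub>m n n) (0\<^sub>m n r) k" (is "_ = ?b")
    proof (rule eq_matI)
      fix i j assume "i < dim_row ?b" "j < dim_col ?b"
      then have ij: "i < n + r + n" "j < n + r + n" by (simp_all add: block3_def)
      have mid: "i = j" if "\<not> i < n" "i < n + r" "\<not> j < n" "j < n + r" using that r by linarith
      show "u $$ (i, j) = ?b $$ (i, j)"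
        using ij mid by (auto simp: block3_def x_def b_def c_def f_def k_def ut d)
    qed (use uc in \<open>simp_all add: block3_def\<close>)
  qed (auto simp: x_def b_def c_def f_def k_def unitri_def ut d intro!: upper_triangularI)
qed

lemma block3_unitri:
  assumes "x \<in> unitri n" "k \<in> unitri n" "b \<in> carrier_mat n r" "c \<in> carrier_mat n n" "f \<in> carrier_mat r n"
  shows "block3 n r x b c (0\<^sub>m r n) (1\<^sub>m r) f (0\<^sub>m n n) (0\<^sub>m n r) k \<in> unitri (n + r + n)" (is "?u \<in> _")
proof -
  have x: "\<And>i j. j < i \<Longrightarrow> i < n \<Longrightarrow> x $$ (i, j) = 0" "\<And>i. i < n \<Longrightarrow> x $$ (i, i) = 1"
    and k: "\<And>i j. j < i \<Longrightarrow> i < n \<Longrightarrow> k $$ (i, j) = 0" "\<And>i. i < n \<Longrightarrow> k $$ (i, i) = 1"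
    using assms by (auto simp: unitri_def)
  have "upper_triangular ?u"
    by (rule upper_triangularI) (auto simp: block3_def x k)
  moreover have "?u $$ (i, i) = 1" if "i < n + r + n" for i
    using that by (auto simp: block3_def x k)
  ultimately show ?thesis by (simp add: unitri_def)
qed

text \<open>The explicit description of \<open>Uset\<close>, with \<open>y\<close> the inverse of \<open>x\<close>.\<close>

lemma Uset_explicit:
  fixes T :: gtype and n :: nat
  defines "r \<equiv> if T = O_odd then 1 else 0" and "J \<equiv> antidiag n"
  shows "(Uset T n :: 'a::field mat set) =
    {block3 n r x (x * v) (x * w) (0\<^sub>m r n) (1\<^sub>m r) (- (transpose_mat v * J))
        (0\<^sub>m n n) (0\<^sub>m n r) (J * transpose_mat y * J) | x y v w.
      x \<in> unitri n \<and> y \<in> unitri n \<and> x * y = 1\<^sub>m n \<and> v \<in> carrier_mat n r \<and> w \<in> carrier_mat n n \<and>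
      (case T of
         Sp \<Rightarrow> J * transpose_mat w - w * J = 0\<^sub>m n n
       | O_even \<Rightarrow> J * transpose_mat w + w * J = 0\<^sub>m n n
       | O_odd \<Rightarrow> J * transpose_mat w + w * J = - (v * transpose_mat v))}"
    (is "_ = ?R")
proof -
  define s :: 'a where "s = (if T = Sp then - 1 else 1)"
  have r: "r = (if T = O_odd then 1 else 0)" by (simp add: r_def)
  have m: "msize T n = n + r + n" by (cases T) (auto simp: msize_def r_def)
  have J: "J \<in> carrier_mat n n" "transpose_mat J = J" "J * J = (1\<^sub>m n :: 'a mat)" by (simp_all add: J_def)
  have cond: "J * transpose_mat w + s \<cdot>\<^sub>m (w * J) = - (v * transpose_mat v) \<longleftrightarrow>
      (case T of
         Sp \<Rightarrow> J * transpose_mat w - w * J = 0\<^sub>m n n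
       | O_even \<Rightarrow> J * transpose_mat w + w * J = 0\<^sub>m n n
       | O_odd \<Rightarrow> J * transpose_mat w + w * J = - (v * transpose_mat v))"
    if "v \<in> carrier_mat n r" "w \<in> carrier_mat n n" for v w :: "'a mat"
  proof -
    have wJ: "w * J \<in> carrier_mat n n" using that J by simp
    have "v * transpose_mat v = 0\<^sub>m n n" if "r = 0"
      using that \<open>v \<in> carrier_mat n r\<close> by (intro eq_matI) (auto simp: scalar_prod_def)
    moreover have "- (0\<^sub>m n n :: 'a mat) = 0\<^sub>m n n" by (intro eq_matI) auto
    moreover have "(- 1) \<cdot>\<^sub>m (w * J) = - (w * J)"
      by (intro eq_matI) (auto simp del: index_mult_mat(1))
    moreover have "J * transpose_mat w + - (w * J) = J * transpose_mat w - w * J"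
      using wJ J that by (intro eq_matI) (auto simp del: index_mult_mat(1))
    moreover have "1 \<cdot>\<^sub>m (w * J) = w * J"
      by (intro eq_matI) (auto simp del: index_mult_mat(1))
    ultimately show ?thesis by (cases T) (simp_all add: s_def r_def)
  qed
  show ?thesis
  proof (intro equalityI subsetI)
    fix u :: "'a mat" assume "u \<in> Uset T n"
    then have iso: "u \<in> isometries T n" and "u \<in> unitri (n + r + n)" by (auto simp: Uset_def m)
    then obtain x b c f k where
      u: "u = block3 n r x b c (0\<^sub>m r n) (1\<^sub>m r) f (0\<^sub>m n n) (0\<^sub>m n r) k"
      and xk: "x \<in> unitri n" "k \<in> unitri n"
      and bcf: "b \<in> carrier_mat n r" "c \<in> carrier_mat n n" "f \<in> carrier_mat r n"
      using unitri_block3[of r u n] by (metis r_def le_refl zero_le)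
    have xc: "x \<in> carrier_mat n n" and kc: "k \<in> carrier_mat n n" using xk by (auto simp: unitri_def)
    obtain y where y: "y \<in> carrier_mat n n" "y * x = 1\<^sub>m n" "x * y = 1\<^sub>m n"
      using unitri_inverse[OF xk(1)] by blast
    have xy: "x * (y * a) = a" if "a \<in> carrier_mat n q" for a q
      using assoc_mult_mat[OF xc y(1) that] y that by simp
    define v where "v = y * b"
    define w where "w = y * c"
    have vw: "v \<in> carrier_mat n r" "w \<in> carrier_mat n n" using y bcf by (simp_all add: v_def w_def)
    have bc: "b = x * v" "c = x * w" using xy bcf by (simp_all add: v_def w_def)
    have eqs: "transpose_mat x * (J * k) = J" "f = - (transpose_mat v * J)"
      "J * transpose_mat w + s \<cdot>\<^sub>m (w * J) = - (v * transpose_mat v)"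
      using iso isometry_block3_iff[OF r s_def xc vw bcf(3) kc] by (simp_all add: u bc J_def)
    have yx: "transpose_mat y * transpose_mat x = 1\<^sub>m n"
      using transpose_mult[OF xc y(1)] y by simp
    have Jk: "J * k \<in> carrier_mat n n" using J kc by simp
    have "transpose_mat y * J = transpose_mat y * (transpose_mat x * (J * k))" by (simp add: eqs)
    also have "\<dots> = transpose_mat y * transpose_mat x * (J * k)"
      by (rule assoc_mult_mat[symmetric, of _ n n _ n _ n]) (use y xc Jk in simp_all)
    also have "\<dots> = J * k" unfolding yx by (rule left_mult_one_mat[OF Jk])
    finally have yJ: "transpose_mat y * J = J * k" .
    have "J * transpose_mat y * J = J * (transpose_mat y * J)"
      by (rule assoc_mult_mat[of _ n n _ n _ n]) (use y J in simp_all)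
    also have "\<dots> = J * (J * k)" by (simp only: yJ)
    also have "\<dots> = k" unfolding J_def by (rule antidiag_cancel[OF kc])
    finally have k: "k = J * transpose_mat y * J" ..
    have "y = J * transpose_mat k * J"
    proof -
      have "transpose_mat k = J * y * J"
      proof -
        have "transpose_mat k = transpose_mat J * transpose_mat (J * transpose_mat y)"
          unfolding k by (rule transpose_mult[of _ n n _ n]) (use J y in simp_all)
        also have "transpose_mat (J * transpose_mat y) = y * J"
          using transpose_mult[of J n n "transpose_mat y" n] J y by simp
        also have "transpose_mat J * (y * J) = J * y * J"
          unfolding J(2) by (rule assoc_mult_mat[symmetric, of _ n n _ n _ n]) (use J y in simp_all)
        finally show ?thesis .
      qed
      then have "J * transpose_mat k * J = J * (J * y * J) * J" by simp
      also have "J * (J * y * J) = y * J"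
      proof -
        have "J * (J * y * J) = J * (J * (y * J))"
          by (subst assoc_mult_mat[of _ n n _ n _ n]) (use J y in simp_all)
        also have "\<dots> = y * J" unfolding J_def by (rule antidiag_cancel[of _ _ n]) (use y in simp)
        finally show ?thesis .
      qed
      also have "y * J * J = y * (J * J)"
        by (rule assoc_mult_mat[of _ n n _ n _ n]) (use J y in simp_all)
      finally show ?thesis using J y by simp
    qed
    then have yu: "y \<in> unitri n" using unitri_flip[OF xk(2)] by (simp add: J_def)
    show "u \<in> ?R"
      unfolding mem_Collect_eq
      by (intro exI[of _ x] exI[of _ y] exI[of _ v] exI[of _ w])
        (use u bc eqs k xk yu y vw cond[OF vw] in simp)
  next
    fix u :: "'a mat" assume "u \<in> ?R"
    then obtain x y v w where
      u: "u = block3 n r x (x * v) (x * w) (0\<^sub>m r n) (1\<^sub>m r) (- (transpose_mat v * J))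
        (0\<^sub>m n n) (0\<^sub>m n r) (J * transpose_mat y * J)"
      and xy: "x \<in> unitri n" "y \<in> unitri n" "x * y = 1\<^sub>m n"
      and vw: "v \<in> carrier_mat n r" "w \<in> carrier_mat n n"
      and cd: "case T of
         Sp \<Rightarrow> J * transpose_mat w - w * J = 0\<^sub>m n n
       | O_even \<Rightarrow> J * transpose_mat w + w * J = 0\<^sub>m n n
       | O_odd \<Rightarrow> J * transpose_mat w + w * J = - (v * transpose_mat v)"
      by blast
    have c: "x \<in> carrier_mat n n" "y \<in> carrier_mat n n" using xy by (auto simp: unitri_def)
    have yx: "y * x = 1\<^sub>m n" by (rule mat_mult_left_right_inverse[OF c xy(3)])
    let ?k = "J * transpose_mat y * J"
    have k: "?k \<in> unitri n" unfolding J_def by (rule unitri_flip[OF xy(2)])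
    have kc: "?k \<in> carrier_mat n n" using k by (auto simp: unitri_def)
    have vJ: "- (transpose_mat v * J) \<in> carrier_mat r n" using vw J by simp
    have "J * ?k = transpose_mat y * J"
    proof -
      have "J * ?k = J * (J * (transpose_mat y * J))"
        by (subst assoc_mult_mat[of _ n n _ n _ n]) (use J c in simp_all)
      also have "\<dots> = transpose_mat y * J" unfolding J_def by (rule antidiag_cancel[of _ _ n]) (use c in simp)
      finally show ?thesis .
    qed
    then have "transpose_mat x * (J * ?k) = transpose_mat x * (transpose_mat y * J)" by simp
    also have "\<dots> = transpose_mat x * transpose_mat y * J"
      by (rule assoc_mult_mat[symmetric, of _ n n _ n _ n]) (use J c in simp_all)
    also have "transpose_mat x * transpose_mat y = 1\<^sub>m n"
      using transpose_mult[OF c(2,1)] yx by simp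
    finally have xJk: "transpose_mat x * (J * ?k) = J" using J by simp
    have "u \<in> isometries T n"
      using isometry_block3_iff[OF r s_def c(1) vw vJ kc] xJk cd cond[OF vw] by (simp add: u J_def)
    moreover have "u \<in> unitri (msize T n)"
      unfolding u m by (rule block3_unitri) (use xy k vw vJ c in simp_all)
    ultimately show "u \<in> Uset T n" by (simp add: Uset_def)
  qed
qed

end

theory Submission
  imports Defs "HOL-Algebra.Multiplicative_Group"
begin

text \<open>
  Call two matrices equivalent if they lie in the same double coset of the unitriangular group \<open>U\<^sub>m\<close>.  Every
  matrix is equivalent to exactly one matrix with at most one nonzero entry in each row and column.  For
  \<open>x \<in> U\<close> the adjoint \<open>N \<mapsto> N*\<close> of the form satisfies \<open>-(x - 1)* = x\<^sup>-\<^sup>1 (x - 1)\<close>, so the normal form \<open>r\<close> of \<open>x - 1\<close>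
  equals \<open>-r*\<close>, that is, \<open>r\<close> is the matrix of a basic pair.  Hence superclass functions are the
  functions on \<open>U\<close> which only depend on the equivalence class of \<open>x - 1\<close>.

  For closure under convolution, consider the permutations \<open>\<rho>\<close> of \<open>U\<^sub>m\<close> with \<open>\<rho> x - \<rho> y\<close> equivalent to \<open>x - y\<close> for
  all \<open>x, y\<close>.  They form a \<open>p\<close>-group normalized by the involution \<open>\<sigma> x = (x*)\<^sup>-\<^sup>1\<close>, whose fixed points are \<open>U\<close>.
  If \<open>z, z' \<in> U\<close> and \<open>z - 1, z' - 1\<close> are equivalent, the argument of Glauberman's lemma (\<open>p\<close> is odd) gives such a
  \<open>\<rho>\<close> with \<open>\<rho> 1 = 1\<close>, \<open>\<rho> z = z'\<close> that commutes with \<open>\<sigma>\<close>, hence permutes \<open>U\<close>; substituting \<open>\<rho> x\<close> for \<open>x\<close> in the sum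
  defining \<open>(\<xi> \<star> \<zeta>) z'\<close> turns it into the one for \<open>z\<close>.

  Commutativity holds because superclass functions are class functions.  The algebra is closed under
  \<open>\<xi> \<mapsto> (x \<mapsto> cnj (\<xi> (x\<^sup>-\<^sup>1)))\<close>, which is the adjoint for the Hermitian inner product, so orthogonal complements of
  left ideals are left ideals, and a maximal family of orthogonal minimal left ideals spans.
\<close>

section \<open>Semisimplicity of star-closed rings of functions\<close>

definition inner_on :: "'b set \<Rightarrow> ('b \<Rightarrow> complex) \<Rightarrow> ('b \<Rightarrow> complex) \<Rightarrow> complex" where
  "inner_on X f g = (\<Sum>x\<in>X. f x * cnj (g x))"

definition sqnorm_on :: "'b set \<Rightarrow> ('b \<Rightarrow> complex) \<Rightarrow> real" where
  "sqnorm_on X f = (\<Sum>x\<in>X. (cmod (f x))\<^sup>2)"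

text \<open>Members have nonzero norm rather than norm one, so expansion coefficients carry a
  division by \<open>sqnorm_on\<close>.\<close>

definition orthogonal_family :: "'b set \<Rightarrow> ('b \<Rightarrow> complex) set \<Rightarrow> bool" where
  "orthogonal_family X F \<longleftrightarrow> (\<forall>f\<in>F. sqnorm_on X f \<noteq> 0) \<and> pairwise (\<lambda>f g. inner_on X f g = 0) F"

lemma inner_on_self: "inner_on X f f = of_real (sqnorm_on X f)"
  unfolding inner_on_def sqnorm_on_def of_real_sum complex_norm_square by (simp only:)

lemma sqnorm_on_nonneg: "0 \<le> sqnorm_on X f"
  by (simp add: sqnorm_on_def sum_nonneg)

lemma sqnorm_on_eq_0_iff: "finite X \<Longrightarrow> sqnorm_on X f = 0 \<longleftrightarrow> (\<forall>x\<in>X. f x = 0)"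
  by (simp add: sqnorm_on_def sum_nonneg_eq_0_iff)

lemma inner_on_cnj: "cnj (inner_on X f g) = inner_on X g f"
  by (simp add: inner_on_def mult.commute)

lemma inner_on_cong:
  "(\<And>x. x \<in> X \<Longrightarrow> f x = f' x) \<Longrightarrow> (\<And>x. x \<in> X \<Longrightarrow> g x = g' x) \<Longrightarrow> inner_on X f g = inner_on X f' g'"
  by (simp add: inner_on_def)

lemma inner_on_add_left: "inner_on X (\<lambda>x. f x + g x) h = inner_on X f h + inner_on X g h"
  by (simp add: inner_on_def distrib_right sum.distrib)

lemma inner_on_diff_left: "inner_on X (\<lambda>x. f x - g x) h = inner_on X f h - inner_on X g h"
  by (simp add: inner_on_def left_diff_distrib sum_subtractf)

lemma inner_on_sum_left:
  "inner_on X (\<lambda>x. \<Sum>f\<in>F. a f * \<phi> f x) h = (\<Sum>f\<in>F. a f * inner_on X (\<phi> f) h)"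
  unfolding inner_on_def sum_distrib_right sum_distrib_left
  by (subst sum.swap) (simp add: mult.assoc)

lemma inner_on_sum_right:
  "inner_on X h (\<lambda>x. \<Sum>f\<in>F. a f * \<phi> f x) = (\<Sum>f\<in>F. cnj (a f) * inner_on X h (\<phi> f))"
  using arg_cong[OF inner_on_sum_left[of X a \<phi> F h], of cnj] by (simp add: inner_on_cnj)

lemma inner_on_orthogonal_sum:
  assumes "finite F" "orthogonal_family X F" "g \<in> F"
  shows "inner_on X (\<lambda>x. \<Sum>f\<in>F. a f * f x) g = a g * of_real (sqnorm_on X g)"
proof -
  have "(\<Sum>f\<in>F. a f * inner_on X f g) = (\<Sum>f\<in>F. if f = g then a g * inner_on X g g else 0)"
    using assms by (intro sum.cong) (auto simp: orthogonal_family_def pairwise_def)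
  then show ?thesis using assms by (simp add: inner_on_sum_left[of X a "\<lambda>f. f"] inner_on_self)
qed

text \<open>Bessel's inequality for the point mass at \<open>x\<close>. With \<open>S\<close> the
  left side, \<open>g\<close> is the orthogonal projection of the point mass to the span of
  \<open>F\<close>; its value at \<open>x\<close> and its squared norm are both \<open>S\<close>,
  whence \<open>S\<^sup>2 \<le> S\<close>.\<close>

lemma bessel_point:
  assumes X: "finite X" "x \<in> X" and F: "finite F" "orthogonal_family X F"
  shows "(\<Sum>f\<in>F. (cmod (f x))\<^sup>2 / sqnorm_on X f) \<le> 1"
proof -
  define S where "S = (\<Sum>f\<in>F. (cmod (f x))\<^sup>2 / sqnorm_on X f)"
  define a where "a f = cnj (f x) / of_real (sqnorm_on X f)" for f
  define g where "g y = (\<Sum>f\<in>F. a f * f y)" for y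
  have summand: "a f * f x = of_real ((cmod (f x))\<^sup>2 / sqnorm_on X f)" for f
    unfolding a_def of_real_divide complex_norm_square by (simp only: mult.commute times_divide_eq_right)
  have gx: "g x = of_real S"
    by (simp only: g_def S_def summand of_real_sum)
  have "inner_on X g g = (\<Sum>f\<in>F. cnj (a f) * inner_on X g f)"
    using inner_on_sum_right[of X g a "\<lambda>f. f"] by (simp add: g_def[abs_def])
  also have "\<dots> = (\<Sum>f\<in>F. cnj (a f * f x))"
  proof (rule sum.cong[OF refl])
    fix f assume f: "f \<in> F"
    then have "sqnorm_on X f \<noteq> 0" using F by (simp add: orthogonal_family_def)
    then show "cnj (a f) * inner_on X g f = cnj (a f * f x)"
      using inner_on_orthogonal_sum[OF F f, of a] by (simp add: g_def[abs_def] a_def)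
  qed
  also have "\<dots> = of_real S" by (simp only: summand S_def of_real_sum complex_cnj_complex_of_real)
  finally have gg: "sqnorm_on X g = S" by (simp only: inner_on_self of_real_eq_iff)
  have "S\<^sup>2 = (cmod (g x))\<^sup>2" by (simp add: gx)
  also have "\<dots> \<le> sqnorm_on X g"
    unfolding sqnorm_on_def using X by (intro member_le_sum) auto
  finally have "S * S \<le> 1 * S" by (simp add: gg power2_eq_square)
  then show ?thesis unfolding S_def[symmetric]
    using sqnorm_on_nonneg[of X g] gg by (cases "S = 0") (auto simp: mult_le_cancel_right)
qed

text \<open>For each \<open>f\<close> in \<open>F\<close> the squared values divided by the squared
  norm add up to 1; exchanging the sums and applying Bessel at every point counts \<open>F\<close>.
  This stands in for a dimension argument.\<close>

lemma card_orthogonal_family_finite: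
  assumes X: "finite X" and F: "finite F" "orthogonal_family X F"
  shows "card F \<le> card X"
proof -
  have "real (card F) = (\<Sum>f\<in>F. sqnorm_on X f / sqnorm_on X f)"
    using F by (simp add: orthogonal_family_def)
  also have "\<dots> = (\<Sum>f\<in>F. \<Sum>x\<in>X. (cmod (f x))\<^sup>2 / sqnorm_on X f)"
    by (rule sum.cong[OF refl], subst (1) sqnorm_on_def) (simp add: sum_divide_distrib)
  also have "\<dots> = (\<Sum>x\<in>X. \<Sum>f\<in>F. (cmod (f x))\<^sup>2 / sqnorm_on X f)" by (rule sum.swap)
  also have "\<dots> \<le> (\<Sum>x\<in>X. 1)" by (intro sum_mono bessel_point X F)
  finally show ?thesis by simp
qed

lemma orthogonal_family_subset: "orthogonal_family X F \<Longrightarrow> F' \<subseteq> F \<Longrightarrow> orthogonal_family X F'"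
  unfolding orthogonal_family_def by (meson pairwise_subset subsetD)

text \<open>An infinite family would contain a finite one with \<open>card X + 1\<close>
  members.\<close>

lemma card_orthogonal_family:
  assumes X: "finite X" and F: "orthogonal_family X F"
  shows "finite F \<and> card F \<le> card X"
proof (cases "finite F")
  case False
  then obtain F' where "F' \<subseteq> F" "finite F'" "card F' = Suc (card X)"
    using infinite_arbitrarily_large by blast
  then show ?thesis
    using card_orthogonal_family_finite[OF X \<open>finite F'\<close> orthogonal_family_subset[OF F \<open>F' \<subseteq> F\<close>]] by simp
qed (use card_orthogonal_family_finite[OF X] F in simp)

text \<open>\<open>scalar\<close> realises multiplication by a complex number as left multiplication
  by a ring element, so left ideals are complex subspaces; \<open>adjoint\<close> makes orthogonal
  complements of left ideals left ideals.\<close>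

locale star_function_ring = ring R for R :: "('b \<Rightarrow> complex, 'c) ring_scheme" (structure) +
  fixes X :: "'b set"
  assumes finite_X: "finite X"
    and carrier_subset: "carrier R \<subseteq> X \<rightarrow>\<^sub>E UNIV"
    and add_pointwise: "f \<in> carrier R \<Longrightarrow> g \<in> carrier R \<Longrightarrow> f \<oplus> g = (\<lambda>x\<in>X. f x + g x)"
    and scalar: "\<exists>u\<in>carrier R. \<forall>f\<in>carrier R. u \<otimes> f = (\<lambda>x\<in>X. c * f x)"
    and adjoint: "f \<in> carrier R \<Longrightarrow>
      \<exists>f'\<in>carrier R. \<forall>g\<in>carrier R. \<forall>h\<in>carrier R. inner_on X (f \<otimes> g) h = inner_on X g (f' \<otimes> h)"
begin

lemma zero_pointwise: "\<zero> = (\<lambda>x\<in>X. 0)"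
proof
  fix x
  have e: "\<zero> \<in> X \<rightarrow>\<^sub>E UNIV" by (rule subsetD[OF carrier_subset zero_closed])
  have "\<zero> x = (\<zero> \<oplus> \<zero>) x" by (simp only: l_zero zero_closed)
  also have "\<dots> = (\<lambda>x\<in>X. \<zero> x + \<zero> x) x" by (simp only: add_pointwise[OF zero_closed zero_closed])
  finally have *: "\<zero> x = (\<lambda>x\<in>X. \<zero> x + \<zero> x) x" .
  show "\<zero> x = (\<lambda>x\<in>X. 0) x"
  proof (cases "x \<in> X")
    case True
    then have "\<zero> x = \<zero> x + \<zero> x" using * by (simp only: restrict_apply if_True)
    then have "\<zero> x = 0" by (rule iffD1[OF add_0_iff])
    then show ?thesis using True by simp
  next
    case False
    then show ?thesis using PiE_arb[OF e False] by simp
  qed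
qed

lemma eq_zero_iff:
  assumes "f \<in> carrier R"
  shows "f = \<zero> \<longleftrightarrow> sqnorm_on X f = 0"
proof -
  have ext: "g \<in> extensional X" if "g \<in> carrier R" for g
    using subsetD[OF carrier_subset that] by (simp add: PiE_def)
  have "f = \<zero> \<longleftrightarrow> (\<forall>x\<in>X. f x = \<zero> x)"
    using extensionalityI[OF ext[OF assms] ext[OF zero_closed]] by blast
  also have "\<dots> \<longleftrightarrow> (\<forall>x\<in>X. f x = 0)" unfolding zero_pointwise by simp
  finally show ?thesis unfolding sqnorm_on_eq_0_iff[OF finite_X] .
qed

lemma minus_pointwise:
  assumes f: "f \<in> carrier R" "g \<in> carrier R" and x: "x \<in> X"
  shows "(f \<ominus> g) x = f x - g x"
proof -
  have "f x = ((f \<ominus> g) \<oplus> g) x" using f by (simp add: minus_eq add.m_assoc l_neg)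
  also have "\<dots> = (f \<ominus> g) x + g x"
    using add_pointwise[of "f \<ominus> g" g] f x by simp
  finally show ?thesis by (simp only: eq_diff_eq)
qed

lemma a_inv_pointwise:
  assumes f: "f \<in> carrier R" and x: "x \<in> X"
  shows "(\<ominus> f) x = - f x"
proof -
  have "(\<ominus> f \<oplus> f) x = \<zero> x" using f by (simp add: l_neg)
  then show ?thesis
    using f x unfolding zero_pointwise by (simp add: add_pointwise add_eq_0_iff2)
qed

lemma finsum_pointwise:
  assumes "finite I" "\<phi> \<in> I \<rightarrow> carrier R"
  shows "(\<Oplus>i\<in>I. \<phi> i) = (\<lambda>x\<in>X. \<Sum>i\<in>I. \<phi> i x)"
  using assms
proof (induction I rule: finite_induct)
  case (insert i I)
  then have \<phi>: "\<phi> \<in> I \<rightarrow> carrier R" and i: "\<phi> i \<in> carrier R" by auto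
  note c = i finsum_closed[OF \<phi>]
  have "(\<Oplus>i\<in>insert i I. \<phi> i) = \<phi> i \<oplus> (\<Oplus>i\<in>I. \<phi> i)"
    using insert by simp
  also have "\<dots> = (\<lambda>x\<in>X. \<phi> i x + (\<Oplus>i\<in>I. \<phi> i) x)" by (rule add_pointwise[OF c])
  also have "\<dots> = (\<lambda>x\<in>X. \<Sum>i\<in>insert i I. \<phi> i x)"
    by (rule restrict_ext) (use insert in auto)
  finally show ?case .
qed (simp add: zero_pointwise)

section \<open>Left ideals, orthogonal projection and minimality\<close>

lemma left_idealD:
  assumes "left_ideal I R"
  shows "I \<subseteq> carrier R" "\<zero> \<in> I" "f \<in> I \<Longrightarrow> g \<in> I \<Longrightarrow> f \<oplus> g \<in> I"
    "f \<in> I \<Longrightarrow> g \<in> I \<Longrightarrow> f \<ominus> g \<in> I" "f \<in> carrier R \<Longrightarrow> g \<in> I \<Longrightarrow> f \<otimes> g \<in> I"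
    "f \<in> I \<Longrightarrow> (\<lambda>x\<in>X. c * f x) \<in> I"
proof -
  interpret I: additive_subgroup I R using assms by (simp add: left_ideal_def)
  show "I \<subseteq> carrier R" "\<zero> \<in> I" "f \<in> I \<Longrightarrow> g \<in> I \<Longrightarrow> f \<oplus> g \<in> I" by auto
  show "f \<in> I \<Longrightarrow> g \<in> I \<Longrightarrow> f \<ominus> g \<in> I" by (simp add: minus_eq I.a_inv_closed)
  show *: "f \<in> carrier R \<Longrightarrow> g \<in> I \<Longrightarrow> f \<otimes> g \<in> I" for f g using assms by (simp add: left_ideal_def)
  show "f \<in> I \<Longrightarrow> (\<lambda>x\<in>X. c * f x) \<in> I"
    using scalar[of c] * by (metis I.a_Hcarr)
qed

lemma left_ideal_sum:
  assumes I: "left_ideal I R" and "finite F" "F \<subseteq> I"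
  shows "(\<lambda>x\<in>X. \<Sum>f\<in>F. a f * f x) \<in> I"
  using assms(2,3)
proof (induction F rule: finite_induct)
  case empty
  then show ?case using left_idealD(2)[OF I] by (simp only: zero_pointwise sum.empty)
next
  case (insert g F)
  then have gI: "(\<lambda>x\<in>X. a g * g x) \<in> I" and F: "(\<lambda>x\<in>X. \<Sum>f\<in>F. a f * f x) \<in> I"
    using left_idealD(6)[OF I] by blast+
  have "(\<lambda>x\<in>X. a g * g x) \<oplus> (\<lambda>x\<in>X. \<Sum>f\<in>F. a f * f x) = (\<lambda>x\<in>X. \<Sum>f\<in>insert g F. a f * f x)"
    using gI F left_idealD(1)[OF I] insert by (subst add_pointwise) (auto intro!: restrict_ext)
  then show ?case using left_idealD(3)[OF I gI F] by (simp only:)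
qed

text \<open>For a left ideal this is its complex dimension; orthogonal families have at most
  \<open>card X\<close> members, so the maximum exists.\<close>

definition rank :: "('b \<Rightarrow> complex) set \<Rightarrow> nat" where
  "rank I = (GREATEST k. \<exists>F\<subseteq>I. orthogonal_family X F \<and> card F = k)"

lemma card_le_rank:
  assumes "F \<subseteq> I" "orthogonal_family X F"
  shows "card F \<le> rank I"
  unfolding rank_def
  by (rule Greatest_le_nat[where b = "card X"]) (use assms card_orthogonal_family[OF finite_X] in auto)

lemma rank_attained: "\<exists>F\<subseteq>I. orthogonal_family X F \<and> card F = rank I"
  unfolding rank_def
proof (rule GreatestI_ex_nat[where b = "card X"])
  show "\<exists>k. \<exists>F\<subseteq>I. orthogonal_family X F \<and> card F = k"
    by (intro exI[of _ 0] exI[of _ "{}"]) (simp add: orthogonal_family_def)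
qed (use card_orthogonal_family[OF finite_X] in auto)

lemma orthogonal_family_insert:
  assumes F: "orthogonal_family X F" and v: "sqnorm_on X v \<noteq> 0" "\<And>f. f \<in> F \<Longrightarrow> inner_on X v f = 0"
  shows "orthogonal_family X (insert v F)" "card (insert v F) = Suc (card F)"
proof -
  have "v \<notin> F" using v(1) v(2)[of v] by (auto simp: inner_on_self)
  then show "card (insert v F) = Suc (card F)" using card_orthogonal_family[OF finite_X F] by simp
  have "inner_on X f v = 0" if "f \<in> F" for f
    using v(2)[OF that] inner_on_cnj[of X v f] by simp
  then show "orthogonal_family X (insert v F)"
    using F v by (auto simp: orthogonal_family_def pairwise_insert)
qed

text \<open>An orthogonal family in \<open>I\<close> with \<open>rank I\<close> members spans
  \<open>I\<close>, so the orthogonal expansion along it is the projection to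
  \<open>I\<close>.\<close>

lemma left_ideal_projection:
  assumes I: "left_ideal I R" and f: "f \<in> carrier R"
  shows "\<exists>g\<in>I. \<forall>u\<in>I. inner_on X (f \<ominus> g) u = 0"
proof -
  obtain F where F: "F \<subseteq> I" "orthogonal_family X F" "card F = rank I" using rank_attained by blast
  have fin: "finite F" using card_orthogonal_family[OF finite_X F(2)] by simp
  define P where "P f = (\<lambda>x\<in>X. \<Sum>h\<in>F. inner_on X f h / of_real (sqnorm_on X h) * h x)" for f
  have PI: "P f \<in> I" for f unfolding P_def by (rule left_ideal_sum[OF I fin F(1)])
  have Pc: "P f \<in> carrier R" for f using PI left_idealD(1)[OF I] by auto
  have perp: "inner_on X (f \<ominus> P f) h = 0" if "f \<in> carrier R" "h \<in> F" for f h
  proof -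
    have "inner_on X (f \<ominus> P f) h = inner_on X (\<lambda>x. f x - P f x) h"
      by (rule inner_on_cong) (simp_all add: minus_pointwise that Pc)
    also have "\<dots> = inner_on X f h -
        inner_on X (\<lambda>x. \<Sum>h\<in>F. inner_on X f h / of_real (sqnorm_on X h) * h x) h"
      unfolding inner_on_diff_left by (intro arg_cong2[where f = minus] refl inner_on_cong) (simp_all add: P_def)
    also have "\<dots> = 0"
      using F(2) that(2) by (subst inner_on_orthogonal_sum[OF fin F(2) that(2)]) (simp add: orthogonal_family_def)
    finally show ?thesis .
  qed
  show ?thesis
  proof (intro bexI[of _ "P f"] ballI PI)
    fix u assume u: "u \<in> I"
    then have uc: "u \<in> carrier R" using left_idealD(1)[OF I] by auto
    \<comment> \<open>A nonzero residual of \<open>u\<close> would enlarge the family beyond the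
      rank, so \<open>u\<close> equals its own expansion.\<close>
    have "sqnorm_on X (u \<ominus> P u) = 0"
    proof (rule ccontr)
      assume "sqnorm_on X (u \<ominus> P u) \<noteq> 0"
      note * = orthogonal_family_insert[OF F(2) this perp[OF uc]]
      have "insert (u \<ominus> P u) F \<subseteq> I" using F(1) left_idealD(4)[OF I u PI] by simp
      from card_le_rank[OF this *(1)] *(2) F(3) show False by simp
    qed
    then have "u x = P u x" if "x \<in> X" for x
      using that by (simp add: sqnorm_on_eq_0_iff[OF finite_X] minus_pointwise uc Pc)
    then have "inner_on X (f \<ominus> P f) u =
        inner_on X (f \<ominus> P f) (\<lambda>x. \<Sum>h\<in>F. inner_on X u h / of_real (sqnorm_on X h) * h x)"
      by (intro inner_on_cong) (simp_all add: P_def)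
    also have "\<dots> = 0" using inner_on_sum_right[of X "f \<ominus> P f" _ "\<lambda>h. h" F] by (simp add: perp f del: times_divide_eq_left)
    finally show "inner_on X (f \<ominus> P f) u = 0" .
  qed
qed

text \<open>Take \<open>u\<close> in \<open>I\<close> but not in \<open>J\<close>: its component
  orthogonal to \<open>J\<close> is nonzero and extends a largest orthogonal family of
  \<open>J\<close>.\<close>

lemma rank_strict_mono:
  assumes I: "left_ideal I R" and J: "left_ideal J R" and sub: "J \<subset> I"
  shows "rank J < rank I"
proof -
  obtain u where u: "u \<in> I" "u \<notin> J" using sub by auto
  have uc: "u \<in> carrier R" using u left_idealD(1)[OF I] by auto
  obtain y where y: "y \<in> J" "\<forall>w\<in>J. inner_on X (u \<ominus> y) w = 0" using left_ideal_projection[OF J uc] by blast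
  have yc: "y \<in> carrier R" using y left_idealD(1)[OF J] by auto
  have v: "u \<ominus> y \<in> I" using left_idealD(4)[OF I u(1)] y(1) sub by auto
  have "u \<ominus> y \<noteq> \<zero>" using u(2) y(1) uc yc r_right_minus_eq[of u y] by metis
  then have n: "sqnorm_on X (u \<ominus> y) \<noteq> 0" using eq_zero_iff[of "u \<ominus> y"] uc yc by simp
  obtain F where F: "F \<subseteq> J" "orthogonal_family X F" "card F = rank J" using rank_attained by blast
  have p: "inner_on X (u \<ominus> y) f = 0" if "f \<in> F" for f using y F that by auto
  have "insert (u \<ominus> y) F \<subseteq> I" using v F sub by auto
  from card_le_rank[OF this orthogonal_family_insert(1)[OF F(2) n p]] orthogonal_family_insert(2)[OF F(2) n p] F(3)
  show ?thesis by simp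
qed

text \<open>A nonzero left ideal of least rank inside \<open>I\<close> is minimal, since the rank
  strictly drops on proper subideals.\<close>

lemma minimal_left_ideal_exists:
  assumes I: "left_ideal I R" "I \<noteq> {\<zero>}"
  shows "\<exists>J\<subseteq>I. minimal_left_ideal J R"
proof -
  define P where "P J \<longleftrightarrow> J \<subseteq> I \<and> left_ideal J R \<and> J \<noteq> {\<zero>}" for J
  have "P I" using I by (simp add: P_def)
  then obtain J where J: "P J" "\<And>K. P K \<Longrightarrow> rank J \<le> rank K"
    using ex_has_least_nat[of P I rank] by metis
  have "K = {\<zero>} \<or> K = J" if K: "left_ideal K R" "K \<subseteq> J" for K
  proof (rule ccontr)
    assume n: "\<not> ?thesis"
    then have "P K" using K J(1) by (auto simp: P_def)
    moreover have "rank K < rank J" using n K J(1) by (intro rank_strict_mono) (auto simp: P_def)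
    ultimately show False using J(2)[of K] by simp
  qed
  then have "minimal_left_ideal J R" using J(1) by (simp add: P_def minimal_left_ideal_def)
  moreover have "J \<subseteq> I" using J(1) by (simp add: P_def)
  ultimately show ?thesis by blast
qed

text \<open>Left multiplication by \<open>a\<close> moves to the other side of the inner product as
  multiplication by \<open>a'\<close>, and \<open>a' \<otimes> u\<close> stays in
  \<open>I\<close>.\<close>

lemma left_ideal_orthogonal_complement:
  assumes S: "\<And>I. I \<in> S \<Longrightarrow> left_ideal I R"
  shows "left_ideal {f \<in> carrier R. \<forall>I\<in>S. \<forall>u\<in>I. inner_on X f u = 0} R" (is "left_ideal ?K R")
  unfolding left_ideal_def
proof (intro conjI ballI)
  have add: "f \<oplus> g \<in> ?K" if f: "f \<in> ?K" and g: "g \<in> ?K" for f g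
  proof -
    have "inner_on X (f \<oplus> g) u = inner_on X f u + inner_on X g u" for u
      unfolding inner_on_add_left[symmetric] using f g by (intro inner_on_cong) (simp_all add: add_pointwise)
    then show ?thesis using f g by auto
  qed
  have zero: "\<zero> \<in> ?K"
  proof -
    have "inner_on X \<zero> u = 0" for u unfolding inner_on_def zero_pointwise by simp
    then show ?thesis by simp
  qed
  have neg: "\<ominus> f \<in> ?K" if f: "f \<in> ?K" for f
  proof -
    have "inner_on X (\<ominus> f) u = - inner_on X f u" for u
      using f by (simp add: inner_on_def a_inv_pointwise sum_negf)
    then show ?thesis using f by auto
  qed
  show "additive_subgroup ?K R"
  proof (intro additive_subgroup.intro add.subgroupI)
    show "?K \<subseteq> carrier R" by blast
    show "?K \<noteq> {}" using zero by blast
  qed (fact neg add)+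
  fix a f assume a: "a \<in> carrier R" and f: "f \<in> ?K"
  obtain a' where a': "a' \<in> carrier R"
    "\<And>g h. g \<in> carrier R \<Longrightarrow> h \<in> carrier R \<Longrightarrow> inner_on X (a \<otimes> g) h = inner_on X g (a' \<otimes> h)"
    using adjoint[OF a] by blast
  have "inner_on X (a \<otimes> f) u = 0" if "I \<in> S" "u \<in> I" for I u
  proof -
    have "u \<in> carrier R" "a' \<otimes> u \<in> I"
      using left_idealD(1)[OF S[OF that(1)]] left_idealD(5)[OF S[OF that(1)] a'(1) that(2)] that(2) by auto
    then show ?thesis using a'(2)[of f u] f that(1) by simp
  qed
  moreover have "a \<otimes> f \<in> carrier R" using a f by simp
  ultimately show "a \<otimes> f \<in> ?K" by (intro CollectI conjI ballI) simp_all
qed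

text \<open>Take as many pairwise orthogonal minimal left ideals as possible. Nothing nonzero is
  orthogonal to all of them, so projections give the decomposition, and orthogonality gives its
  uniqueness.\<close>

theorem semisimple: "semisimple_ring R"
proof -
  define perp where "perp I J \<longleftrightarrow> (\<forall>u\<in>I. \<forall>v\<in>J. inner_on X u v = 0)" for I J
  define P where "P S \<longleftrightarrow> (\<forall>I\<in>S. minimal_left_ideal I R) \<and> pairwise perp S" for S
  have ne: "\<exists>u\<in>I. sqnorm_on X u \<noteq> 0" if "minimal_left_ideal I R" for I
  proof -
    have "left_ideal I R" "I \<noteq> {\<zero>}" using that by (auto simp: minimal_left_ideal_def)
    then obtain u where u: "u \<in> I" "u \<noteq> \<zero>" using left_idealD(2)[of I] by blast
    then have "u \<in> carrier R" using left_idealD(1)[OF \<open>left_ideal I R\<close>] by (simp only: subsetD)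
    then show ?thesis using u eq_zero_iff[of u] by (intro bexI[of _ u]) simp_all
  qed
  \<comment> \<open>Picking a nonzero function in each ideal yields an orthogonal family of the same
    size.\<close>
  have bound: "finite S \<and> card S \<le> card X" if "P S" for S
  proof -
    have "\<forall>I\<in>S. \<exists>u. u \<in> I \<and> sqnorm_on X u \<noteq> 0"
      using that ne by (simp add: P_def Bex_def)
    from bchoice[OF this] obtain c where c: "\<And>I. I \<in> S \<Longrightarrow> c I \<in> I" "\<And>I. I \<in> S \<Longrightarrow> sqnorm_on X (c I) \<noteq> 0"
      by auto
    have pc: "inner_on X (c I) (c J) = 0" if "I \<in> S" "J \<in> S" "I \<noteq> J" for I J
    proof -
      have "perp I J" using \<open>P S\<close> that by (simp add: P_def pairwise_def)
      then show ?thesis using c(1) that by (simp add: perp_def)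
    qed
    have "inj_on c S"
    proof (rule inj_onI, rule ccontr)
      fix I J assume "I \<in> S" "J \<in> S" "c I = c J" "I \<noteq> J"
      then show False using pc[of I J] c(2)[of I] by (simp add: inner_on_self)
    qed
    moreover have "orthogonal_family X (c ` S)"
      unfolding orthogonal_family_def pairwise_image
    proof
      show "pairwise (\<lambda>I J. c I \<noteq> c J \<longrightarrow> inner_on X (c I) (c J) = 0) S"
        by (rule pairwiseI) (use pc in simp)
    qed (use c(2) in simp)
    ultimately show ?thesis using card_orthogonal_family[OF finite_X, of "c ` S"]
      by (simp add: card_image finite_image_iff)
  qed
  have "P {}" by (simp add: P_def)
  moreover have "\<forall>S. P S \<longrightarrow> card S < Suc (card X)" using bound by (simp add: less_Suc_eq_le)
  ultimately have "\<exists>S. P S \<and> (\<forall>S'. P S' \<longrightarrow> card S' \<le> card S)" by (rule ex_has_greatest_nat)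
  then obtain S where S: "P S" "\<forall>S'. P S' \<longrightarrow> card S' \<le> card S" by (elim exE conjE)
  have Sl: "left_ideal I R" if "I \<in> S" for I using S(1) that by (simp add: P_def minimal_left_ideal_def)
  let ?K = "{f \<in> carrier R. \<forall>I\<in>S. \<forall>u\<in>I. inner_on X f u = 0}"
  \<comment> \<open>Otherwise the complement contains a minimal left ideal, which could be added to
    \<open>S\<close>.\<close>
  have K0: "?K = {\<zero>}"
  proof (rule ccontr)
    assume "?K \<noteq> {\<zero>}"
    from minimal_left_ideal_exists[OF left_ideal_orthogonal_complement[OF Sl] this]
    obtain J where J: "J \<subseteq> ?K" "minimal_left_ideal J R" by blast
    have JI: "perp J I" "perp I J" if "I \<in> S" for I
    proof -
      show *: "perp J I" using subsetD[OF J(1)] that unfolding perp_def by simp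
      show "perp I J"
        unfolding perp_def
      proof (intro ballI)
        fix u v assume "u \<in> I" "v \<in> J"
        then have "inner_on X v u = 0" using * by (simp add: perp_def)
        then show "inner_on X u v = 0" using inner_on_cnj[of X v u] by simp
      qed
    qed
    have "J \<notin> S"
    proof
      assume "J \<in> S"
      then have "perp J J" by (rule JI)
      moreover obtain u where "u \<in> J" "sqnorm_on X u \<noteq> 0" using ne[OF J(2)] by (elim bexE)
      ultimately show False using inner_on_self[of X u] by (simp add: perp_def)
    qed
    moreover have "P (insert J S)" using S(1) J(2) JI by (simp add: P_def pairwise_insert)
    then have "card (insert J S) \<le> card S" using S(2) by simp
    ultimately show False using bound[OF S(1)] by simp
  qed
  obtain k :: nat and L where L: "bij_betw L {..<k} S"
    using ex_bij_betw_nat_finite[of S] bound[OF S(1)] unfolding atLeast0LessThan by blast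
  have LS: "L i \<in> S" if "i < k" for i using L that by (auto simp: bij_betw_def)
  have Lperp: "inner_on X u v = 0" if "i < k" "j < k" "i \<noteq> j" "u \<in> L i" "v \<in> L j" for i j u v
  proof -
    have "L i \<noteq> L j" using L that by (auto simp: bij_betw_def inj_on_def)
    then have "perp (L i) (L j)" using S(1) LS that(1,2) unfolding P_def pairwise_def by blast
    then show ?thesis using that(4,5) by (simp add: perp_def)
  qed
  have Lc: "L i \<subseteq> carrier R" if "i < k" for i using left_idealD(1)[OF Sl[OF LS[OF that]]] .
  have inner_sum: "inner_on X (\<Oplus>i\<in>{..<k}. g i) u = inner_on X (g j) u"
    if g: "\<And>i. i < k \<Longrightarrow> g i \<in> L i" and j: "j < k" "u \<in> L j" for g j u
  proof -
    have "(\<Oplus>i\<in>{..<k}. g i) = (\<lambda>x\<in>X. \<Sum>i<k. g i x)"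
      by (rule finsum_pointwise) (use g Lc in auto)
    then have "inner_on X (\<Oplus>i\<in>{..<k}. g i) u = inner_on X (\<lambda>x. \<Sum>i<k. 1 * g i x) u"
      by (intro inner_on_cong) auto
    also have "\<dots> = (\<Sum>i<k. inner_on X (g i) u)"
      using inner_on_sum_left[of X "\<lambda>_. 1" g "{..<k}" u] by simp
    also have "\<dots> = (\<Sum>i<k. if i = j then inner_on X (g j) u else 0)"
      using Lperp g j by (intro sum.cong) auto
    finally show ?thesis using j by simp
  qed
  have unique: "\<exists>!f. f \<in> (\<Pi>\<^sub>E i\<in>{..<k}. L i) \<and> x = (\<Oplus>i\<in>{..<k}. f i)" if x: "x \<in> carrier R" for x
  proof -
    have "\<forall>i\<in>{..<k}. \<exists>g. g \<in> L i \<and> (\<forall>u\<in>L i. inner_on X (x \<ominus> g) u = 0)"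
      using left_ideal_projection[OF Sl[OF LS] x] by (simp add: Bex_def)
    from bchoice[OF this] obtain p where
      p: "\<And>i. i < k \<Longrightarrow> p i \<in> L i \<and> (\<forall>u\<in>L i. inner_on X (x \<ominus> p i) u = 0)" by auto
    have pc: "p i \<in> carrier R" if "i < k" for i using p Lc that by blast
    \<comment> \<open>The components of \<open>x\<close> are its projections to the ideals; the
      remainder lies in the complement, hence vanishes.\<close>
    define f where "f = (\<lambda>i\<in>{..<k}. p i)"
    have fP: "f \<in> (\<Pi>\<^sub>E i\<in>{..<k}. L i)" using p by (auto simp: f_def)
    have sc: "(\<Oplus>i\<in>{..<k}. f i) \<in> carrier R"
      using pc by (intro finsum_closed) (auto simp: f_def)
    have "x \<ominus> (\<Oplus>i\<in>{..<k}. f i) \<in> ?K"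
    proof (safe, goal_cases)
      case (2 I u)
      then obtain j where j: "j < k" "I = L j" using L by (auto simp: bij_betw_def)
      have "inner_on X (x \<ominus> (\<Oplus>i\<in>{..<k}. f i)) u =
          inner_on X x u - inner_on X (\<Oplus>i\<in>{..<k}. f i) u"
        unfolding inner_on_diff_left[symmetric] using x sc by (intro inner_on_cong) (simp_all add: minus_pointwise)
      also have "\<dots> = inner_on X x u - inner_on X (p j) u"
        using inner_sum[of f j u] 2 j fP by (auto simp: f_def)
      also have "\<dots> = inner_on X (x \<ominus> p j) u"
        unfolding inner_on_diff_left[symmetric] using x pc[OF j(1)] by (intro inner_on_cong) (simp_all add: minus_pointwise)
      finally show ?case using p j 2 by simp
    qed (use x sc in simp)
    then have xf: "x = (\<Oplus>i\<in>{..<k}. f i)" unfolding K0 using x sc by simp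
    have uniq: "g = f" if g: "g \<in> (\<Pi>\<^sub>E i\<in>{..<k}. L i)" "x = (\<Oplus>i\<in>{..<k}. g i)" for g
    proof (rule PiE_ext[OF g(1) fP])
      fix i assume "i \<in> {..<k}"
      then have i: "i < k" by simp
      have gi: "g j \<in> L j" "f j \<in> L j" if "j < k" for j using g fP that by (auto simp: PiE_def Pi_def)
      have c: "g i \<in> carrier R" "f i \<in> carrier R" using gi Lc i by blast+
      have d: "g i \<ominus> f i \<in> L i" by (rule left_idealD(4)[OF Sl[OF LS[OF i]]]) (use gi i in auto)
      have "inner_on X (g i \<ominus> f i) u = inner_on X (g i) u - inner_on X (f i) u" for u
        unfolding inner_on_diff_left[symmetric] using c by (intro inner_on_cong) (simp_all add: minus_pointwise)
      \<comment> \<open>Inner products with \<open>L i\<close> see only the summand with index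
        \<open>i\<close>.\<close>
      moreover have "inner_on X (g i) u = inner_on X (f i) u" if "u \<in> L i" for u
        using inner_sum[of g i u] inner_sum[of f i u] gi i that xf g(2) by metis
      ultimately have "sqnorm_on X (g i \<ominus> f i) = 0"
        using d inner_on_self[of X "g i \<ominus> f i"] by simp
      then show "g i = f i" using eq_zero_iff[of "g i \<ominus> f i"] c by simp
    qed
    show ?thesis
    proof (rule ex1I[of _ f])
      show "f \<in> (\<Pi>\<^sub>E i\<in>{..<k}. L i) \<and> x = (\<Oplus>i\<in>{..<k}. f i)" using fP xf by (rule conjI)
    qed (use uniq in blast)
  qed
  show ?thesis
    unfolding semisimple_ring_def
  proof (intro conjI exI[of _ k] exI[of _ L] allI impI ballI)
    show "ring R" by (rule ring_axioms)
    show "minimal_left_ideal (L i) R" if "i < k" for i using S(1) LS[OF that] by (simp add: P_def)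
  qed (rule unique)
qed

end


section \<open>Convolution algebras of class functions on a finite group\<close>

text \<open>\<open>A\<close> is modelled on a unital subalgebra of the complex group algebra that
  lies in the centre and is closed under the involution in \<open>A_star\<close>.\<close>

locale convolution_algebra = group G for G (structure) +
  fixes A :: "('a \<Rightarrow> complex) set"
  assumes finite_carrier: "finite (carrier G)"
    and A_subset: "A \<subseteq> carrier G \<rightarrow>\<^sub>E UNIV"
    and A_one: "(\<lambda>z\<in>carrier G. if z = \<one> then 1 else 0) \<in> A"
    and A_add: "\<xi> \<in> A \<Longrightarrow> \<zeta> \<in> A \<Longrightarrow> (\<lambda>z\<in>carrier G. \<xi> z + \<zeta> z) \<in> A"
    and A_smult: "\<xi> \<in> A \<Longrightarrow> (\<lambda>z\<in>carrier G. c * \<xi> z) \<in> A"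
    and A_star: "\<xi> \<in> A \<Longrightarrow> (\<lambda>z\<in>carrier G. cnj (\<xi> (inv z))) \<in> A"
    and A_conv: "\<xi> \<in> A \<Longrightarrow> \<zeta> \<in> A \<Longrightarrow>
      (\<lambda>z\<in>carrier G. \<Sum>x\<in>carrier G. \<xi> x * \<zeta> (z \<otimes> inv x)) \<in> A"
    and A_class: "\<xi> \<in> A \<Longrightarrow> x \<in> carrier G \<Longrightarrow> y \<in> carrier G \<Longrightarrow> \<xi> (x \<otimes> y) = \<xi> (y \<otimes> x)"
begin

definition conv :: "('a \<Rightarrow> complex) \<Rightarrow> ('a \<Rightarrow> complex) \<Rightarrow> 'a \<Rightarrow> complex" where
  "conv \<xi> \<zeta> = (\<lambda>z\<in>carrier G. \<Sum>x\<in>carrier G. \<xi> x * \<zeta> (z \<otimes> inv x))"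

definition alg :: "(complex, 'a \<Rightarrow> complex) module" where
  "alg = \<lparr>carrier = A, monoid.mult = conv,
    monoid.one = (\<lambda>z\<in>carrier G. if z = \<one> then 1 else 0),
    ring.zero = (\<lambda>z\<in>carrier G. 0),
    ring.add = (\<lambda>\<xi> \<zeta>. \<lambda>z\<in>carrier G. \<xi> z + \<zeta> z),
    module.smult = (\<lambda>c \<xi>. \<lambda>z\<in>carrier G. c * \<xi> z)\<rparr>"

lemma A_extensional: "\<xi> \<in> A \<Longrightarrow> \<xi> \<in> extensional (carrier G)"
  using A_subset by (auto simp: PiE_def)

lemma sum_inv: "(\<Sum>x\<in>carrier G. f (inv x)) = (\<Sum>x\<in>carrier G. f x)"
  by (rule sum.reindex_bij_witness[of _ "\<lambda>x. inv x" "\<lambda>x. inv x"]) auto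

lemma sum_mult_right:
  assumes g: "g \<in> carrier G"
  shows "(\<Sum>x\<in>carrier G. f (x \<otimes> g)) = (\<Sum>x\<in>carrier G. f x)"
  by (rule sum.reindex_bij_witness[of _ "\<lambda>x. x \<otimes> inv g" "\<lambda>x. x \<otimes> g"])
    (use g in \<open>auto simp: m_assoc\<close>)

lemma conv_extensional: "conv \<xi> \<zeta> \<in> extensional (carrier G)"
  by (simp add: conv_def)

lemma conv_apply: "z \<in> carrier G \<Longrightarrow> conv \<xi> \<zeta> z = (\<Sum>x\<in>carrier G. \<xi> x * \<zeta> (z \<otimes> inv x))"
  by (simp add: conv_def)

text \<open>Replacing \<open>x\<close> by the inverse of \<open>x \<otimes> inv z\<close> makes the
  first argument \<open>z \<otimes> inv x\<close> and the second a conjugate of \<open>x\<close>,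
  where the class function \<zeta> has the same value as at \<open>x\<close>.\<close>

lemma conv_commute:
  assumes \<xi>: "\<xi> \<in> A" and \<zeta>: "\<zeta> \<in> A"
  shows "conv \<xi> \<zeta> = conv \<zeta> \<xi>"
proof (rule extensionalityI[OF conv_extensional conv_extensional])
  fix z assume z: "z \<in> carrier G"
  have "conv \<xi> \<zeta> z = (\<Sum>x\<in>carrier G. \<xi> (inv x) * \<zeta> (z \<otimes> inv (inv x)))"
    unfolding conv_apply[OF z] by (rule sum_inv[symmetric])
  also have "\<dots> = (\<Sum>x\<in>carrier G. \<xi> (inv (x \<otimes> inv z)) * \<zeta> (z \<otimes> inv (inv (x \<otimes> inv z))))"
    by (rule sum_mult_right[symmetric, where f = "\<lambda>x. \<xi> (inv x) * \<zeta> (z \<otimes> inv (inv x))"]) (use z in simp)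
  also have "\<dots> = (\<Sum>x\<in>carrier G. \<zeta> x * \<xi> (z \<otimes> inv x))"
  proof (rule sum.cong[OF refl])
    fix x assume x: "x \<in> carrier G"
    have "\<zeta> (z \<otimes> inv (inv (x \<otimes> inv z))) = \<zeta> (x \<otimes> inv z \<otimes> z)"
      using A_class[OF \<zeta>, of z "x \<otimes> inv z"] x z by simp
    also have "x \<otimes> inv z \<otimes> z = x" using x z by (simp add: m_assoc)
    finally show "\<xi> (inv (x \<otimes> inv z)) * \<zeta> (z \<otimes> inv (inv (x \<otimes> inv z))) = \<zeta> x * \<xi> (z \<otimes> inv x)"
      using x z by (simp add: inv_mult_group)
  qed
  also have "\<dots> = conv \<zeta> \<xi> z" by (rule conv_apply[OF z, symmetric])
  finally show "conv \<xi> \<zeta> z = conv \<zeta> \<xi> z" .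
qed

text \<open>Both sides become the same double sum after shifting \<open>x\<close> to
  \<open>x \<otimes> y\<close>.\<close>

lemma conv_assoc: "conv (conv \<xi> \<zeta>) \<eta> = conv \<xi> (conv \<zeta> \<eta>)"
proof (rule extensionalityI[OF conv_extensional conv_extensional])
  fix z assume z: "z \<in> carrier G"
  have "conv (conv \<xi> \<zeta>) \<eta> z = (\<Sum>x\<in>carrier G. \<Sum>y\<in>carrier G. \<xi> y * \<zeta> (x \<otimes> inv y) * \<eta> (z \<otimes> inv x))"
    unfolding conv_apply[OF z] by (intro sum.cong refl) (simp add: conv_apply sum_distrib_right)
  also have "\<dots> = (\<Sum>y\<in>carrier G. \<Sum>x\<in>carrier G. \<xi> y * \<zeta> (x \<otimes> inv y) * \<eta> (z \<otimes> inv x))"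
    by (rule sum.swap)
  also have "\<dots> = (\<Sum>y\<in>carrier G. \<xi> y * conv \<zeta> \<eta> (z \<otimes> inv y))"
  proof (rule sum.cong[OF refl])
    fix y assume y: "y \<in> carrier G"
    have "(\<Sum>x\<in>carrier G. \<xi> y * \<zeta> (x \<otimes> inv y) * \<eta> (z \<otimes> inv x)) =
        (\<Sum>x\<in>carrier G. \<xi> y * \<zeta> (x \<otimes> y \<otimes> inv y) * \<eta> (z \<otimes> inv (x \<otimes> y)))"
      by (rule sum_mult_right[OF y, symmetric])
    also have "\<dots> = (\<Sum>x\<in>carrier G. \<xi> y * (\<zeta> x * \<eta> (z \<otimes> inv y \<otimes> inv x)))"
      using y z by (intro sum.cong refl) (simp add: m_assoc inv_mult_group)
    also have "\<dots> = \<xi> y * conv \<zeta> \<eta> (z \<otimes> inv y)"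
      using y z by (simp add: conv_apply sum_distrib_left)
    finally show "(\<Sum>x\<in>carrier G. \<xi> y * \<zeta> (x \<otimes> inv y) * \<eta> (z \<otimes> inv x)) = \<xi> y * conv \<zeta> \<eta> (z \<otimes> inv y)" .
  qed
  also have "\<dots> = conv \<xi> (conv \<zeta> \<eta>) z" by (rule conv_apply[OF z, symmetric])
  finally show "conv (conv \<xi> \<zeta>) \<eta> z = conv \<xi> (conv \<zeta> \<eta>) z" .
qed

lemma conv_one:
  assumes \<xi>: "\<xi> \<in> A"
  shows "conv (\<lambda>z\<in>carrier G. if z = \<one> then 1 else 0) \<xi> = \<xi>"
proof (rule extensionalityI[OF conv_extensional A_extensional[OF \<xi>]])
  fix z assume z: "z \<in> carrier G"
  have "conv (\<lambda>z\<in>carrier G. if z = \<one> then 1 else 0) \<xi> z =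
      (\<Sum>x\<in>carrier G. if x = \<one> then \<xi> (z \<otimes> inv x) else 0)"
    unfolding conv_apply[OF z] by (intro sum.cong) auto
  also have "\<dots> = \<xi> z" using z finite_carrier by (simp add: sum.delta)
  finally show "conv (\<lambda>z\<in>carrier G. if z = \<one> then 1 else 0) \<xi> z = \<xi> z" .
qed

lemma conv_add_left: "conv (\<lambda>z\<in>carrier G. \<xi> z + \<xi>' z) \<zeta> = (\<lambda>z\<in>carrier G. conv \<xi> \<zeta> z + conv \<xi>' \<zeta> z)"
  by (rule extensionalityI[OF conv_extensional]) (auto simp: conv_apply distrib_right sum.distrib)

lemma conv_smult_left: "conv (\<lambda>z\<in>carrier G. c * \<xi> z) \<zeta> = (\<lambda>z\<in>carrier G. c * conv \<xi> \<zeta> z)"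
  by (rule extensionalityI[OF conv_extensional]) (auto simp: conv_apply sum_distrib_left mult.assoc)

lemma A_zero: "(\<lambda>z\<in>carrier G. 0) \<in> A"
  using A_smult[OF A_one, of 0] by (simp cong: restrict_cong)

lemma abelian_group_alg: "abelian_group alg"
proof (rule abelian_groupI)
  fix \<xi> assume \<xi>: "\<xi> \<in> carrier alg"
  \<comment> \<open>The negative is written as the multiple by -1 so that \<open>A_smult\<close>
    puts it into \<open>A\<close>.\<close>
  show "\<exists>\<zeta>\<in>carrier alg. \<zeta> \<oplus>\<^bsub>alg\<^esub> \<xi> = \<zero>\<^bsub>alg\<^esub>"
    by (rule bexI[of _ "\<lambda>z\<in>carrier G. (- 1) * \<xi> z"])
      (use \<xi> A_smult[of \<xi> "-1"] in \<open>auto simp: alg_def intro!: restrict_ext\<close>)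
  show "\<zero>\<^bsub>alg\<^esub> \<oplus>\<^bsub>alg\<^esub> \<xi> = \<xi>"
    by (rule extensionalityI) (use \<xi> in \<open>auto simp: alg_def A_extensional\<close>)
qed (auto simp: alg_def A_zero A_add add.assoc add.commute intro!: restrict_ext)

lemma cring_alg: "cring alg"
proof (rule cringI[OF abelian_group_alg])
  show "comm_monoid alg"
    by (rule comm_monoidI)
      (auto simp: alg_def A_one A_conv[folded conv_def] conv_assoc conv_one conv_commute[OF _ A_one] intro: conv_commute)
qed (auto simp: alg_def conv_add_left)

theorem algebra_alg: "algebra class_ring alg"
proof (rule algebraI)
  show "cring (class_ring :: complex ring)"
    using class_field unfolding field_def domain_def by (elim conjE)
  show "cring alg" by (rule cring_alg)
  fix \<xi> assume \<xi>: "\<xi> \<in> carrier alg"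
  show "\<one>\<^bsub>class_ring\<^esub> \<odot>\<^bsub>alg\<^esub> \<xi> = \<xi>"
    by (rule extensionalityI) (use \<xi> in \<open>auto simp: alg_def A_extensional\<close>)
qed (auto simp: alg_def A_smult conv_smult_left algebra_simps intro!: restrict_ext)

text \<open>Translating \<open>z\<close> by \<open>x\<close> and then inverting \<open>x\<close>
  moves \<xi> to the other argument. This provides the adjoint that
  \<open>star_function_ring\<close> asks for.\<close>

lemma inner_on_conv:
  fixes \<xi> \<zeta> \<eta> :: "'a \<Rightarrow> complex"
  defines "\<xi>' \<equiv> \<lambda>z\<in>carrier G. cnj (\<xi> (inv z))"
  shows "inner_on (carrier G) (conv \<xi> \<zeta>) \<eta> = inner_on (carrier G) \<zeta> (conv \<xi>' \<eta>)"
proof -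
  have "inner_on (carrier G) (conv \<xi> \<zeta>) \<eta> =
      (\<Sum>z\<in>carrier G. \<Sum>x\<in>carrier G. \<xi> x * \<zeta> (z \<otimes> inv x) * cnj (\<eta> z))"
    by (simp add: inner_on_def conv_apply sum_distrib_right)
  also have "\<dots> = (\<Sum>x\<in>carrier G. \<Sum>z\<in>carrier G. \<xi> x * \<zeta> (z \<otimes> inv x) * cnj (\<eta> z))"
    by (rule sum.swap)
  also have "\<dots> = (\<Sum>x\<in>carrier G. \<Sum>z\<in>carrier G. \<xi> x * \<zeta> z * cnj (\<eta> (z \<otimes> x)))"
  proof (rule sum.cong[OF refl])
    fix x assume x: "x \<in> carrier G"
    have "(\<Sum>z\<in>carrier G. \<xi> x * \<zeta> (z \<otimes> inv x) * cnj (\<eta> z)) =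
        (\<Sum>z\<in>carrier G. \<xi> x * \<zeta> (z \<otimes> x \<otimes> inv x) * cnj (\<eta> (z \<otimes> x)))"
      by (rule sum_mult_right[OF x, symmetric])
    also have "\<dots> = (\<Sum>z\<in>carrier G. \<xi> x * \<zeta> z * cnj (\<eta> (z \<otimes> x)))"
      using x by (intro sum.cong refl) (simp add: m_assoc)
    finally show "(\<Sum>z\<in>carrier G. \<xi> x * \<zeta> (z \<otimes> inv x) * cnj (\<eta> z)) =
        (\<Sum>z\<in>carrier G. \<xi> x * \<zeta> z * cnj (\<eta> (z \<otimes> x)))" .
  qed
  also have "\<dots> = (\<Sum>x\<in>carrier G. \<Sum>z\<in>carrier G. \<xi> (inv x) * \<zeta> z * cnj (\<eta> (z \<otimes> inv x)))"
    by (rule sum_inv[symmetric])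
  also have "\<dots> = (\<Sum>z\<in>carrier G. \<Sum>x\<in>carrier G. \<xi> (inv x) * \<zeta> z * cnj (\<eta> (z \<otimes> inv x)))"
    by (rule sum.swap)
  also have "\<dots> = inner_on (carrier G) \<zeta> (conv \<xi>' \<eta>)"
    by (simp add: inner_on_def conv_apply \<xi>'_def sum_distrib_left mult_ac)
  finally show ?thesis .
qed

theorem semisimple_alg: "semisimple_ring alg"
proof -
  interpret cring alg by (rule cring_alg)
  interpret star_function_ring alg "carrier G"
  proof
    show "finite (carrier G)" by (rule finite_carrier)
    show "carrier alg \<subseteq> carrier G \<rightarrow>\<^sub>E UNIV" using A_subset by (simp add: alg_def)
    fix \<xi> assume \<xi>: "\<xi> \<in> carrier alg"
    show "\<xi> \<oplus>\<^bsub>alg\<^esub> \<zeta> = (\<lambda>z\<in>carrier G. \<xi> z + \<zeta> z)" for \<zeta> by (simp add: alg_def)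
    show "\<exists>\<xi>'\<in>carrier alg. \<forall>\<zeta>\<in>carrier alg. \<forall>\<eta>\<in>carrier alg.
        inner_on (carrier G) (\<xi> \<otimes>\<^bsub>alg\<^esub> \<zeta>) \<eta> = inner_on (carrier G) \<zeta> (\<xi>' \<otimes>\<^bsub>alg\<^esub> \<eta>)"
      by (rule bexI[of _ "\<lambda>z\<in>carrier G. cnj (\<xi> (inv z))"])
        (use \<xi> A_star in \<open>simp_all add: alg_def inner_on_conv\<close>)
  next
    fix c :: complex
    \<comment> \<open>Convolution with the unit scaled by \<open>c\<close> acts as the scalar
      \<open>c\<close>.\<close>
    show "\<exists>u\<in>carrier alg. \<forall>\<xi>\<in>carrier alg. u \<otimes>\<^bsub>alg\<^esub> \<xi> = (\<lambda>z\<in>carrier G. c * \<xi> z)"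
      by (rule bexI[of _ "\<lambda>z\<in>carrier G. c * (\<lambda>z\<in>carrier G. if z = \<one> then 1 else 0) z"])
        (use A_smult[OF A_one, of c] in \<open>simp_all add: alg_def conv_smult_left conv_one del: restrict_apply\<close>)
  qed
  show ?thesis by (rule semisimple)
qed

end


section \<open>Unitriangular double cosets and convolution\<close>

lemma unitri_iff:
  "A \<in> unitri m \<longleftrightarrow> A \<in> carrier_mat m m \<and>
    (\<forall>i<m. \<forall>j<m. j < i \<longrightarrow> A $$ (i, j) = 0) \<and> (\<forall>i<m. A $$ (i, i) = 1)"
  unfolding unitri_def by (auto intro: upper_triangularI dest: upper_triangularD less_trans)

lemma unitri_carrier: "A \<in> unitri m \<Longrightarrow> A \<in> carrier_mat m m"
  by (simp add: unitri_def)

lemma one_unitri: "1\<^sub>m m \<in> unitri m"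
  by (simp add: unitri_iff)

text \<open>A decreasing filtration: \<open>k = 0\<close> gives the upper triangular matrices,
  \<open>k = 1\<close> the strictly upper triangular ones.\<close>

definition superdiagonal :: "nat \<Rightarrow> nat \<Rightarrow> 'a::field mat set" where
  "superdiagonal m k = {A \<in> carrier_mat m m. \<forall>i<m. \<forall>j<m. j < i + k \<longrightarrow> A $$ (i, j) = 0}"

text \<open>For \<open>l < i\<close> the factor \<open>a $$ (i, l)\<close> vanishes, and for
  \<open>l > i\<close> the entry of \<open>A\<close> lies before the \<open>k\<close>-th
  superdiagonal. So the first superdiagonal that may be nonzero is left unchanged.\<close>

lemma superdiagonal_mult_left_entry:
  assumes A: "A \<in> superdiagonal m k" and a: "a \<in> unitri m" and ij: "i < m" "j < m" "j \<le> i + k"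
  shows "(a * A) $$ (i, j) = A $$ (i, j)"
proof -
  have "(a * A) $$ (i, j) = (\<Sum>l=0..<m. a $$ (i, l) * A $$ (l, j))"
    using A a ij by (intro mult_entry) (auto simp: superdiagonal_def unitri_iff)
  also have "\<dots> = (\<Sum>l=0..<m. if l = i then A $$ (i, j) else 0)"
  proof (rule sum.cong[OF refl])
    fix l assume "l \<in> {0..<m}"
    then have l: "l < m" by simp
    show "a $$ (i, l) * A $$ (l, j) = (if l = i then A $$ (i, j) else 0)"
      using A a ij l by (cases l i rule: linorder_cases) (simp_all add: superdiagonal_def unitri_iff)
  qed
  finally show ?thesis using ij by simp
qed

lemma superdiagonal_mult_right_entry:
  assumes A: "A \<in> superdiagonal m k" and b: "b \<in> unitri m" and ij: "i < m" "j < m" "j \<le> i + k"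
  shows "(A * b) $$ (i, j) = A $$ (i, j)"
proof -
  have "(A * b) $$ (i, j) = (\<Sum>l=0..<m. A $$ (i, l) * b $$ (l, j))"
    using A b ij by (intro mult_entry) (auto simp: superdiagonal_def unitri_iff)
  also have "\<dots> = (\<Sum>l=0..<m. if l = j then A $$ (i, j) else 0)"
  proof (rule sum.cong[OF refl])
    fix l assume "l \<in> {0..<m}"
    then have l: "l < m" by simp
    show "A $$ (i, l) * b $$ (l, j) = (if l = j then A $$ (i, j) else 0)"
      using A b ij l by (cases l j rule: linorder_cases) (simp_all add: superdiagonal_def unitri_iff)
  qed
  finally show ?thesis using ij by simp
qed

lemma superdiagonal_mult_left: "A \<in> superdiagonal m k \<Longrightarrow> a \<in> unitri m \<Longrightarrow> a * A \<in> superdiagonal m k"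
  using superdiagonal_mult_left_entry[of A m k a]
  by (simp add: superdiagonal_def unitri_carrier mult_carrier_mat[of _ m m] del: index_mult_mat(1))

lemma superdiagonal_mult_right: "A \<in> superdiagonal m k \<Longrightarrow> b \<in> unitri m \<Longrightarrow> A * b \<in> superdiagonal m k"
  using superdiagonal_mult_right_entry[of A m k b]
  by (simp add: superdiagonal_def unitri_carrier mult_carrier_mat[of _ m m] del: index_mult_mat(1))

lemma unitri_iff_superdiagonal:
  "A \<in> unitri m \<longleftrightarrow> A \<in> carrier_mat m m \<and> A - 1\<^sub>m m \<in> superdiagonal m 1"
proof -
  have "(\<forall>i<m. \<forall>j<m. j < i + 1 \<longrightarrow> (A - 1\<^sub>m m) $$ (i, j) = 0) \<longleftrightarrow>
      (\<forall>i<m. \<forall>j<m. j < i \<longrightarrow> A $$ (i, j) = 0) \<and> (\<forall>i<m. A $$ (i, i) = 1)"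
    by (auto simp: less_Suc_eq)
  then show ?thesis by (auto simp: unitri_iff superdiagonal_def)
qed

lemma unitri_mult:
  assumes a: "a \<in> unitri m" and b: "b \<in> unitri m"
  shows "a * b \<in> unitri m"
proof -
  have c: "a \<in> carrier_mat m m" "b \<in> carrier_mat m m" using a b by (auto intro: unitri_carrier)
  have "a \<in> superdiagonal m 0" "b \<in> superdiagonal m 0" using a b by (auto simp: superdiagonal_def unitri_iff)
  then have "(a * b) $$ (i, j) = b $$ (i, j)" if "i < m" "j < m" "j \<le> i" for i j
    using superdiagonal_mult_left_entry[of b m 0 a i j] a that by simp
  then show ?thesis using b c by (auto simp: unitri_iff simp del: index_mult_mat(1))
qed

text \<open>Reading \<open>x * y = 1\<^sub>m m\<close> from the last row upwards determines the
  entries of \<open>y\<close> on and below the diagonal.\<close>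

lemma unitri_inverse_unitri:
  assumes x: "x \<in> unitri m"
  shows "\<exists>y\<in>unitri m. y * x = 1\<^sub>m m"
proof -
  obtain y where y: "y \<in> carrier_mat m m" "y * x = 1\<^sub>m m" "x * y = 1\<^sub>m m"
    using unitri_inverse[OF x] by blast
  have xc: "x \<in> carrier_mat m m" using x by (rule unitri_carrier)
  have "y $$ (i, j) = (if i = j then 1 else 0)" if "i < m" "j \<le> i" for i j
    using that
  proof (induction "m - i" arbitrary: i rule: less_induct)
    case less
    have "(x * y) $$ (i, j) = (\<Sum>l=0..<m. x $$ (i, l) * y $$ (l, j))"
      using less.prems by (intro mult_entry[OF xc y(1)]) auto
    also have "\<dots> = (\<Sum>l=0..<m. if l = i then y $$ (i, j) else 0)"
    proof (rule sum.cong[OF refl])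
      fix l assume "l \<in> {0..<m}"
      then have l: "l < m" by simp
      show "x $$ (i, l) * y $$ (l, j) = (if l = i then y $$ (i, j) else 0)"
        using x less.prems l less.hyps[of l] by (cases l i rule: linorder_cases) (simp_all add: unitri_iff)
    qed
    finally show ?case using y(3) less.prems by simp
  qed
  then have "y \<in> unitri m" using y(1) by (auto simp: unitri_iff)
  then show ?thesis using y by blast
qed

definition unitri_group :: "nat \<Rightarrow> 'a::field mat monoid" where
  "unitri_group m = \<lparr>carrier = unitri m, monoid.mult = (*), monoid.one = 1\<^sub>m m\<rparr>"

lemma unitri_group_sel [simp]:
  "carrier (unitri_group m) = unitri m" "monoid.mult (unitri_group m) = (*)" "monoid.one (unitri_group m) = 1\<^sub>m m"
  by (simp_all add: unitri_group_def)

lemma group_unitri_group: "group (unitri_group m)"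
proof (rule groupI)
  fix x y z :: "'a mat"
  assume "x \<in> carrier (unitri_group m)" "y \<in> carrier (unitri_group m)" "z \<in> carrier (unitri_group m)"
  then show "x \<otimes>\<^bsub>unitri_group m\<^esub> y \<otimes>\<^bsub>unitri_group m\<^esub> z = x \<otimes>\<^bsub>unitri_group m\<^esub> (y \<otimes>\<^bsub>unitri_group m\<^esub> z)"
    by (simp add: assoc_mult_mat[of x m m y m z m] unitri_carrier)
qed (auto simp: one_unitri unitri_mult unitri_inverse_unitri dest: unitri_carrier)

definition uinv :: "nat \<Rightarrow> 'a::field mat \<Rightarrow> 'a mat" where
  "uinv m x = inv\<^bsub>unitri_group m\<^esub> x"

lemma uinv:
  assumes "x \<in> unitri m"
  shows "uinv m x \<in> unitri m" "uinv m x * x = 1\<^sub>m m" "x * uinv m x = 1\<^sub>m m"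
  using group.inv_closed[OF group_unitri_group, of x m] group.l_inv[OF group_unitri_group, of x m]
    group.r_inv[OF group_unitri_group, of x m] assms
  by (simp_all add: uinv_def)

lemma uinv_unique: "x \<in> unitri m \<Longrightarrow> y \<in> unitri m \<Longrightarrow> y * x = 1\<^sub>m m \<Longrightarrow> uinv m x = y"
  using group.inv_equality[OF group_unitri_group[of m], of y x] by (simp add: uinv_def)

lemma uinv_cancel:
  assumes x: "x \<in> unitri m" and A: "A \<in> carrier_mat m m"
  shows "uinv m x * (x * A) = A" "x * (uinv m x * A) = A" "A * x * uinv m x = A" "A * uinv m x * x = A"
proof -
  have c: "x \<in> carrier_mat m m" "uinv m x \<in> carrier_mat m m" using uinv x by (auto intro: unitri_carrier)
  show "uinv m x * (x * A) = A" "x * (uinv m x * A) = A"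
    using c A uinv[OF x] by (simp_all add: assoc_mult_mat[of _ m m _ m _ m, symmetric] del: assoc_mult_mat)
  show "A * x * uinv m x = A" "A * uinv m x * x = A"
    using c A uinv[OF x] by (simp_all add: assoc_mult_mat[of _ m m _ m _ m])
qed

section \<open>Double cosets of the unitriangular group\<close>

definition double_coset_rel :: "nat \<Rightarrow> 'a::field mat \<Rightarrow> 'a mat \<Rightarrow> bool" where
  "double_coset_rel m A B \<longleftrightarrow> (\<exists>a\<in>unitri m. \<exists>b\<in>unitri m. B = a * A * b)"

lemma double_coset_relI: "a \<in> unitri m \<Longrightarrow> b \<in> unitri m \<Longrightarrow> B = a * A * b \<Longrightarrow> double_coset_rel m A B"
  by (auto simp: double_coset_rel_def)

lemma double_coset_rel_carrier: "A \<in> carrier_mat m m \<Longrightarrow> double_coset_rel m A B \<Longrightarrow> B \<in> carrier_mat m m"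
  unfolding double_coset_rel_def by (auto dest!: unitri_carrier intro!: mult_carrier_mat[of _ m m])

lemma double_coset_rel_refl: "A \<in> carrier_mat m m \<Longrightarrow> double_coset_rel m A A"
  by (rule double_coset_relI[OF one_unitri one_unitri]) simp

lemma double_coset_rel_trans:
  assumes A: "A \<in> carrier_mat m m" and AB: "double_coset_rel m A B" and BC: "double_coset_rel m B C"
  shows "double_coset_rel m A C"
proof -
  obtain a b c d where abcd: "a \<in> unitri m" "b \<in> unitri m" "c \<in> unitri m" "d \<in> unitri m"
    and eq: "B = a * A * b" "C = c * B * d"
    using AB BC unfolding double_coset_rel_def by blast
  have cr: "a \<in> carrier_mat m m" "b \<in> carrier_mat m m" "c \<in> carrier_mat m m" "d \<in> carrier_mat m m"
    using abcd by (auto intro: unitri_carrier)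
  show ?thesis
    by (rule double_coset_relI[of "c * a" _ "b * d"])
      (use abcd cr A eq in \<open>simp_all add: unitri_mult assoc_mult_mat[of _ m m _ m _ m] mult_carrier_mat[of _ m m]\<close>)
qed

lemma double_coset_rel_sym:
  assumes A: "A \<in> carrier_mat m m" and AB: "double_coset_rel m A B"
  shows "double_coset_rel m B A"
proof -
  obtain a b where ab: "a \<in> unitri m" "b \<in> unitri m" and eq: "B = a * A * b"
    using AB unfolding double_coset_rel_def by blast
  have cr: "a \<in> carrier_mat m m" "b \<in> carrier_mat m m" "uinv m a \<in> carrier_mat m m" "uinv m b \<in> carrier_mat m m"
    using ab uinv by (auto intro: unitri_carrier)
  have "uinv m a * B * uinv m b = uinv m a * (a * (A * b)) * uinv m b"
    unfolding eq using cr A by (simp add: assoc_mult_mat[of _ m m _ m _ m])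
  also have "\<dots> = A * b * uinv m b" using cr A by (simp only: uinv_cancel ab mult_carrier_mat[of _ m m])
  also have "\<dots> = A" using A by (simp only: uinv_cancel ab)
  finally show ?thesis using ab uinv by (intro double_coset_relI[of "uinv m a" _ "uinv m b"]) auto
qed

lemma double_coset_rel_mult:
  assumes "A \<in> carrier_mat m m" "a \<in> unitri m"
  shows "double_coset_rel m A (a * A)" "double_coset_rel m A (A * a)"
  using assms unitri_carrier[OF assms(2)]
  by (auto intro: double_coset_relI[OF assms(2) one_unitri, of _ A]
      double_coset_relI[OF one_unitri assms(2), of _ A] simp: mult_carrier_mat[of _ m m])

lemma double_coset_rel_uminus:
  assumes A: "A \<in> carrier_mat m m" and AB: "double_coset_rel m A B"
  shows "double_coset_rel m (- A) (- B)"
proof -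
  obtain a b where ab: "a \<in> unitri m" "b \<in> unitri m" and eq: "B = a * A * b"
    using AB unfolding double_coset_rel_def by blast
  have cr: "a \<in> carrier_mat m m" "b \<in> carrier_mat m m" using ab by (auto intro: unitri_carrier)
  show ?thesis using cr A by (intro double_coset_relI[OF ab]) (simp add: eq)
qed

text \<open>Neither factor changes entries up to the \<open>k\<close>-th superdiagonal, so that
  superdiagonal is an invariant of the double coset.\<close>

lemma double_coset_rel_entry:
  assumes A: "A \<in> superdiagonal m k" and AB: "double_coset_rel m A B" and ij: "i < m" "j < m" "j \<le> i + k"
  shows "B $$ (i, j) = A $$ (i, j)"
proof -
  obtain a b where ab: "a \<in> unitri m" "b \<in> unitri m" and eq: "B = a * A * b"
    using AB unfolding double_coset_rel_def by blast
  show ?thesis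
    using superdiagonal_mult_right_entry[OF superdiagonal_mult_left[OF A ab(1)] ab(2) ij]
      superdiagonal_mult_left_entry[OF A ab(1) ij] by (simp add: eq)
qed

lemma double_coset_rel_zero:
  assumes "A \<in> carrier_mat m m" "double_coset_rel m A (0\<^sub>m m m)"
  shows "A = 0\<^sub>m m m"
proof -
  obtain a b where "a \<in> unitri m" "b \<in> unitri m" "A = a * 0\<^sub>m m m * b"
    using double_coset_rel_sym[OF assms] unfolding double_coset_rel_def by blast
  then show ?thesis using unitri_carrier by (metis left_mult_zero_mat right_mult_zero_mat)
qed

section \<open>Self-maps preserving the double cosets of differences\<close>

definition coset_isometry :: "nat \<Rightarrow> ('a::field mat \<Rightarrow> 'a mat) \<Rightarrow> bool" where
  "coset_isometry m \<rho> \<longleftrightarrow> (\<forall>x\<in>unitri m. \<rho> x \<in> unitri m) \<and>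
    (\<forall>x\<in>unitri m. \<forall>y\<in>unitri m. double_coset_rel m (x - y) (\<rho> x - \<rho> y))"

lemma coset_isometryD:
  assumes "coset_isometry m \<rho>"
  shows "x \<in> unitri m \<Longrightarrow> \<rho> x \<in> unitri m"
    "x \<in> unitri m \<Longrightarrow> y \<in> unitri m \<Longrightarrow> double_coset_rel m (x - y) (\<rho> x - \<rho> y)"
  using assms by (auto simp: coset_isometry_def)

lemma coset_isometry_comp:
  assumes "coset_isometry m \<rho>" "coset_isometry m \<tau>"
  shows "coset_isometry m (\<lambda>x. \<rho> (\<tau> x))"
  unfolding coset_isometry_def
proof (intro conjI ballI)
  fix x y :: "'a mat" assume xy: "x \<in> unitri m" "y \<in> unitri m"
  have "x - y \<in> carrier_mat m m" using xy by (intro minus_carrier_mat unitri_carrier)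
  then show "double_coset_rel m (x - y) (\<rho> (\<tau> x) - \<rho> (\<tau> y))"
    using coset_isometryD[OF assms(1)] coset_isometryD[OF assms(2)] xy double_coset_rel_trans by metis
qed (use assms in \<open>simp add: coset_isometry_def\<close>)

lemma coset_isometry_funpow: "coset_isometry m \<rho> \<Longrightarrow> coset_isometry m (\<rho> ^^ k)"
proof (induction k)
  case 0
  then show ?case by (auto simp: coset_isometry_def intro!: double_coset_rel_refl minus_carrier_mat dest: unitri_carrier)
next
  case (Suc k)
  then show ?case using coset_isometry_comp[of m \<rho> "\<rho> ^^ k"] by (simp add: comp_def)
qed

text \<open>A difference equivalent to zero is zero. On a finite invariant set such a map is
  therefore a permutation.\<close>

lemma coset_isometry_inj: 
  assumes "coset_isometry m \<rho>"
  shows "inj_on \<rho> (unitri m)"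
proof (rule inj_onI)
  fix x y assume xy: "x \<in> unitri m" "y \<in> unitri m" "\<rho> x = \<rho> y"
  have c: "x \<in> carrier_mat m m" "y \<in> carrier_mat m m" "\<rho> y \<in> carrier_mat m m"
    using xy coset_isometryD(1)[OF assms] by (auto intro: unitri_carrier)
  have "double_coset_rel m (x - y) (0\<^sub>m m m)"
    using coset_isometryD(2)[OF assms xy(1,2)] c xy(3) by simp
  then have z: "x - y = 0\<^sub>m m m" using c by (intro double_coset_rel_zero) auto
  show "x = y"
  proof (rule eq_matI)
    fix i j assume "i < dim_row y" "j < dim_col y"
    then have "(x - y) $$ (i, j) = 0" using c z by simp
    then show "x $$ (i, j) = y $$ (i, j)" using c \<open>i < dim_row y\<close> \<open>j < dim_col y\<close> by simp
  qed (use c in auto)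
qed

text \<open>
  A coset isometry acts on \<open>superdiagonal m k\<close> modulo \<open>superdiagonal m (k + 1)\<close> as a translation, which is
  killed by \<open>p\<close> in characteristic \<open>p\<close>; hence its order is a power of \<open>p\<close>.
\<close>

lemma coset_isometry_funpow_power:
  fixes \<rho> :: "'a::field mat \<Rightarrow> 'a mat"
  assumes \<rho>: "coset_isometry m \<rho>" and p: "of_nat p = (0::'a)"
  shows "x \<in> unitri m \<Longrightarrow> i < m \<Longrightarrow> j < m \<Longrightarrow> j \<le> i + k \<Longrightarrow> (\<rho> ^^ (p ^ k)) x $$ (i, j) = x $$ (i, j)"
proof (induction k arbitrary: x i j)
  case 0
  then have "\<rho> x \<in> unitri m" using coset_isometryD(1)[OF \<rho>] by simp
  then show ?case using 0 by (cases "i = j") (simp_all add: unitri_iff)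
next
  case (Suc k)
  define \<tau> where "\<tau> = \<rho> ^^ (p ^ k)"
  have \<tau>: "coset_isometry m \<tau>" unfolding \<tau>_def by (rule coset_isometry_funpow[OF \<rho>])
  have \<tau>n: "(\<tau> ^^ l) x \<in> unitri m" for l
    using coset_isometryD(1)[OF coset_isometry_funpow[OF \<tau>]] Suc.prems by blast
  \<comment> \<open>By induction \<tau> moves nothing up to the \<open>k\<close>-th superdiagonal,
    so the next superdiagonal of its displacement is a double coset invariant and does not change
    along an orbit.\<close>
  have d: "(\<tau> (\<tau> z) - \<tau> z) $$ (i, j) = (\<tau> z - z) $$ (i, j)" if z: "z \<in> unitri m" for z
  proof (rule double_coset_rel_entry[of _ m "Suc k"])
    have "\<tau> z \<in> carrier_mat m m" "z \<in> carrier_mat m m"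
      using z coset_isometryD(1)[OF \<tau>] by (auto intro: unitri_carrier)
    then show "\<tau> z - z \<in> superdiagonal m (Suc k)"
      using Suc.IH[OF z] by (auto simp: superdiagonal_def \<tau>_def less_Suc_eq_le)
    show "double_coset_rel m (\<tau> z - z) (\<tau> (\<tau> z) - \<tau> z)"
      using coset_isometryD[OF \<tau>] z by blast
  qed (use Suc.prems in simp_all)
  have c: "(\<tau> ^^ l) x \<in> carrier_mat m m" for l using \<tau>n by (rule unitri_carrier)
  have step: "((\<tau> ^^ Suc l) x - (\<tau> ^^ l) x) $$ (i, j) = (\<tau> x - x) $$ (i, j)" for l
  proof (induction l)
    case (Suc l)
    then show ?case using d[OF \<tau>n[of l]] by simp
  qed simp
  \<comment> \<open>Each application of \<tau> adds the same displacement, so \<open>p\<close>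
    applications add zero.\<close>
  have "(\<tau> ^^ l) x $$ (i, j) = x $$ (i, j) + of_nat l * (\<tau> x - x) $$ (i, j)" for l
  proof (induction l)
    case (Suc l)
    have "(\<tau> ^^ Suc l) x $$ (i, j) = (\<tau> ^^ l) x $$ (i, j) + ((\<tau> ^^ Suc l) x - (\<tau> ^^ l) x) $$ (i, j)"
      using c[of l] c[of "Suc l"] Suc.prems \<open>i < m\<close> \<open>j < m\<close> by simp
    then show ?case unfolding step Suc.IH by (simp add: distrib_right)
  qed simp
  from this[of p] p show ?case by (simp add: \<tau>_def funpow_mult mult.commute)
qed

text \<open>With exponent \<open>m\<close> the condition \<open>j \<le> i + m\<close> holds at every
  position.\<close>

lemma coset_isometry_order:
  fixes \<rho> :: "'a::field mat \<Rightarrow> 'a mat"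
  assumes \<rho>: "coset_isometry m \<rho>" and p: "of_nat p = (0::'a)" and x: "x \<in> unitri m"
  shows "(\<rho> ^^ (p ^ m)) x = x"
proof (rule eq_matI)
  have c: "(\<rho> ^^ (p ^ m)) x \<in> carrier_mat m m" "x \<in> carrier_mat m m"
    using coset_isometryD(1)[OF coset_isometry_funpow[OF \<rho>] x] x by (auto intro: unitri_carrier)
  then show "dim_row ((\<rho> ^^ (p ^ m)) x) = dim_row x" "dim_col ((\<rho> ^^ (p ^ m)) x) = dim_col x" by auto
  fix i j assume "i < dim_row x" "j < dim_col x"
  then show "(\<rho> ^^ (p ^ m)) x $$ (i, j) = x $$ (i, j)"
    using c(2) by (intro coset_isometry_funpow_power[OF \<rho> p x]) auto
qed

text \<open>Two-sided multiplication of \<open>w - 1\<close> transported to \<open>w\<close>: if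
  \<open>z' - 1\<close> is \<open>a * (z - 1) * b\<close>, this maps \<open>z\<close> to
  \<open>z'\<close> while fixing the identity.\<close>

definition two_sided :: "nat \<Rightarrow> 'a::field mat \<Rightarrow> 'a mat \<Rightarrow> 'a mat \<Rightarrow> 'a mat" where
  "two_sided m a b w = 1\<^sub>m m + a * (w - 1\<^sub>m m) * b"

lemma one_plus_minus_one:
  fixes A :: "'a::ring_1 mat"
  assumes "A \<in> carrier_mat m m"
  shows "1\<^sub>m m + A - 1\<^sub>m m = A"
  using assms by (intro eq_matI) auto

lemma two_sided_minus_one:
  assumes "a \<in> unitri m" "b \<in> unitri m" "w \<in> unitri m"
  shows "two_sided m a b w - 1\<^sub>m m = a * (w - 1\<^sub>m m) * b"
proof -
  have "a * (w - 1\<^sub>m m) * b \<in> carrier_mat m m"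
    using assms by (auto dest!: unitri_carrier intro!: mult_carrier_mat[of _ m m])
  then show ?thesis unfolding two_sided_def by (rule one_plus_minus_one)
qed

text \<open>The identity matrices cancel in a difference of two values, leaving
  \<open>a * (x - y) * b\<close>.\<close>

lemma coset_isometry_two_sided:
  assumes ab: "a \<in> unitri m" "b \<in> unitri m"
  shows "coset_isometry m (two_sided m a b)"
  unfolding coset_isometry_def
proof (intro conjI ballI)
  have c: "a \<in> carrier_mat m m" "b \<in> carrier_mat m m" using ab by (auto intro: unitri_carrier)
  fix x :: "'a mat" assume x: "x \<in> unitri m"
  have "a * (x - 1\<^sub>m m) * b \<in> superdiagonal m 1"
    by (intro superdiagonal_mult_left superdiagonal_mult_right ab)
      (use x in \<open>simp add: unitri_iff_superdiagonal\<close>)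
  moreover from this have "two_sided m a b x \<in> carrier_mat m m"
    by (simp add: two_sided_def superdiagonal_def)
  ultimately show "two_sided m a b x \<in> unitri m"
    using two_sided_minus_one[OF ab x] by (simp add: unitri_iff_superdiagonal)
  fix y :: "'a mat" assume y: "y \<in> unitri m"
  define P where "P = x - 1\<^sub>m m"
  define Q where "Q = y - 1\<^sub>m m"
  have xy: "x \<in> carrier_mat m m" "y \<in> carrier_mat m m" using x y by (auto intro: unitri_carrier)
  then have PQ: "P \<in> carrier_mat m m" "Q \<in> carrier_mat m m" "a * P * b \<in> carrier_mat m m" "a * Q * b \<in> carrier_mat m m"
    using c by (auto simp: P_def Q_def intro!: mult_carrier_mat[of _ m m])
  have "two_sided m a b x - two_sided m a b y = a * P * b - a * Q * b"
    using PQ unfolding two_sided_def P_def[symmetric] Q_def[symmetric]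
    by (intro eq_matI) (auto simp del: index_mult_mat(1))
  also have "\<dots> = a * (P - Q) * b"
    using PQ(1,2) c by (simp add: mult_minus_distrib_mat[of _ m m] minus_mult_distrib_mat[of _ m m _ _ m] mult_carrier_mat[of _ m m] del: assoc_mult_mat)
  also have "P - Q = x - y" using xy by (intro eq_matI) (auto simp: P_def Q_def)
  finally show "double_coset_rel m (x - y) (two_sided m a b x - two_sided m a b y)"
    by (rule double_coset_relI[OF ab])
qed

lemma two_sided_inverse:
  assumes ab: "a \<in> unitri m" "b \<in> unitri m" and w: "w \<in> unitri m"
  shows "two_sided m (uinv m a) (uinv m b) (two_sided m a b w) = w"
    "two_sided m a b (two_sided m (uinv m a) (uinv m b) w) = w"
proof -
  \<comment> \<open>Stated with generic factors so that it serves both orders of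
    composition.\<close>
  have *: "two_sided m c d (two_sided m a b w) = w"
    if abcd: "a \<in> unitri m" "b \<in> unitri m" "c \<in> unitri m" "d \<in> unitri m"
      and inv: "c * a = 1\<^sub>m m" "b * d = 1\<^sub>m m" for a b c d :: "'a mat"
  proof -
    have cr: "a \<in> carrier_mat m m" "b \<in> carrier_mat m m" "c \<in> carrier_mat m m" "d \<in> carrier_mat m m"
      "w \<in> carrier_mat m m" using abcd w by (auto intro: unitri_carrier)
    define P where "P = w - 1\<^sub>m m"
    have P: "P \<in> carrier_mat m m" using cr by (simp add: P_def minus_carrier_mat)
    have "c * (a * P * b) * d = (c * a) * P * (b * d)"
      using cr P by (simp add: assoc_mult_mat[of _ m m _ m _ m] mult_carrier_mat[of _ m m])
    then have "c * (two_sided m a b w - 1\<^sub>m m) * d = P"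
      using P inv unfolding two_sided_minus_one[OF abcd(1,2) w] P_def[symmetric] by simp
    then show ?thesis using cr unfolding two_sided_def[of m c d] by (intro eq_matI) (auto simp: P_def)
  qed
  show "two_sided m (uinv m a) (uinv m b) (two_sided m a b w) = w"
    "two_sided m a b (two_sided m (uinv m a) (uinv m b) w) = w"
    by (rule *; use ab uinv in blast)+
qed

lemma two_sided_one: "a \<in> unitri m \<Longrightarrow> b \<in> unitri m \<Longrightarrow> two_sided m a b (1\<^sub>m m) = 1\<^sub>m m"
  unfolding two_sided_def by (simp add: minus_r_inv_mat[of _ m m] unitri_carrier right_mult_zero_mat[of _ m m] left_mult_zero_mat[of _ m m])


section \<open>The adjoint of the form and the twist\<close>

definition gram_sign :: "gtype \<Rightarrow> nat \<Rightarrow> nat \<Rightarrow> 'a::field" where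
  "gram_sign T n i = (if T = Sp \<and> n \<le> i then - 1 else 1)"

text \<open>The adjoint with respect to the form with Gram matrix \<open>gram T n\<close>, see \<open>transpose_mult_gram\<close> below.\<close>

definition star :: "gtype \<Rightarrow> nat \<Rightarrow> 'a::field mat \<Rightarrow> 'a mat" where
  "star T n A = mat (msize T n) (msize T n) (\<lambda>(i, j).
     gram_sign T n i * gram_sign T n j * A $$ (msize T n - 1 - j, msize T n - 1 - i))"

lemma gram_sign_square [simp]: "gram_sign T n i * gram_sign T n i = 1"
  "gram_sign T n i * (gram_sign T n i * x) = x"
  by (simp_all add: gram_sign_def)

text \<open>Reversing the index of \<open>Sp\<close> swaps the two halves and changes the sign; in
  the orthogonal types all signs are 1. This reflects that the form is alternating or
  symmetric.\<close>

lemma gram_sign_flip: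
  assumes "i < msize T n"
  shows "gram_sign T n (msize T n - Suc i) = (if T = Sp then - 1 else 1) * gram_sign T n i"
  using assms by (cases T) (auto simp: gram_sign_def msize_def)

lemma star_carrier [simp]: "star T n A \<in> carrier_mat (msize T n) (msize T n)"
  by (simp add: star_def)

lemma star_entry:
  "i < msize T n \<Longrightarrow> j < msize T n \<Longrightarrow>
    star T n A $$ (i, j) = gram_sign T n i * gram_sign T n j * A $$ (msize T n - 1 - j, msize T n - 1 - i)"
  by (simp add: star_def)

lemma star_star:
  assumes A: "A \<in> carrier_mat (msize T n) (msize T n)"
  shows "star T n (star T n A) = A"
proof (rule eq_matI)
  fix i j assume "i < dim_row A" "j < dim_col A"
  then have ij: "i < msize T n" "j < msize T n" using A by auto
  then show "star T n (star T n A) $$ (i, j) = A $$ (i, j)"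
    by (subst star_entry[OF ij], subst star_entry) (auto simp: gram_sign_flip mult.left_commute)
qed (use A in \<open>auto simp: star_def\<close>)

text \<open>The sign at the summation index occurs twice and cancels; reversing that index matches
  the two sums.\<close>

lemma star_mult:
  fixes A B :: "'a::field mat"
  assumes A: "A \<in> carrier_mat (msize T n) (msize T n)" and B: "B \<in> carrier_mat (msize T n) (msize T n)"
  shows "star T n (A * B) = star T n B * star T n A"
proof (rule eq_matI)
  let ?m = "msize T n" and ?s = "gram_sign T n :: nat \<Rightarrow> 'a"
  fix i j assume "i < dim_row (star T n B * star T n A)" "j < dim_col (star T n B * star T n A)"
  then have ij: "i < ?m" "j < ?m" by (simp_all add: star_def)
  have "star T n (A * B) $$ (i, j) =
      (\<Sum>l=0..<?m. ?s i * ?s j * (A $$ (?m - 1 - j, l) * B $$ (l, ?m - 1 - i)))"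
    unfolding star_entry[OF ij] using ij
    by (subst mult_entry[OF A B]) (simp_all add: sum_distrib_left)
  also have "\<dots> = (\<Sum>l=0..<?m. star T n B $$ (i, l) * star T n A $$ (l, j))"
    by (rule sum.reindex_bij_witness[of _ "\<lambda>l. ?m - 1 - l" "\<lambda>l. ?m - 1 - l"])
      (use ij in \<open>auto simp: star_entry mult_ac\<close>)
  also have "\<dots> = (star T n B * star T n A) $$ (i, j)"
    using ij by (subst mult_entry[of _ ?m ?m _ ?m]) simp_all
  finally show "star T n (A * B) $$ (i, j) = (star T n B * star T n A) $$ (i, j)" .
qed (simp_all add: star_def)

lemma star_one: "star T n (1\<^sub>m (msize T n)) = 1\<^sub>m (msize T n)"
  by (rule eq_matI) (auto simp: star_def)

lemma star_minus:
  assumes "A \<in> carrier_mat (msize T n) (msize T n)" "B \<in> carrier_mat (msize T n) (msize T n)"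
  shows "star T n (A - B) = star T n A - star T n B"
  using assms by (intro eq_matI) (auto simp: star_def right_diff_distrib)

lemma star_uminus:
  assumes "A \<in> carrier_mat (msize T n) (msize T n)"
  shows "star T n (- A) = - star T n A"
  using assms by (intro eq_matI) (auto simp: star_def)

lemma star_unitri:
  assumes "A \<in> unitri (msize T n)"
  shows "star T n A \<in> unitri (msize T n)"
  using assms by (auto simp: unitri_iff star_entry)

lemma star_double_coset_rel:
  assumes A: "A \<in> carrier_mat (msize T n) (msize T n)" and AB: "double_coset_rel (msize T n) A B"
  shows "double_coset_rel (msize T n) (star T n A) (star T n B)"
proof -
  let ?m = "msize T n"
  obtain a b where ab: "a \<in> unitri ?m" "b \<in> unitri ?m" and eq: "B = a * A * b"
    using AB unfolding double_coset_rel_def by blast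
  have cr: "a \<in> carrier_mat ?m ?m" "b \<in> carrier_mat ?m ?m" using ab by (auto intro: unitri_carrier)
  have "star T n B = star T n b * (star T n A * star T n a)"
    unfolding eq using cr A by (simp add: star_mult mult_carrier_mat[of _ ?m ?m] del: assoc_mult_mat)
  also have "\<dots> = star T n b * star T n A * star T n a"
    by (rule assoc_mult_mat[symmetric, of _ ?m ?m _ ?m _ ?m]) simp_all
  finally show ?thesis by (intro double_coset_relI[of "star T n b" _ "star T n a"]) (simp_all add: ab star_unitri)
qed

lemma gram_mult_entry:
  fixes A :: "'a::field mat"
  assumes A: "A \<in> carrier_mat (msize T n) (msize T n)" and ij: "i < msize T n" "j < msize T n"
  shows "(gram T n * A) $$ (i, j) = gram_sign T n i * A $$ (msize T n - 1 - i, j)"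
proof -
  have "(gram T n * A) $$ (i, j) = (\<Sum>l=0..<msize T n. gram T n $$ (i, l) * A $$ (l, j))"
    by (rule mult_entry[OF _ A ij]) (simp add: gram_def)
  also have "\<dots> = (\<Sum>l=0..<msize T n. if l = msize T n - 1 - i then gram_sign T n i * A $$ (l, j) else 0)"
    by (rule sum.cong) (use ij in \<open>auto simp: gram_def gram_sign_def\<close>)
  finally show ?thesis using ij by simp
qed

lemma mult_gram_entry:
  fixes A :: "'a::field mat"
  assumes A: "A \<in> carrier_mat (msize T n) (msize T n)" and ij: "i < msize T n" "j < msize T n"
  shows "(A * gram T n) $$ (i, j) = A $$ (i, msize T n - 1 - j) * gram_sign T n (msize T n - 1 - j)"
proof -
  have "(A * gram T n) $$ (i, j) = (\<Sum>l=0..<msize T n. A $$ (i, l) * gram T n $$ (l, j))"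
    by (rule mult_entry[OF A _ ij]) (simp add: gram_def)
  also have "\<dots> = (\<Sum>l=0..<msize T n. if l = msize T n - 1 - j then A $$ (i, l) * gram_sign T n l else 0)"
    by (rule sum.cong) (use ij in \<open>auto simp: gram_def gram_sign_def\<close>)
  finally show ?thesis using ij by simp
qed

lemma transpose_mult_gram:
  fixes x :: "'a::field mat"
  assumes x: "x \<in> carrier_mat (msize T n) (msize T n)"
  shows "transpose_mat x * gram T n = gram T n * star T n x"
proof (rule eq_matI)
  let ?m = "msize T n"
  fix i j assume "i < dim_row (gram T n * star T n x)" "j < dim_col (gram T n * star T n x)"
  then have ij: "i < ?m" "j < ?m" by (simp_all add: star_def gram_def)
  have "gram_sign T n i * (gram_sign T n (?m - 1 - i) * gram_sign T n j) = (gram_sign T n (?m - 1 - j) :: 'a)"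
    using ij by (simp add: gram_sign_flip mult_ac)
  then show "(transpose_mat x * gram T n) $$ (i, j) = (gram T n * star T n x) $$ (i, j)"
    using ij x by (simp add: mult_gram_entry gram_mult_entry star_entry mult_ac del: index_mult_mat(1))
qed (use x in \<open>simp_all add: star_def gram_def\<close>)

lemma gram_mult_cancel:
  assumes A: "A \<in> carrier_mat (msize T n) (msize T n)" and B: "B \<in> carrier_mat (msize T n) (msize T n)"
    and eq: "gram T n * A = gram T n * B"
  shows "A = B"
proof (rule eq_matI)
  fix i j assume "i < dim_row B" "j < dim_col B"
  then have ij: "i < msize T n" "j < msize T n" using B by auto
  then have "(gram T n * A) $$ (msize T n - 1 - i, j) = (gram T n * B) $$ (msize T n - 1 - i, j)"
    by (simp add: eq)
  then show "A $$ (i, j) = B $$ (i, j)"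
    using ij A B by (simp add: gram_mult_entry gram_sign_def del: index_mult_mat(1) split: if_splits)
qed (use A B in auto)

text \<open>By \<open>transpose_mult_gram\<close> the isometry condition reads
  \<open>gram T n * (star T n x * x) = gram T n\<close>, and the Gram matrix can be
  cancelled.\<close>

lemma Uset_iff:
  "x \<in> Uset T n \<longleftrightarrow> x \<in> unitri (msize T n) \<and> star T n x * x = 1\<^sub>m (msize T n)"
proof -
  let ?m = "msize T n"
  have "transpose_mat x * gram T n * x = gram T n \<longleftrightarrow> star T n x * x = 1\<^sub>m ?m"
    if x: "x \<in> carrier_mat ?m ?m"
  proof -
    have g: "gram T n \<in> carrier_mat ?m ?m" by (simp add: gram_def)
    have sx: "star T n x * x \<in> carrier_mat ?m ?m" using x by (rule mult_carrier_mat[OF star_carrier])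
    have "transpose_mat x * gram T n * x = gram T n * (star T n x * x)"
      unfolding transpose_mult_gram[OF x] by (rule assoc_mult_mat[OF g star_carrier x])
    moreover have "gram T n * 1\<^sub>m ?m = gram T n" by (rule right_mult_one_mat[OF g])
    ultimately show ?thesis using gram_mult_cancel[OF sx, of "1\<^sub>m ?m"] by auto
  qed
  then show ?thesis unfolding Uset_def isometries_def by (auto dest: unitri_carrier)
qed

text \<open>The involution \<sigma> of the opening sketch. Inversion and adjoint both reverse
  products, so their composite is an automorphism of the unitriangular group.\<close>

definition twist :: "gtype \<Rightarrow> nat \<Rightarrow> 'a::field mat \<Rightarrow> 'a mat" where
  "twist T n x = uinv (msize T n) (star T n x)"

lemma twist_unitri: "x \<in> unitri (msize T n) \<Longrightarrow> twist T n x \<in> unitri (msize T n)"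
  unfolding twist_def by (intro uinv star_unitri)

lemma twist_twist:
  assumes x: "x \<in> unitri (msize T n)"
  shows "twist T n (twist T n x) = x"
  unfolding twist_def[of T n "twist T n x"]
proof (rule uinv_unique[OF star_unitri[OF twist_unitri[OF x]] x])
  have sx: "star T n x \<in> unitri (msize T n)" by (rule star_unitri[OF x])
  have "x * star T n (twist T n x) = star T n (star T n x) * star T n (twist T n x)"
    using x by (simp add: star_star unitri_carrier)
  also have "\<dots> = star T n (twist T n x * star T n x)"
    using twist_unitri[OF x] by (simp add: star_mult unitri_carrier)
  also have "\<dots> = 1\<^sub>m (msize T n)" unfolding twist_def uinv(2)[OF sx] by (rule star_one)
  finally show "x * star T n (twist T n x) = 1\<^sub>m (msize T n)" .
qed

lemma Uset_iff_twist: "x \<in> Uset T n \<longleftrightarrow> x \<in> unitri (msize T n) \<and> twist T n x = x"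
proof -
  have "star T n x * x = 1\<^sub>m (msize T n) \<longleftrightarrow> twist T n x = x" if x: "x \<in> unitri (msize T n)"
  proof
    note sx = star_unitri[OF x]
    show "twist T n x = x" if "star T n x * x = 1\<^sub>m (msize T n)"
      using uinv_unique[OF x sx that] uinv_cancel(3)[OF sx, of "uinv (msize T n) (star T n x)"]
        group.inv_inv[OF group_unitri_group[of "msize T n"], of x] x by (simp add: twist_def uinv_def)
    show "star T n x * x = 1\<^sub>m (msize T n)" if "twist T n x = x"
      using uinv(3)[OF sx] that by (simp add: twist_def)
  qed
  then show ?thesis by (auto simp: Uset_iff)
qed

text \<open>The resolvent identity: inversion carries the double coset of a difference to that of
  its negative.\<close>

lemma uinv_minus:
  assumes xy: "x \<in> unitri m" "y \<in> unitri m"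
  shows "uinv m x - uinv m y = uinv m x * - (x - y) * uinv m y"
proof -
  have c: "x \<in> carrier_mat m m" "y \<in> carrier_mat m m" "uinv m x \<in> carrier_mat m m" "uinv m y \<in> carrier_mat m m"
    using xy uinv by (auto intro: unitri_carrier)
  have "- (x - y) = y - x" using c by (intro eq_matI) auto
  then have "uinv m x * - (x - y) * uinv m y = uinv m x * y * uinv m y - uinv m x * x * uinv m y"
    using c by (simp add: mult_minus_distrib_mat[of _ m m] minus_mult_distrib_mat[of _ m m _ _ m] mult_carrier_mat[of _ m m] del: assoc_mult_mat)
  also have "\<dots> = uinv m x - uinv m y"
    using c uinv(2)[OF xy(1)] uinv_cancel(3)[OF xy(2) c(3)] by simp
  finally show ?thesis by simp
qed

text \<open>The resolvent identity for the adjoints of \<open>x\<close> and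
  \<open>y\<close>.\<close>

lemma twist_double_coset_rel:
  assumes x: "x \<in> unitri (msize T n)" and y: "y \<in> unitri (msize T n)"
  shows "double_coset_rel (msize T n) (- star T n (x - y)) (twist T n x - twist T n y)"
proof -
  have "twist T n x - twist T n y =
      twist T n x * - star T n (x - y) * twist T n y"
    unfolding twist_def using uinv_minus[OF star_unitri[OF x] star_unitri[OF y]] x y
    by (simp add: star_minus unitri_carrier)
  then show ?thesis by (intro double_coset_relI[OF twist_unitri[OF x] twist_unitri[OF y]])
qed

text \<open>A single twist replaces the double coset of \<open>x - y\<close> by that of
  \<open>- star T n (x - y)\<close>; conjugation does this twice, and the two changes
  cancel.\<close>

lemma coset_isometry_twist_conj:
  assumes \<rho>: "coset_isometry (msize T n) \<rho>"
  shows "coset_isometry (msize T n) (\<lambda>x. twist T n (\<rho> (twist T n x)))"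
  unfolding coset_isometry_def
proof (intro conjI ballI)
  let ?m = "msize T n"
  fix x :: "'a mat" assume x: "x \<in> unitri ?m"
  then show "twist T n (\<rho> (twist T n x)) \<in> unitri ?m"
    by (intro twist_unitri coset_isometryD(1)[OF \<rho>])
  fix y :: "'a mat" assume y: "y \<in> unitri ?m"
  define a where "a = twist T n x"
  define b where "b = twist T n y"
  have ab: "a \<in> unitri ?m" "b \<in> unitri ?m" "\<rho> a \<in> unitri ?m" "\<rho> b \<in> unitri ?m"
    using x y by (auto simp: a_def b_def intro!: twist_unitri coset_isometryD(1)[OF \<rho>])
  have c: "x - y \<in> carrier_mat ?m ?m" "a - b \<in> carrier_mat ?m ?m" "\<rho> a - \<rho> b \<in> carrier_mat ?m ?m"
    "- star T n (x - y) \<in> carrier_mat ?m ?m"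
    using x y ab by (auto intro!: minus_carrier_mat simp: unitri_carrier)
  have "double_coset_rel ?m (- star T n (x - y)) (\<rho> a - \<rho> b)"
    using double_coset_rel_trans[OF c(4)] twist_double_coset_rel[OF x y] coset_isometryD(2)[OF \<rho> ab(1,2)]
    unfolding a_def b_def by blast
  from double_coset_rel_uminus[OF _ star_double_coset_rel[OF c(4) this]]
  have "double_coset_rel ?m (- star T n (- star T n (x - y))) (- star T n (\<rho> a - \<rho> b))" by simp
  then have "double_coset_rel ?m (x - y) (- star T n (\<rho> a - \<rho> b))"
    using c(1) by (simp add: star_uminus star_star)
  from double_coset_rel_trans[OF c(1) this twist_double_coset_rel[OF ab(3,4)]]
  show "double_coset_rel ?m (x - y) (twist T n (\<rho> (twist T n x)) - twist T n (\<rho> (twist T n y)))"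
    unfolding a_def b_def .
qed


lemma two_sided_unitri:
  "a \<in> unitri m \<Longrightarrow> b \<in> unitri m \<Longrightarrow> x \<in> unitri m \<Longrightarrow> two_sided m a b x \<in> unitri m"
  by (rule coset_isometryD(1)[OF coset_isometry_two_sided])

lemma twist_one: "twist T n (1\<^sub>m (msize T n)) = 1\<^sub>m (msize T n)"
  unfolding twist_def star_one by (rule uinv_unique) (simp_all add: one_unitri)

text \<open>
  With \<open>\<beta> w = 1 + a (w - 1) b\<close> mapping \<open>z\<close> to \<open>z'\<close> and \<open>\<sigma>\<close> the twist, \<open>c = \<beta>\<^sup>-\<^sup>1 \<sigma> \<beta> \<sigma>\<close> fixes \<open>z\<close> and
  \<open>\<sigma> c \<sigma> = c\<^sup>-\<^sup>1\<close>.  As \<open>c\<close> has odd order, it has a square root \<open>s\<close> among its powers, and \<open>\<beta> s\<close> commutes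
  with \<open>\<sigma>\<close> and still maps \<open>z\<close> to \<open>z'\<close>.
\<close>

theorem equivariant_coset_isometry:
  fixes z z' :: "'a::field mat"
  assumes p: "of_nat p = (0::'a)" "odd p" and z: "z \<in> Uset T n" and z': "z' \<in> Uset T n"
    and zz': "double_coset_rel (msize T n) (z - 1\<^sub>m (msize T n)) (z' - 1\<^sub>m (msize T n))"
  obtains \<rho> where "coset_isometry (msize T n) \<rho>" "\<rho> z = z'" "\<rho> (1\<^sub>m (msize T n)) = 1\<^sub>m (msize T n)"
    "\<And>x. x \<in> unitri (msize T n) \<Longrightarrow> \<rho> (twist T n x) = twist T n (\<rho> x)"
proof -
  let ?m = "msize T n"
  obtain a b where ab: "a \<in> unitri ?m" "b \<in> unitri ?m" and eq: "z' - 1\<^sub>m ?m = a * (z - 1\<^sub>m ?m) * b"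
    using zz' unfolding double_coset_rel_def by blast
  have zu: "z \<in> unitri ?m" "twist T n z = z" "z' \<in> unitri ?m" "twist T n z' = z'"
    using z z' by (auto simp: Uset_iff_twist)
  define \<sigma> :: "'a mat \<Rightarrow> 'a mat" where "\<sigma> = twist T n"
  define \<beta> where "\<beta> = two_sided ?m a b"
  define \<beta>' where "\<beta>' = two_sided ?m (uinv ?m a) (uinv ?m b)"
  have cl: "\<And>x. x \<in> unitri ?m \<Longrightarrow> \<sigma> x \<in> unitri ?m" "\<And>x. x \<in> unitri ?m \<Longrightarrow> \<beta> x \<in> unitri ?m"
    "\<And>x. x \<in> unitri ?m \<Longrightarrow> \<beta>' x \<in> unitri ?m"
    using ab uinv by (auto simp: \<sigma>_def \<beta>_def \<beta>'_def intro!: twist_unitri two_sided_unitri)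
  have inv: "\<And>x. x \<in> unitri ?m \<Longrightarrow> \<sigma> (\<sigma> x) = x" "\<And>x. x \<in> unitri ?m \<Longrightarrow> \<beta>' (\<beta> x) = x"
    "\<And>x. x \<in> unitri ?m \<Longrightarrow> \<beta> (\<beta>' x) = x"
    using ab by (auto simp: \<sigma>_def \<beta>_def \<beta>'_def twist_twist two_sided_inverse)
  have \<beta>1: "\<beta> (1\<^sub>m ?m) = 1\<^sub>m ?m" "\<beta>' (1\<^sub>m ?m) = 1\<^sub>m ?m" "\<sigma> (1\<^sub>m ?m) = 1\<^sub>m ?m"
    using ab by (auto simp: \<beta>_def \<beta>'_def \<sigma>_def two_sided_one twist_one uinv(1))
  have "\<beta> z = 1\<^sub>m ?m + (z' - 1\<^sub>m ?m)" by (simp add: \<beta>_def two_sided_def eq)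
  also have "\<dots> = z'" using unitri_carrier[OF zu(3)] by (intro eq_matI) auto
  finally have \<beta>z: "\<beta> z = z'" .
  define c where "c x = \<beta>' (\<sigma> (\<beta> (\<sigma> x)))" for x
  have ciso: "coset_isometry ?m c"
    unfolding c_def \<sigma>_def \<beta>_def \<beta>'_def
    by (intro coset_isometry_comp[OF coset_isometry_two_sided coset_isometry_twist_conj]
        coset_isometry_two_sided uinv ab)
  have cz: "c z = z" using zu \<beta>z inv(2)[OF zu(1)] by (simp add: c_def \<sigma>_def)
  have c1: "c (1\<^sub>m ?m) = 1\<^sub>m ?m" by (simp add: c_def \<beta>1)
  \<comment> \<open>The power of \<open>c\<close> with exponent \<open>p ^ ?m\<close> is the
    identity on unitriangular matrices, and \<open>2 * h\<close> exceeds this odd exponent by one,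
    so \<open>c ^^ h\<close> is a square root of \<open>c\<close>.\<close>
  define h where "h = (p ^ ?m + 1) div 2"
  define s where "s = c ^^ h"
  have siso: "coset_isometry ?m s" unfolding s_def by (rule coset_isometry_funpow[OF ciso])
  have scl: "s x \<in> unitri ?m" if "x \<in> unitri ?m" for x using coset_isometryD(1)[OF siso that] .
  have "odd (p ^ ?m)" using p(2) by simp
  then have hh: "h + h = Suc (p ^ ?m)" unfolding h_def by presburger
  have ss: "s (s x) = c x" if "x \<in> unitri ?m" for x
  proof -
    have "s (s x) = (c ^^ (h + h)) x" by (simp add: s_def funpow_add)
    also have "\<dots> = c ((c ^^ (p ^ ?m)) x)" unfolding hh by simp
    also have "\<dots> = c x" by (simp only: coset_isometry_order[OF ciso p(1) that])
    finally show ?thesis .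
  qed
  \<comment> \<open>That is, \<sigma> conjugates \<open>c\<close> to its inverse; the same then
    holds for the powers of \<open>c\<close>, in particular for \<open>s\<close>.\<close>
  have c\<sigma>c: "c (\<sigma> (c x)) = \<sigma> x" if "x \<in> unitri ?m" for x
    using that by (simp add: c_def cl inv)
  have "(c ^^ k) (\<sigma> ((c ^^ k) x)) = \<sigma> x" if "x \<in> unitri ?m" for k x
  proof (induction k)
    case (Suc k)
    have "(c ^^ k) x \<in> unitri ?m" using coset_isometryD(1)[OF coset_isometry_funpow[OF ciso] that] .
    then show ?case using Suc by (simp add: funpow_swap1[of c] c\<sigma>c) (simp add: funpow_swap1[of c, symmetric] c\<sigma>c)
  qed simp
  then have s\<sigma>s: "s (\<sigma> (s x)) = \<sigma> x" if "x \<in> unitri ?m" for x using that by (simp add: s_def)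
  have fixed: "s x = x" if "c x = x" for x
  proof -
    have "(c ^^ k) x = x" for k by (induction k) (simp_all add: that)
    then show ?thesis by (simp add: s_def)
  qed
  show thesis
  proof (rule that[of "\<lambda>x. \<beta> (s x)"])
    show "coset_isometry ?m (\<lambda>x. \<beta> (s x))"
      by (rule coset_isometry_comp[OF _ siso]) (simp add: \<beta>_def coset_isometry_two_sided ab)
    show "\<beta> (s z) = z'" by (simp add: fixed cz \<beta>z)
    show "\<beta> (s (1\<^sub>m ?m)) = 1\<^sub>m ?m" by (simp add: fixed c1 \<beta>1)
    fix x :: "'a mat" assume x: "x \<in> unitri ?m"
    \<comment> \<open>By the definition of \<open>c\<close>, \<sigma> after \<beta> is \<beta> after
      \<open>c\<close> after \<sigma>. Then \<open>c\<close> splits as \<open>s\<close> applied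
      twice, and \<open>s\<sigma>s\<close> absorbs one of these together with the inner
      \<open>s\<close>.\<close>
    have "\<sigma> (\<beta> (s x)) = \<beta> (c (\<sigma> (s x)))" using x by (simp add: c_def cl inv scl)
    also have "c (\<sigma> (s x)) = s (\<sigma> x)" using x by (simp add: ss[symmetric] s\<sigma>s cl scl)
    finally show "\<beta> (s (twist T n x)) = twist T n (\<beta> (s x))" by (simp add: \<sigma>_def)
  qed
qed

section \<open>The finite group \<open>Uset T n\<close> and invariance of convolution sums\<close>

lemma Uset_subset_unitri: "Uset T n \<subseteq> unitri (msize T n)"
  by (auto simp: Uset_def)

text \<open>On \<open>Uset T n\<close> the inverse is the adjoint, which reverses products and is an
  involution.\<close>

lemma subgroup_Uset: "subgroup (Uset T n) (unitri_group (msize T n))"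
proof (rule group.subgroupI[OF group_unitri_group])
  show "Uset T n \<subseteq> carrier (unitri_group (msize T n))" using Uset_subset_unitri by simp
  have "1\<^sub>m (msize T n) \<in> Uset T n" by (simp add: Uset_iff_twist one_unitri twist_one)
  then show "Uset T n \<noteq> {}" by blast
  let ?m = "msize T n"
  fix x y :: "'a mat" assume x: "x \<in> Uset T n"
  then have xu: "x \<in> unitri ?m" and sx: "star T n x * x = 1\<^sub>m ?m" by (auto simp: Uset_iff)
  have ix: "uinv ?m x = star T n x" by (rule uinv_unique[OF xu star_unitri[OF xu] sx])
  show "inv\<^bsub>unitri_group ?m\<^esub> x \<in> Uset T n"
    unfolding uinv_def[symmetric] ix
    using star_unitri[OF xu] uinv(3)[OF xu] xu by (simp add: Uset_iff star_star unitri_carrier ix)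
  assume y: "y \<in> Uset T n"
  then have yu: "y \<in> unitri ?m" and sy: "star T n y * y = 1\<^sub>m ?m" by (auto simp: Uset_iff)
  have c: "x \<in> carrier_mat ?m ?m" "y \<in> carrier_mat ?m ?m" using xu yu by (auto intro: unitri_carrier)
  have "star T n (x * y) * (x * y) = star T n y * (star T n x * x * y)"
    using c star_carrier[of T n x] star_carrier[of T n y]
    by (simp add: star_mult mult_carrier_mat[of _ ?m ?m] assoc_mult_mat[of _ ?m ?m _ ?m _ ?m])
  also have "\<dots> = 1\<^sub>m ?m" unfolding sx using c sy by simp
  finally show "x \<otimes>\<^bsub>unitri_group ?m\<^esub> y \<in> Uset T n" using xu yu by (simp add: Uset_iff unitri_mult)
qed

lemma Ugrp_eq: "Ugrp T n = (unitri_group (msize T n))\<lparr>carrier := Uset T n\<rparr>"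
  by (simp add: Ugrp_def unitri_group_def)

lemma group_Ugrp: "group (Ugrp T n)"
  unfolding Ugrp_eq by (rule subgroup.subgroup_is_group[OF subgroup_Uset group_unitri_group])

lemma inv_Ugrp: "x \<in> Uset T n \<Longrightarrow> inv\<^bsub>Ugrp T n\<^esub> x = uinv (msize T n) x"
  unfolding Ugrp_eq uinv_def by (rule group.m_inv_consistent[OF group_unitri_group subgroup_Uset])

lemma finite_carrier_mat: "finite (carrier_mat r c :: 'a::finite mat set)"
proof -
  have "carrier_mat r c \<subseteq> (\<lambda>f. mat r c f) ` (({..<r} \<times> {..<c}) \<rightarrow>\<^sub>E (UNIV :: 'a set))"
  proof
    fix A :: "'a mat" assume A: "A \<in> carrier_mat r c"
    have "A = mat r c (\<lambda>x\<in>{..<r} \<times> {..<c}. A $$ x)" using A by (intro eq_matI) auto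
    moreover have "(\<lambda>x\<in>{..<r} \<times> {..<c}. A $$ x) \<in> ({..<r} \<times> {..<c}) \<rightarrow>\<^sub>E UNIV" by simp
    ultimately show "A \<in> (\<lambda>f. mat r c f) ` (({..<r} \<times> {..<c}) \<rightarrow>\<^sub>E UNIV)" by blast
  qed
  then show ?thesis by (rule finite_subset) (simp add: finite_PiE)
qed

lemma finite_Uset: "finite (Uset T n :: 'a::{field, finite} mat set)"
  using finite_carrier_mat by (rule finite_subset[rotated]) (auto simp: Uset_def unitri_def)

text \<open>An equivariant \<rho> with \<open>\<rho> z = z'\<close> is substituted for the summation
  variable. It fixes the identity, so \<xi> keeps its value at \<open>x\<close>. As
  \<open>z * uinv (msize T n) x - 1\<close> is equivalent to \<open>z - x\<close>, whose double
  coset \<rho> preserves, \<zeta> keeps its value too.\<close>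

lemma sum_convolution_invariant:
  fixes \<xi> \<zeta> :: "'a::{field, finite} mat \<Rightarrow> complex"
  assumes p: "of_nat p = (0::'a)" "odd p"
    and inv: "\<And>x y. x \<in> Uset T n \<Longrightarrow> y \<in> Uset T n \<Longrightarrow>
        double_coset_rel (msize T n) (x - 1\<^sub>m (msize T n)) (y - 1\<^sub>m (msize T n)) \<Longrightarrow> \<xi> x = \<xi> y \<and> \<zeta> x = \<zeta> y"
    and z: "z \<in> Uset T n" and z': "z' \<in> Uset T n"
    and zz': "double_coset_rel (msize T n) (z - 1\<^sub>m (msize T n)) (z' - 1\<^sub>m (msize T n))"
  shows "(\<Sum>x\<in>Uset T n. \<xi> x * \<zeta> (z * uinv (msize T n) x)) = (\<Sum>x\<in>Uset T n. \<xi> x * \<zeta> (z' * uinv (msize T n) x))"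
proof -
  let ?m = "msize T n"
  obtain \<rho> where \<rho>: "coset_isometry ?m \<rho>" "\<rho> z = z'" "\<rho> (1\<^sub>m ?m) = 1\<^sub>m ?m"
    "\<And>x. x \<in> unitri ?m \<Longrightarrow> \<rho> (twist T n x) = twist T n (\<rho> x)"
    using equivariant_coset_isometry[OF p z z' zz'] by blast
  have U: "x \<in> unitri ?m" if "x \<in> Uset T n" for x using that by (simp add: Uset_iff_twist)
  \<comment> \<open>Commuting with the twist, \<rho> preserves its fixed points.\<close>
  have \<rho>U: "\<rho> x \<in> Uset T n" if "x \<in> Uset T n" for x
    using that \<rho>(4)[of x] coset_isometryD(1)[OF \<rho>(1), of x] by (simp add: Uset_iff_twist)
  have "inj_on \<rho> (Uset T n)" using coset_isometry_inj[OF \<rho>(1)] by (rule inj_on_subset) (rule Uset_subset_unitri)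
  moreover from this have "\<rho> ` Uset T n = Uset T n"
    by (intro endo_inj_surj finite_Uset) (use \<rho>U in auto)
  ultimately have bij: "bij_betw \<rho> (Uset T n) (Uset T n)" by (simp add: bij_betw_def)
  have sub: "x * uinv ?m y \<in> Uset T n" if "x \<in> Uset T n" "y \<in> Uset T n" for x y :: "'a mat"
    using subgroup.m_closed[OF subgroup_Uset that(1) subgroup.m_inv_closed[OF subgroup_Uset that(2)]]
    by (simp add: uinv_def)
  have quot: "x * uinv ?m y - 1\<^sub>m ?m = (x - y) * uinv ?m y" if "x \<in> unitri ?m" "y \<in> unitri ?m" for x y :: "'a mat"
    using that uinv(1,3)[OF that(2)] minus_mult_distrib_mat[of x ?m ?m y "uinv ?m y" ?m] by (simp add: unitri_carrier)
  have "(\<Sum>x\<in>Uset T n. \<xi> x * \<zeta> (z' * uinv ?m x)) = (\<Sum>x\<in>Uset T n. \<xi> (\<rho> x) * \<zeta> (\<rho> z * uinv ?m (\<rho> x)))"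
    unfolding \<rho>(2) by (rule sum.reindex_bij_betw[OF bij, symmetric])
  also have "\<dots> = (\<Sum>x\<in>Uset T n. \<xi> x * \<zeta> (z * uinv ?m x))"
  proof (rule sum.cong[OF refl])
    fix x :: "'a mat" assume x: "x \<in> Uset T n"
    note xu = U[OF x] and zu = U[OF z] and rxu = U[OF \<rho>U[OF x]] and rzu = U[OF \<rho>U[OF z]]
    have c: "x \<in> carrier_mat ?m ?m" "z \<in> carrier_mat ?m ?m" "\<rho> x \<in> carrier_mat ?m ?m" "\<rho> z \<in> carrier_mat ?m ?m"
      using xu zu rxu rzu by (auto intro: unitri_carrier)
    have "double_coset_rel ?m (x - 1\<^sub>m ?m) (\<rho> x - 1\<^sub>m ?m)"
      using coset_isometryD(2)[OF \<rho>(1) xu one_unitri] \<rho>(3) by simp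
    then have 1: "\<xi> x = \<xi> (\<rho> x)" using inv[OF x \<rho>U[OF x]] by simp
    have d: "z - x \<in> carrier_mat ?m ?m" "(z - x) * uinv ?m x \<in> carrier_mat ?m ?m" "\<rho> z - \<rho> x \<in> carrier_mat ?m ?m"
      using c uinv(1)[OF xu] by (auto intro!: minus_carrier_mat mult_carrier_mat[of _ ?m ?m] simp: unitri_carrier)
    have "double_coset_rel ?m ((z - x) * uinv ?m x) (z - x)"
      by (rule double_coset_rel_sym[OF d(1) double_coset_rel_mult(2)[OF d(1) uinv(1)[OF xu]]])
    from double_coset_rel_trans[OF d(2) this coset_isometryD(2)[OF \<rho>(1) zu xu]]
    have "double_coset_rel ?m ((z - x) * uinv ?m x) (\<rho> z - \<rho> x)" .
    from double_coset_rel_trans[OF d(2) this double_coset_rel_mult(2)[OF d(3) uinv(1)[OF rxu]]]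
    have "double_coset_rel ?m (z * uinv ?m x - 1\<^sub>m ?m) (\<rho> z * uinv ?m (\<rho> x) - 1\<^sub>m ?m)"
      by (simp only: quot xu zu rxu rzu)
    then have "\<zeta> (z * uinv ?m x) = \<zeta> (\<rho> z * uinv ?m (\<rho> x))"
      using inv[OF sub[OF z x] sub[OF \<rho>U[OF z] \<rho>U[OF x]]] by simp
    with 1 show "\<xi> (\<rho> x) * \<zeta> (\<rho> z * uinv ?m (\<rho> x)) = \<xi> x * \<zeta> (z * uinv ?m x)" by simp
  qed
  finally show ?thesis by simp
qed


section \<open>Normal forms of double cosets\<close>

definition rook :: "nat \<Rightarrow> 'a::field mat \<Rightarrow> bool" where
  "rook m A \<longleftrightarrow> A \<in> carrier_mat m m \<and>
    (\<forall>i<m. \<forall>j<m. \<forall>j'<m. A $$ (i, j) \<noteq> 0 \<and> A $$ (i, j') \<noteq> 0 \<longrightarrow> j = j') \<and>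
    (\<forall>i<m. \<forall>i'<m. \<forall>j<m. A $$ (i, j) \<noteq> 0 \<and> A $$ (i', j) \<noteq> 0 \<longrightarrow> i = i')"

text \<open>A unitriangular left factor can add a row only to rows above it; dually, a right factor
  can add a column only to columns on its right. This dictates the choice of pivots.\<close>

lemma row_transvection:
  fixes B :: "'a::field mat" and c :: "nat \<Rightarrow> 'a"
  assumes B: "B \<in> carrier_mat m m" and i: "i < m"
  defines "g \<equiv> mat m m (\<lambda>(k, l). if k = l then 1 else if l = i \<and> k < i then c k else 0)"
  shows "g \<in> unitri m" and "k < m \<Longrightarrow> l < m \<Longrightarrow>
    (g * B) $$ (k, l) = B $$ (k, l) + (if k < i then c k * B $$ (i, l) else 0)"
proof -
  show "g \<in> unitri m" by (auto simp: unitri_iff g_def)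
  assume kl: "k < m" "l < m"
  have "(g * B) $$ (k, l) = (\<Sum>j=0..<m. g $$ (k, j) * B $$ (j, l))"
    by (rule mult_entry[OF _ B kl]) (simp add: g_def)
  also have "\<dots> = (\<Sum>j=0..<m. (if j = k then B $$ (j, l) else 0) +
      (if j = i then (if k < i then c k * B $$ (j, l) else 0) else 0))"
    by (rule sum.cong) (use kl in \<open>auto simp: g_def\<close>)
  also have "\<dots> = B $$ (k, l) + (if k < i then c k * B $$ (i, l) else 0)"
    using kl i by (simp add: sum.distrib)
  finally show "(g * B) $$ (k, l) = B $$ (k, l) + (if k < i then c k * B $$ (i, l) else 0)" .
qed

lemma col_transvection:
  fixes B :: "'a::field mat" and c :: "nat \<Rightarrow> 'a"
  assumes B: "B \<in> carrier_mat m m" and t: "t < m"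
  defines "g \<equiv> mat m m (\<lambda>(k, l). if k = l then 1 else if k = t \<and> t < l then c l else 0)"
  shows "g \<in> unitri m" and "k < m \<Longrightarrow> l < m \<Longrightarrow>
    (B * g) $$ (k, l) = B $$ (k, l) + (if t < l then B $$ (k, t) * c l else 0)"
proof -
  show "g \<in> unitri m" by (auto simp: unitri_iff g_def)
  assume kl: "k < m" "l < m"
  have "(B * g) $$ (k, l) = (\<Sum>j=0..<m. B $$ (k, j) * g $$ (j, l))"
    by (rule mult_entry[OF B _ kl]) (simp add: g_def)
  also have "\<dots> = (\<Sum>j=0..<m. (if j = l then B $$ (k, j) else 0) +
      (if j = t then (if t < l then B $$ (k, j) * c l else 0) else 0))"
    by (rule sum.cong) (use kl in \<open>auto simp: g_def\<close>)
  also have "\<dots> = B $$ (k, l) + (if t < l then B $$ (k, t) * c l else 0)"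
    using kl t by (simp add: sum.distrib)
  finally show "(B * g) $$ (k, l) = B $$ (k, l) + (if t < l then B $$ (k, t) * c l else 0)" .
qed

text \<open>The invariant of the elimination after \<open>t\<close> columns. The second clause
  ranges over all columns, so pivot rows are already clear in the columns still to come.\<close>

definition rook_upto :: "nat \<Rightarrow> nat \<Rightarrow> 'a::field mat \<Rightarrow> bool" where
  "rook_upto m t B \<longleftrightarrow>
    (\<forall>j<t. \<forall>i<m. \<forall>i'<m. B $$ (i, j) \<noteq> 0 \<and> B $$ (i', j) \<noteq> 0 \<longrightarrow> i = i') \<and>
    (\<forall>j<t. \<forall>i<m. \<forall>l<m. B $$ (i, j) \<noteq> 0 \<and> l \<noteq> j \<longrightarrow> B $$ (i, l) = 0)"

text \<open>The pivot is the lowest nonzero entry of column \<open>t\<close>: row operations going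
  upwards clear the rest of the column, then column operations going right clear the rest of the
  pivot row.\<close>

lemma rook_upto_step:
  fixes B :: "'a::field mat"
  assumes B: "B \<in> carrier_mat m m" and t: "t < m" and rk: "rook_upto m t B"
  shows "\<exists>D. double_coset_rel m B D \<and> rook_upto m (Suc t) D"
proof (cases "\<forall>k<m. B $$ (k, t) = 0")
  case True
  then have "rook_upto m (Suc t) B" using rk by (auto simp: rook_upto_def less_Suc_eq)
  then show ?thesis using double_coset_rel_refl[OF B] by blast
next
  case False
  define i where "i = Max {k. k < m \<and> B $$ (k, t) \<noteq> 0}"
  have "i \<in> {k. k < m \<and> B $$ (k, t) \<noteq> 0}" unfolding i_def by (rule Max_in) (use False in auto)
  then have i: "i < m" "B $$ (i, t) \<noteq> 0" by auto
  have low: "B $$ (k, t) = 0" if "i < k" "k < m" for k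
    using Max_ge[of "{k. k < m \<and> B $$ (k, t) \<noteq> 0}" k] that unfolding i_def[symmetric] by auto
  \<comment> \<open>A nonzero entry on the left would make row \<open>i\<close> an earlier pivot
    row, and such rows vanish in column \<open>t\<close>.\<close>
  have left: "B $$ (i, l) = 0" if "l < t" for l
    using rk i t that unfolding rook_upto_def by (metis nat_neq_iff)
  have pivot_row: "B $$ (k, l) = 0" if "j < t" "k < m" "l < m" "B $$ (k, j) \<noteq> 0" "l \<noteq> j" for j k l
    using rk that unfolding rook_upto_def by blast
  define c where "c k = - B $$ (k, t) / B $$ (i, t)" for k
  define d where "d l = - B $$ (i, l) / B $$ (i, t)" for l
  define g where "g = mat m m (\<lambda>(k, l). if k = l then 1 else if l = i \<and> k < i then c k else 0)"
  define h where "h = mat m m (\<lambda>(k, l). if k = l then 1 else if k = t \<and> t < l then d l else 0)"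
  define C where "C = g * B"
  define D where "D = C * h"
  have gu: "g \<in> unitri m" unfolding g_def by (rule row_transvection(1)[OF B i(1)])
  have hu: "h \<in> unitri m" unfolding h_def by (rule col_transvection(1)[OF B t])
  have Cc: "C \<in> carrier_mat m m" using B unitri_carrier[OF gu] by (simp add: C_def)
  have C: "C $$ (k, l) = B $$ (k, l) + (if k < i then c k * B $$ (i, l) else 0)" if "k < m" "l < m" for k l
    unfolding C_def g_def by (rule row_transvection(2)[OF B i(1) that])
  have Ct: "C $$ (k, t) = (if k = i then B $$ (i, t) else 0)" if "k < m" for k
    using C[OF that t] low[of k] that i by (cases k i rule: linorder_cases) (simp_all add: c_def)
  have D: "D $$ (k, l) = C $$ (k, l) + (if t < l then C $$ (k, t) * d l else 0)" if "k < m" "l < m" for k l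
    unfolding D_def h_def by (rule col_transvection(2)[OF Cc t that])
  have D1: "D $$ (k, l) = B $$ (k, l)" if "k < m" "l < t" for k l
    using D[of k l] C[of k l] left[of l] that t by simp
  have D2: "D $$ (k, t) = (if k = i then B $$ (i, t) else 0)" if "k < m" for k
    using D[of k t] Ct[of k] that t by simp
  have D3: "D $$ (i, l) = 0" if "t < l" "l < m" for l
    using D[of i l] C[of i l] Ct[of i] that i by (simp add: d_def)
  have D4: "D $$ (k, l) = B $$ (k, l) + (if k < i then c k * B $$ (i, l) else 0)"
    if "t < l" "l < m" "k < m" "k \<noteq> i" for k l
    using D[of k l] C[of k l] Ct[of k] that by simp
  have "rook_upto m (Suc t) D"
    unfolding rook_upto_def
  proof (intro conjI allI impI)
    fix j k k' assume *: "j < Suc t" "k < m" "k' < m" "D $$ (k, j) \<noteq> 0 \<and> D $$ (k', j) \<noteq> 0"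
    show "k = k'"
    proof (cases "j = t")
      case True
      then show ?thesis using * D2 by (metis (full_types))
    next
      case False
      then have "j < t" "B $$ (k, j) \<noteq> 0" "B $$ (k', j) \<noteq> 0" using * D1[of k j] D1[of k' j] by auto
      then show ?thesis using * rk unfolding rook_upto_def by blast
    qed
  next
    fix j k l assume *: "j < Suc t" "k < m" "l < m" "D $$ (k, j) \<noteq> 0 \<and> l \<noteq> j"
    show "D $$ (k, l) = 0"
    proof (cases "j = t")
      case True
      then have "k = i" using * D2[of k] by (simp split: if_splits)
      then show ?thesis using * True D1[of i l] left[of l] D3[of l] by (cases l t rule: linorder_cases) auto
    next
      case False
      then have j: "j < t" "B $$ (k, j) \<noteq> 0" using * D1[of k j] by auto
      have B0: "B $$ (k, l) = 0" "B $$ (k, t) = 0"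
        using pivot_row[OF j(1) *(2) _ j(2)] * t j by auto
      \<comment> \<open>Earlier pivot rows vanish in column \<open>t\<close>, so their multiplier is
        zero and they stay unchanged.\<close>
      then have "k \<noteq> i" "c k = 0" using i by (auto simp: c_def)
      then show ?thesis using * B0 D1[of k l] D2[of k] D4[of l k] by (cases l t rule: linorder_cases) auto
    qed
  qed
  moreover have "double_coset_rel m B D"
    by (rule double_coset_relI[OF gu hu]) (simp add: D_def C_def)
  ultimately show ?thesis by blast
qed

lemma rook_exists:
  assumes A: "A \<in> carrier_mat m m"
  shows "\<exists>B. double_coset_rel m A B \<and> rook m B"
proof -
  have "\<exists>B. double_coset_rel m A B \<and> rook_upto m t B" if "t \<le> m" for t
    using that
  proof (induction t)
    case 0
    show ?case using double_coset_rel_refl[OF A] by (auto simp: rook_upto_def)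
  next
    case (Suc t)
    then obtain B where B: "double_coset_rel m A B" "rook_upto m t B" by auto
    have "t < m" using Suc.prems by simp
    then obtain D where D: "double_coset_rel m B D" "rook_upto m (Suc t) D"
      using rook_upto_step[OF double_coset_rel_carrier[OF A B(1)] _ B(2)] by blast
    then show ?case using double_coset_rel_trans[OF A B(1) D(1)] by blast
  qed
  from this[of m] obtain B where B: "double_coset_rel m A B" "rook_upto m m B" by auto
  have "rook m B"
    unfolding rook_def
  proof (intro conjI allI impI)
    show "B \<in> carrier_mat m m" by (rule double_coset_rel_carrier[OF A B(1)])
    fix i j j' assume *: "i < m" "j < m" "j' < m" "B $$ (i, j) \<noteq> 0 \<and> B $$ (i, j') \<noteq> 0"
    show "j = j'"
    proof (rule ccontr)
      assume "j \<noteq> j'"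
      then have "B $$ (i, j') = 0" using B(2) * unfolding rook_upto_def by metis
      then show False using * by simp
    qed
  next
    fix i i' j assume "i < m" "i' < m" "j < m" "B $$ (i, j) \<noteq> 0 \<and> B $$ (i', j) \<noteq> 0"
    then show "i = i'" using B(2) unfolding rook_upto_def by blast
  qed
  then show ?thesis using B by blast
qed

section \<open>Uniqueness of rook forms\<close>

lemma rook_double_coset_support:
  assumes r: "rook m r" and r': "rook m r'" and rel: "double_coset_rel m r r'"
    and ij: "i < m" "j < m" "r' $$ (i, j) \<noteq> 0"
  shows "\<exists>l\<le>j. r $$ (i, l) \<noteq> 0 \<and> (l = j \<longrightarrow> r $$ (i, j) = r' $$ (i, j))"
proof -
  obtain a b where ab: "a \<in> unitri m" "b \<in> unitri m" and eq: "r' = a * r * b"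
    using rel unfolding double_coset_rel_def by blast
  have c: "a \<in> carrier_mat m m" "b \<in> carrier_mat m m" "r \<in> carrier_mat m m" "r' \<in> carrier_mat m m"
    using ab r r' by (auto intro: unitri_carrier simp: rook_def)
  define g where "g = uinv m a"
  have g: "g \<in> unitri m" "g \<in> carrier_mat m m" using uinv(1)[OF ab(1)] by (auto simp: g_def intro: unitri_carrier)
  have "g * r' = g * (a * (r * b))" using c by (simp add: eq assoc_mult_mat[of _ m m _ m _ m])
  also have "\<dots> = r * b" unfolding g_def using c by (simp only: uinv_cancel ab mult_carrier_mat[of _ m m])
  \<comment> \<open>The equivalence is rewritten with one unitriangular factor on each side, so that
    both products can be compared entrywise.\<close>
  finally have gr: "g * r' = r * b" .
  have "(g * r') $$ (i, j) = (\<Sum>l=0..<m. g $$ (i, l) * r' $$ (l, j))"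
    by (rule mult_entry[OF g(2) c(4) ij(1,2)])
  \<comment> \<open>Column \<open>j\<close> of \<open>r'\<close> has its only nonzero entry in row
    \<open>i\<close>, and \<open>g\<close> has ones on the diagonal.\<close>
  also have "\<dots> = (\<Sum>l=0..<m. if l = i then r' $$ (i, j) else 0)"
  proof (rule sum.cong[OF refl])
    fix l assume "l \<in> {0..<m}"
    then show "g $$ (i, l) * r' $$ (l, j) = (if l = i then r' $$ (i, j) else 0)"
      using g(1) r' ij by (auto simp: unitri_iff rook_def)
  qed
  finally have 1: "(r * b) $$ (i, j) = r' $$ (i, j)" using ij unfolding gr by simp
  have 2: "(r * b) $$ (i, j) = (\<Sum>l=0..<m. r $$ (i, l) * b $$ (l, j))"
    by (rule mult_entry[OF c(3,2) ij(1,2)])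
  then obtain l where l: "l < m" "r $$ (i, l) \<noteq> 0" "b $$ (l, j) \<noteq> 0"
    using 1 ij(3) by (metis (no_types, lifting) atLeastLessThan_iff mult_eq_0_iff sum.neutral)
  have "l \<le> j" using l ab(2) ij by (auto simp: unitri_iff not_less[symmetric])
  moreover have "r $$ (i, j) = r' $$ (i, j)" if "l = j"
  proof -
    have "(\<Sum>l=0..<m. r $$ (i, l) * b $$ (l, j)) = (\<Sum>l=0..<m. if l = j then r $$ (i, j) else 0)"
    proof (rule sum.cong[OF refl])
      fix k assume "k \<in> {0..<m}"
      then show "r $$ (i, k) * b $$ (k, j) = (if k = j then r $$ (i, j) else 0)"
        using r ab(2) ij l that by (auto simp: unitri_iff rook_def)
    qed
    then show ?thesis using 1 2 ij by simp
  qed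
  ultimately show ?thesis using l by blast
qed

text \<open>The support lemma, applied in both directions, gives nonzero entries in columns
  \<open>j' \<le> l \<le> j\<close> of the same row. That row of \<open>s'\<close> has only one
  nonzero entry, so the three columns coincide and the values agree.\<close>

lemma rook_unique:
  assumes r: "rook m r" and r': "rook m r'" and rel: "double_coset_rel m r r'"
  shows "r = r'"
proof -
  have *: "s $$ (i, j) = s' $$ (i, j)"
    if s: "rook m s" and s': "rook m s'" and rel: "double_coset_rel m s s'"
      and ij: "i < m" "j < m" "s' $$ (i, j) \<noteq> 0" for s s' :: "'a mat" and i j
  proof -
    obtain l where l: "l \<le> j" "s $$ (i, l) \<noteq> 0" "l = j \<longrightarrow> s $$ (i, j) = s' $$ (i, j)"
      using rook_double_coset_support[OF s s' rel ij] by blast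
    have rel': "double_coset_rel m s' s" using s by (intro double_coset_rel_sym[OF _ rel]) (simp add: rook_def)
    have "l < m" using l ij by simp
    then obtain j' where j': "j' \<le> l" "s' $$ (i, j') \<noteq> 0"
      using rook_double_coset_support[OF s' s rel' ij(1) _ l(2)] by blast
    then have "j' = j" using s' ij \<open>l < m\<close> unfolding rook_def by (metis le_less_trans)
    then show ?thesis using l j' by simp
  qed
  have rel': "double_coset_rel m r' r" using r by (intro double_coset_rel_sym[OF _ rel]) (simp add: rook_def)
  show ?thesis
  proof (rule eq_matI)
    fix i j assume "i < dim_row r'" "j < dim_col r'"
    then have "i < m" "j < m" using r' by (auto simp: rook_def)
    then show "r $$ (i, j) = r' $$ (i, j)"
      using *[OF r r' rel, of i j] *[OF r' r rel', of i j] by metis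
  qed (use r r' in \<open>auto simp: rook_def\<close>)
qed


section \<open>Superclasses and double cosets\<close>

text \<open>\<open>star\<close> reflects positions in the antidiagonal up to signs, which exchanges
  the row and column conditions.\<close>

lemma rook_uminus_star:
  fixes r :: "'a::field mat"
  assumes "rook (msize T n) r"
  shows "rook (msize T n) (- star T n r)"
proof -
  let ?m = "msize T n"
  have c: "r \<in> carrier_mat ?m ?m" using assms by (simp add: rook_def)
  have nz: "(- star T n r) $$ (i, j) \<noteq> 0 \<longleftrightarrow> r $$ (?m - 1 - j, ?m - 1 - i) \<noteq> 0"
    if "i < ?m" "j < ?m" for i j
  proof -
    have "(- star T n r) $$ (i, j) = - (gram_sign T n i * gram_sign T n j * r $$ (?m - 1 - j, ?m - 1 - i))"
      using that by (simp add: star_def)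
    then show ?thesis by (simp add: gram_sign_def)
  qed
  have row: "\<And>i j j'. i < ?m \<Longrightarrow> j < ?m \<Longrightarrow> j' < ?m \<Longrightarrow> r $$ (i, j) \<noteq> 0 \<Longrightarrow> r $$ (i, j') \<noteq> 0 \<Longrightarrow> j = j'"
    and col: "\<And>i i' j. i < ?m \<Longrightarrow> i' < ?m \<Longrightarrow> j < ?m \<Longrightarrow> r $$ (i, j) \<noteq> 0 \<Longrightarrow> r $$ (i', j) \<noteq> 0 \<Longrightarrow> i = i'"
    using assms unfolding rook_def by blast+
  show ?thesis
    unfolding rook_def
  proof (intro conjI allI impI)
    show "- star T n r \<in> carrier_mat ?m ?m" by simp
    fix i j j' assume *: "i < ?m" "j < ?m" "j' < ?m"
      "(- star T n r) $$ (i, j) \<noteq> 0 \<and> (- star T n r) $$ (i, j') \<noteq> 0"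
    then have "?m - 1 - j = ?m - 1 - j'"
      using nz[of i j] nz[of i j'] by (intro col[of _ _ "?m - 1 - i"]) simp_all
    then show "j = j'" using * by linarith
  next
    fix i i' j assume *: "i < ?m" "i' < ?m" "j < ?m"
      "(- star T n r) $$ (i, j) \<noteq> 0 \<and> (- star T n r) $$ (i', j) \<noteq> 0"
    then have "?m - 1 - i = ?m - 1 - i'"
      using nz[of i j] nz[of i' j] by (intro row[of "?m - 1 - j"]) simp_all
    then show "i = i'" using * by linarith
  qed
qed

text \<open>For \<open>N = x - 1\<close>, the relation \<open>star T n x * x = 1\<close> gives
  \<open>- star T n N = star T n x * N\<close>, so \<open>N\<close> is equivalent to its negated
  adjoint. The same holds for its rook form \<open>r\<close>, and uniqueness turns the equivalence
  into an equality.\<close>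

lemma Uset_skew_rook:
  fixes x :: "'a::field mat"
  assumes x: "x \<in> Uset T n"
  obtains r where "rook (msize T n) r" "double_coset_rel (msize T n) r (x - 1\<^sub>m (msize T n))"
    "r \<in> superdiagonal (msize T n) 1" "- star T n r = r"
proof -
  let ?m = "msize T n"
  define N where "N = x - 1\<^sub>m ?m"
  have xu: "x \<in> unitri ?m" and sx: "star T n x * x = 1\<^sub>m ?m" using x by (auto simp: Uset_iff)
  have ix: "uinv ?m x = star T n x" by (rule uinv_unique[OF xu star_unitri[OF xu] sx])
  have xc: "x \<in> carrier_mat ?m ?m" using xu by (rule unitri_carrier)
  have Nc: "N \<in> carrier_mat ?m ?m" using xc by (simp add: N_def minus_carrier_mat)
  obtain r where r: "double_coset_rel ?m N r" "rook ?m r" using rook_exists[OF Nc] by blast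
  have rc: "r \<in> carrier_mat ?m ?m" using r by (simp add: rook_def)
  have rN: "double_coset_rel ?m r N" by (rule double_coset_rel_sym[OF Nc r(1)])
  have "- star T n N = star T n x * N"
  proof -
    have sc: "star T n x \<in> carrier_mat ?m ?m" by simp
    have "- star T n N = - (star T n x - 1\<^sub>m ?m)"
      unfolding N_def star_minus[OF xc one_carrier_mat] star_one ..
    also have "\<dots> = 1\<^sub>m ?m - star T n x"
      using carrier_matD[OF sc] by (intro eq_matI) (simp_all del: carrier_matD)
    also have "\<dots> = star T n x * N"
      unfolding N_def mult_minus_distrib_mat[OF sc xc one_carrier_mat] sx right_mult_one_mat[OF sc] ..
    finally show ?thesis .
  qed
  then have "double_coset_rel ?m N (- star T n N)"
    using double_coset_rel_mult(1)[OF Nc star_unitri[OF xu]] by simp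
  from double_coset_rel_trans[OF rc rN this]
  have "double_coset_rel ?m r (- star T n N)" .
  from double_coset_rel_trans[OF rc this double_coset_rel_uminus[OF _ star_double_coset_rel[OF Nc r(1)]]]
  have "double_coset_rel ?m r (- star T n r)" by simp
  then have skew: "- star T n r = r" using rook_unique[OF r(2) rook_uminus_star[OF r(2)]] by simp
  have "N \<in> superdiagonal ?m 1" using xu by (simp add: N_def unitri_iff_superdiagonal)
  then have "r \<in> superdiagonal ?m 1"
    using double_coset_rel_entry[OF _ r(1), of 1] rc unfolding superdiagonal_def by simp
  then show thesis using that[of r] r(2) rN skew by (simp add: N_def)
qed

text \<open>
  The matrix position of the first of the (at most two) entries of a root; the other one is its mirror image
  in the antidiagonal.
\<close>

fun root_position :: "gtype \<Rightarrow> nat \<Rightarrow> root \<Rightarrow> nat \<times> nat" where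
  "root_position T n (Minus i j) = (i - 1, j - 1)"
| "root_position T n (Plus i j) = (i - 1, msize T n - j)"
| "root_position T n (Double i) = (i - 1, msize T n - i)"
| "root_position T n (Single i) = (i - 1, n)"

section \<open>Roots as matrix positions\<close>

lemma roots_cases:
  assumes "\<alpha> \<in> roots T n"
  obtains (Minus) i j where "\<alpha> = Minus i j" "1 \<le> i" "i < j" "j \<le> n"
  | (Plus) i j where "\<alpha> = Plus i j" "1 \<le> i" "i < j" "j \<le> n"
  | (Double) i where "\<alpha> = Double i" "T = Sp" "1 \<le> i" "i \<le> n"
  | (Single) i where "\<alpha> = Single i" "T = O_odd" "1 \<le> i" "i \<le> n"
  using assms by (cases T) (auto simp: roots_def)

lemma msize_cases: "msize T n = 2 * n + (if T = O_odd then 1 else 0)"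
  by (cases T) (simp_all add: msize_def)

text \<open>One position above the diagonal from each pair mirrored in the antidiagonal. Positions
  on the antidiagonal count only for \<open>Sp\<close>, where they belong to the roots
  \<open>Double i\<close>.\<close>

definition half_positions :: "gtype \<Rightarrow> nat \<Rightarrow> (nat \<times> nat) set" where
  "half_positions T n = {(a, b). a < b \<and> (a + b + 1 < msize T n \<or> T = Sp \<and> a + b + 1 = msize T n)}"

lemma root_position_in: "\<alpha> \<in> roots T n \<Longrightarrow> root_position T n \<alpha> \<in> half_positions T n"
  by (erule roots_cases) (auto simp: half_positions_def msize_cases)

lemma inj_on_root_position: "inj_on (root_position T n) (roots T n)"
proof (rule inj_onI)
  fix \<alpha> \<beta> assume "\<alpha> \<in> roots T n" "\<beta> \<in> roots T n" "root_position T n \<alpha> = root_position T n \<beta>"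
  then show "\<alpha> = \<beta>"
    by (elim roots_cases) (auto simp: msize_cases split: if_splits)
qed

lemma root_position_image: "root_position T n ` roots T n = half_positions T n"
proof (intro equalityI subsetI)
  fix q assume "q \<in> half_positions T n"
  then obtain a b where q: "q = (a, b)" and ab: "a < b"
    "a + b + 1 < msize T n \<or> T = Sp \<and> a + b + 1 = msize T n" by (auto simp: half_positions_def)
  \<comment> \<open>The inverse of \<open>root_position\<close>; adding one turns positions counted
    from 0 into labels counted from 1.\<close>
  define \<alpha> where "\<alpha> = (if a + b + 1 = msize T n then Double (a + 1)
    else if b < n then Minus (a + 1) (b + 1)
    else if T = O_odd \<and> b = n then Single (a + 1) else Plus (a + 1) (msize T n - b))"
  have "\<alpha> \<in> roots T n" "root_position T n \<alpha> = q"
    using ab by (cases T; auto simp: \<alpha>_def roots_def msize_cases q)+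
  then show "q \<in> root_position T n ` roots T n" by blast
qed (auto intro: root_position_in)

lemma finite_half_positions: "finite (half_positions T n)"
  by (rule finite_subset[of _ "{..<msize T n} \<times> {..<msize T n}"]) (auto simp: half_positions_def)

lemma finite_roots: "finite (roots T n)"
  by (rule finite_imageD[OF _ inj_on_root_position]) (simp add: root_position_image finite_half_positions)

lemma munit_entry:
  "a < msize T n \<Longrightarrow> b < msize T n \<Longrightarrow>
    munit T n i j $$ (a, b) = (if a = position T n i \<and> b = position T n j then 1 else 0)"
  by (simp add: munit_def)

lemma munit_carrier [simp]: "munit T n i j \<in> carrier_mat (msize T n) (msize T n)"
  by (simp add: munit_def)

lemma position_simps:
  "1 \<le> i \<Longrightarrow> position T n (int i) = i - 1" "1 \<le> i \<Longrightarrow> position T n (- int i) = msize T n - i"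
  "position T n 0 = n"
  by (simp_all add: position_def)

text \<open>Off the antidiagonal a position differs from its mirror image, so the two indicators
  never overlap. The reflection is moved from \<open>(x, y)\<close> to
  \<open>(a, b)\<close>.\<close>

lemma unit_and_mirror_entry:
  fixes a b m x y :: nat and c :: "'a::ring_1"
  assumes "a < m" "b < m" "x < m" "y < m" "x + y + 1 \<noteq> m"
  shows "(if a = x \<and> b = y then 1 else 0) + (if a = m - 1 - y \<and> b = m - 1 - x then c else 0) =
    (if (x, y) = (a, b) then 1 else if (x, y) = (m - 1 - b, m - 1 - a) then c else 0)"
proof -
  have flip: "u = m - 1 - v \<longleftrightarrow> v = m - 1 - u" if "u < m" "v < m" for u v :: nat
    using that by linarith
  have *: "a = m - 1 - y \<and> b = m - 1 - x \<longleftrightarrow> x = m - 1 - b \<and> y = m - 1 - a"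
    using flip[OF assms(1,4)] flip[OF assms(2,3)] by metis
  show ?thesis
  proof (cases "a = x \<and> b = y")
    case True
    then have "x = a" by simp
    have "a \<noteq> m - 1 - y"
    proof
      assume "a = m - 1 - y"
      then have "x + y + 1 = m" using \<open>x = a\<close> assms(4) by linarith
      then show False using assms(5) by contradiction
    qed
    then show ?thesis using True by simp
  next
    case False
    then have "\<not> (x = a \<and> y = b)" by metis
    with False show ?thesis unfolding * prod.inject by (simp only: if_False add_0)
  qed
qed

text \<open>One formula for all kinds of roots: the mirrored entry carries the sign that makes the
  matrix equal to its negated adjoint.\<close>

lemma root_mat_entry:
  fixes a b :: nat
  assumes "\<alpha> \<in> roots T n" and ab: "a < msize T n" "b < msize T n"
  shows "(root_mat T n \<alpha> $$ (a, b) :: 'a::field) =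
    (if root_position T n \<alpha> = (a, b) then 1
     else if root_position T n \<alpha> = (msize T n - 1 - b, msize T n - 1 - a)
     then - (gram_sign T n a * gram_sign T n b) else 0)"
    (is "_ = (if _ then 1 else if _ = (?m - 1 - b, ?m - 1 - a) then _ else 0)")
  using assms(1)
proof (cases rule: roots_cases)
  case (Minus i j)
  then have m: "2 * n \<le> ?m" by (simp_all add: msize_cases)
  have e: "?m - 1 - (j - 1) = ?m - j" "?m - 1 - (i - 1) = ?m - i" using Minus m by linarith+
  have s: "- (gram_sign T n a * gram_sign T n b) = (- 1 :: 'a)" if "a = ?m - j \<and> b = ?m - i"
  proof -
    have "n \<le> a" "n \<le> b" using that Minus(2-4) m by linarith+
    then show ?thesis using Minus by (simp add: gram_sign_def)
  qed
  have "root_mat T n \<alpha> $$ (a, b) = (if a = i - 1 \<and> b = j - 1 then 1 else 0) +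
      (if a = ?m - j \<and> b = ?m - i then - 1 else (0::'a))"
    using Minus ab by (simp add: munit_entry position_simps carrier_matD[OF munit_carrier])
  also have "\<dots> = (if a = i - 1 \<and> b = j - 1 then 1 else 0) +
      (if a = ?m - 1 - (j - 1) \<and> b = ?m - 1 - (i - 1) then - (gram_sign T n a * gram_sign T n b) else 0)"
    unfolding e by (rule arg_cong[where f = "(+) _"], rule if_cong[OF refl _ refl], rule s[symmetric])
  also have "\<dots> = (if (i - 1, j - 1) = (a, b) then 1
      else if (i - 1, j - 1) = (?m - 1 - b, ?m - 1 - a) then - (gram_sign T n a * gram_sign T n b) else 0)"
    by (rule unit_and_mirror_entry[OF ab]) (use Minus m in linarith)+
  finally show ?thesis unfolding Minus(1) root_position.simps .
next
  case (Plus i j)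
  then have m: "2 * n \<le> ?m" by (simp_all add: msize_cases)
  have e: "?m - 1 - (?m - j) = j - 1" "?m - 1 - (i - 1) = ?m - i" using Plus m by linarith+
  have s: "- (gram_sign T n a * gram_sign T n b) = ((if T = Sp then 1 else - 1) :: 'a)" if "a = j - 1 \<and> b = ?m - i"
  proof -
    have "\<not> n \<le> a" "n \<le> b" using that Plus(2-4) m by linarith+
    then show ?thesis using Plus by (simp add: gram_sign_def)
  qed
  have "root_mat T n \<alpha> $$ (a, b) = (if a = i - 1 \<and> b = ?m - j then 1 else 0) +
      (if a = j - 1 \<and> b = ?m - i then (if T = Sp then 1 else - 1) else (0::'a))"
    using Plus ab by (cases "T = Sp") (simp_all add: munit_entry position_simps carrier_matD[OF munit_carrier])
  also have "\<dots> = (if a = i - 1 \<and> b = ?m - j then 1 else 0) +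
      (if a = ?m - 1 - (?m - j) \<and> b = ?m - 1 - (i - 1) then - (gram_sign T n a * gram_sign T n b) else 0)"
    unfolding e by (rule arg_cong[where f = "(+) _"], rule if_cong[OF refl _ refl], rule s[symmetric])
  also have "\<dots> = (if (i - 1, ?m - j) = (a, b) then 1
      else if (i - 1, ?m - j) = (?m - 1 - b, ?m - 1 - a) then - (gram_sign T n a * gram_sign T n b) else 0)"
    by (rule unit_and_mirror_entry[OF ab]) (use Plus m in linarith)+
  finally show ?thesis unfolding Plus(1) root_position.simps .
next
  case (Double i)
  have m: "2 * n = ?m" using Double by (simp add: msize_cases)
  \<comment> \<open>A \<open>Double\<close> position is its own mirror image, so the second case of
    the formula does not arise.\<close>
  have "(i - 1, ?m - i) = (a, b)" if "(i - 1, ?m - i) = (?m - 1 - b, ?m - 1 - a)"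
  proof -
    have "i - 1 = ?m - 1 - b" "?m - i = ?m - 1 - a" using that by simp_all
    then have "i - 1 = a" "?m - i = b" using Double(3,4) ab m by linarith+
    then show ?thesis by simp
  qed
  moreover have "(root_mat T n \<alpha> $$ (a, b) :: 'a) = (if (i - 1, ?m - i) = (a, b) then 1 else 0)"
    using Double ab by (simp add: munit_entry position_simps)
  ultimately show ?thesis unfolding Double(1) root_position.simps by presburger
next
  case (Single i)
  then have m: "2 * n + 1 = ?m" by (simp_all add: msize_cases)
  have e: "?m - 1 - (n) = n" "?m - 1 - (i - 1) = ?m - i" using Single m by linarith+
  have s: "- (gram_sign T n a * gram_sign T n b) = (- 1 :: 'a)" if "a = n \<and> b = ?m - i"
  proof -
    have "T \<noteq> Sp" using Single by simp
    then show ?thesis using Single by (simp add: gram_sign_def)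
  qed
  have "root_mat T n \<alpha> $$ (a, b) = (if a = i - 1 \<and> b = n then 1 else 0) +
      (if a = n \<and> b = ?m - i then - 1 else (0::'a))"
    using Single ab by (simp add: munit_entry position_simps carrier_matD[OF munit_carrier])
  also have "\<dots> = (if a = i - 1 \<and> b = n then 1 else 0) +
      (if a = ?m - 1 - (n) \<and> b = ?m - 1 - (i - 1) then - (gram_sign T n a * gram_sign T n b) else 0)"
    unfolding e by (rule arg_cong[where f = "(+) _"], rule if_cong[OF refl _ refl], rule s[symmetric])
  also have "\<dots> = (if (i - 1, n) = (a, b) then 1
      else if (i - 1, n) = (?m - 1 - b, ?m - 1 - a) then - (gram_sign T n a * gram_sign T n b) else 0)"
    by (rule unit_and_mirror_entry[OF ab]) (use Single m in linarith)+
  finally show ?thesis unfolding Single(1) root_position.simps .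
qed

text \<open>Skewness ties mirrored entries together, so a skew strictly upper triangular matrix is
  determined by its entries at the root positions.\<close>

lemma pair_mat_skew_rook:
  fixes r :: "'a::field mat"
  assumes two: "(2::'a) \<noteq> 0" and r: "r \<in> superdiagonal (msize T n) 1" and skew: "- star T n r = r"
  shows "pair_mat T n {\<alpha> \<in> roots T n. r $$ root_position T n \<alpha> \<noteq> 0} (\<lambda>\<alpha>. r $$ root_position T n \<alpha>) = r"
    (is "pair_mat T n ?D ?\<phi> = r")
proof (rule eq_matI)
  let ?m = "msize T n" and ?s = "gram_sign T n :: nat \<Rightarrow> 'a"
  have rc: "r \<in> carrier_mat ?m ?m" using r by (simp add: superdiagonal_def)
  then show "dim_row (pair_mat T n ?D ?\<phi>) = dim_row r" "dim_col (pair_mat T n ?D ?\<phi>) = dim_col r"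
    by (auto simp: pair_mat_def)
  fix a b assume "a < dim_row r" "b < dim_col r"
  then have ab: "a < ?m" "b < ?m" using rc by auto
  define q where "q = (?m - 1 - b, ?m - 1 - a)"
  \<comment> \<open>The weight with which the coefficient at position \<open>p\<close> contributes
    to the entry \<open>(a, b)\<close>.\<close>
  define w where "w p = (if p = (a, b) then 1 else if p = q then - (?s a * ?s b) else 0)" for p
  have skew_entry: "r $$ (a, b) = - (?s a * ?s b) * r $$ q"
  proof -
    have "r $$ (a, b) = (- star T n r) $$ (a, b)" by (simp only: skew)
    also have "\<dots> = - (?s a * ?s b) * r $$ q" using ab by (simp add: star_def q_def)
    finally show ?thesis .
  qed
  have "pair_mat T n ?D ?\<phi> $$ (a, b) = (\<Sum>\<alpha>\<in>?D. ?\<phi> \<alpha> * w (root_position T n \<alpha>))"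
    unfolding pair_mat_def w_def q_def using ab by (simp add: root_mat_entry)
  also have "\<dots> = (\<Sum>\<alpha>\<in>roots T n. r $$ root_position T n \<alpha> * w (root_position T n \<alpha>))"
    by (rule sum.mono_neutral_left) (auto simp: finite_roots)
  also have "\<dots> = (\<Sum>p\<in>half_positions T n. r $$ p * w p)"
    unfolding root_position_image[symmetric] by (simp add: sum.reindex[OF inj_on_root_position])
  also have "\<dots> = r $$ (a, b)"
  proof (cases "(a, b) \<in> half_positions T n")
    case True
    then have "q = (a, b) \<or> q \<notin> half_positions T n" using ab by (auto simp: half_positions_def q_def)
    then have "(\<Sum>p\<in>half_positions T n. r $$ p * w p) = (\<Sum>p\<in>half_positions T n. if p = (a, b) then r $$ p else 0)"
      by (intro sum.cong refl) (auto simp: w_def)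
    then show ?thesis using True finite_half_positions by simp
  next
    case False
    note nab = this
    have "(\<Sum>p\<in>half_positions T n. r $$ p * w p) =
        (\<Sum>p\<in>half_positions T n. if p = q then - (?s a * ?s b) * r $$ p else 0)"
      using False by (intro sum.cong refl) (auto simp: w_def)
    also have "\<dots> = (if q \<in> half_positions T n then r $$ (a, b) else 0)"
      using finite_half_positions by (simp add: skew_entry)
    also have "\<dots> = r $$ (a, b)"
    proof (cases "q \<in> half_positions T n")
      case q: False
      have "r $$ (a, b) = 0"
      proof (cases "a < b")
        case True
        then have "T \<noteq> Sp" "a + b + 1 = ?m" using nab q ab by (auto simp: half_positions_def q_def)
        then have "q = (a, b)" "?s a = 1" "?s b = 1" by (auto simp: q_def gram_sign_def)
        \<comment> \<open>In the orthogonal types skewness makes an antidiagonal entry its own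
          negative; it vanishes because 2 is nonzero.\<close>
        then have "r $$ (a, b) = - r $$ (a, b)" using skew_entry by simp
        then have "r $$ (a, b) + r $$ (a, b) = 0" by (rule iffD1[OF eq_neg_iff_add_eq_0])
        then have "2 * r $$ (a, b) = 0" unfolding mult_2 .
        then show ?thesis using two by simp
      next
        case False
        then show ?thesis using r ab by (simp add: superdiagonal_def)
      qed
      then show ?thesis using q by simp
    qed simp
    finally show ?thesis .
  qed
  finally show "pair_mat T n ?D ?\<phi> $$ (a, b) = r $$ (a, b)" .
qed

lemma entries_position:
  assumes "\<alpha> \<in> roots T n" "(i, j) \<in> entries \<alpha>"
  shows "\<bar>i\<bar> \<le> int n \<and> (i = 0 \<longrightarrow> T = O_odd)" "\<bar>j\<bar> \<le> int n \<and> (j = 0 \<longrightarrow> T = O_odd)"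
    "root_position T n \<alpha> = (position T n i, position T n j) \<or>
     root_position T n \<alpha> = (msize T n - 1 - position T n j, msize T n - 1 - position T n i)"
  using assms by (auto elim!: roots_cases simp: position_def msize_cases)

lemma position_less: "\<bar>i\<bar> \<le> int n \<Longrightarrow> i = 0 \<longrightarrow> T = O_odd \<Longrightarrow> position T n i < msize T n"
  by (auto simp: position_def msize_cases)

lemma position_inj:
  assumes "\<bar>i\<bar> \<le> int n" "i = 0 \<longrightarrow> T = O_odd" "\<bar>j\<bar> \<le> int n" "j = 0 \<longrightarrow> T = O_odd"
    "position T n i = position T n j"
  shows "i = j"
  using assms by (auto simp: position_def msize_cases split: if_splits)

text \<open>Skewness makes \<open>r\<close> nonzero at every entry of a selected root, not only at
  its root position, so all these entries lie in the support of a rook matrix.\<close>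

lemma basic_set_skew_rook:
  fixes r :: "'a::field mat"
  assumes rook: "rook (msize T n) r" and skew: "- star T n r = r"
  shows "basic_set T n {\<alpha> \<in> roots T n. r $$ root_position T n \<alpha> \<noteq> 0}" (is "basic_set T n ?D")
proof -
  let ?m = "msize T n" and ?p = "position T n"
  have pos: "\<bar>i\<bar> \<le> int n \<and> (i = 0 \<longrightarrow> T = O_odd)" "\<bar>j\<bar> \<le> int n \<and> (j = 0 \<longrightarrow> T = O_odd)"
    "?p i < ?m" "?p j < ?m" "r $$ (?p i, ?p j) \<noteq> 0"
    if mem: "(i, j) \<in> \<Union> (entries ` ?D)" for i j
  proof -
    obtain \<alpha> where \<alpha>: "\<alpha> \<in> roots T n" "r $$ root_position T n \<alpha> \<noteq> 0" "(i, j) \<in> entries \<alpha>" using mem by auto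
    note e = entries_position[OF \<alpha>(1,3)]
    show "\<bar>i\<bar> \<le> int n \<and> (i = 0 \<longrightarrow> T = O_odd)" "\<bar>j\<bar> \<le> int n \<and> (j = 0 \<longrightarrow> T = O_odd)"
      by (fact e)+
    show p: "?p i < ?m" "?p j < ?m" using e(1,2) position_less[of i n T] position_less[of j n T] by simp_all
    have "r $$ (?p i, ?p j) = (- star T n r) $$ (?p i, ?p j)" by (simp add: skew)
    also have "\<dots> = - (gram_sign T n (?p i) * gram_sign T n (?p j)) * r $$ (?m - 1 - ?p j, ?m - 1 - ?p i)"
      using p by (simp add: star_def)
    finally show "r $$ (?p i, ?p j) \<noteq> 0"
      using e(3) \<alpha>(2) by (auto simp: gram_sign_def split: if_splits)
  qed
  show ?thesis
    unfolding basic_set_def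
  proof (intro conjI allI impI)
    fix i j j' assume "(i, j) \<in> \<Union> (entries ` ?D) \<and> (i, j') \<in> \<Union> (entries ` ?D)"
    note m = conjunct1[OF this] conjunct2[OF this]
    have "?p j = ?p j'"
      using rook pos(3,4,5)[OF m(1)] pos(4,5)[OF m(2)] unfolding rook_def by blast
    then show "j = j'" using position_inj[of j n T j'] pos(2)[OF m(1)] pos(2)[OF m(2)] by simp
  next
    fix i i' j assume "(i, j) \<in> \<Union> (entries ` ?D) \<and> (i', j) \<in> \<Union> (entries ` ?D)"
    note m = conjunct1[OF this] conjunct2[OF this]
    have "?p i = ?p i'"
      using rook pos(3,4,5)[OF m(1)] pos(3,5)[OF m(2)] unfolding rook_def by blast
    then show "i = i'" using position_inj[of i n T i'] pos(1)[OF m(1)] pos(1)[OF m(2)] by simp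
  qed auto
qed

section \<open>Superclass functions and their closure properties\<close>

lemma superclass_iff:
  "x \<in> superclass T n D \<phi> \<longleftrightarrow> x \<in> Uset T n \<and>
    double_coset_rel (msize T n) (pair_mat T n D \<phi>) (x - 1\<^sub>m (msize T n))"
  by (auto simp: superclass_def Vset_def double_coset_rel_def)

text \<open>The rook form of \<open>x - 1\<close> supplies the pair: its support among the root
  positions gives \<open>D\<close>, its values there give \<phi>.\<close>

lemma superclass_exists:
  fixes x :: "'a::field mat"
  assumes "(2::'a) \<noteq> 0" and x: "x \<in> Uset T n"
  shows "\<exists>D \<phi>. basic_pair T n D \<phi> \<and> x \<in> superclass T n D \<phi>"
proof -
  obtain r where r: "rook (msize T n) r" "double_coset_rel (msize T n) r (x - 1\<^sub>m (msize T n))"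
    "r \<in> superdiagonal (msize T n) 1" "- star T n r = r"
    using Uset_skew_rook[OF x] by blast
  show ?thesis
    by (intro exI[of _ "{\<alpha> \<in> roots T n. r $$ root_position T n \<alpha> \<noteq> 0}"]
        exI[of _ "\<lambda>\<alpha>. r $$ root_position T n \<alpha>"] conjI)
      (use r x assms(1) in \<open>simp_all add: basic_pair_def basic_set_skew_rook superclass_iff pair_mat_skew_rook\<close>)
qed

text \<open>All \<open>x - 1\<close> with \<open>x\<close> in one superclass lie in a single double
  coset, which determines the superclass, and the superclasses cover
  \<open>Uset T n\<close>.\<close>

lemma scf_iff:
  fixes \<eta> :: "'a::field mat \<Rightarrow> complex"
  assumes "(2::'a) \<noteq> 0"
  shows "\<eta> \<in> scf T n \<longleftrightarrow> \<eta> \<in> Uset T n \<rightarrow>\<^sub>E UNIV \<and>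
    (\<forall>x\<in>Uset T n. \<forall>y\<in>Uset T n. double_coset_rel (msize T n) (x - 1\<^sub>m (msize T n)) (y - 1\<^sub>m (msize T n)) \<longrightarrow> \<eta> x = \<eta> y)"
    (is "_ \<longleftrightarrow> _ \<and> ?inv")
proof -
  let ?m = "msize T n"
  have pc: "pair_mat T n D \<phi> \<in> carrier_mat ?m ?m" for D and \<phi> :: "root \<Rightarrow> 'a" by (simp add: pair_mat_def)
  have "?inv" if \<eta>: "\<eta> \<in> scf T n"
  proof (intro ballI impI)
    fix x y :: "'a mat"
    assume x: "x \<in> Uset T n" and y: "y \<in> Uset T n" and rel: "double_coset_rel ?m (x - 1\<^sub>m ?m) (y - 1\<^sub>m ?m)"
    obtain D \<phi> where D: "basic_pair T n D \<phi>" "x \<in> superclass T n D \<phi>" using superclass_exists[OF assms x] by blast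
    then have "y \<in> superclass T n D \<phi>"
      using y rel double_coset_rel_trans[OF pc] by (auto simp: superclass_iff)
    then show "\<eta> x = \<eta> y" using \<eta> D unfolding scf_def by blast
  qed
  moreover have "\<eta> \<in> scf T n" if \<eta>: "\<eta> \<in> Uset T n \<rightarrow>\<^sub>E UNIV" and inv: ?inv
    unfolding scf_def
  proof (intro CollectI conjI \<eta> allI impI ballI)
    fix D and \<phi> :: "root \<Rightarrow> 'a" and x y
    assume x: "x \<in> superclass T n D \<phi>" and y: "y \<in> superclass T n D \<phi>"
    then have "x - 1\<^sub>m ?m \<in> carrier_mat ?m ?m" by (simp add: minus_carrier_mat)
    moreover have "double_coset_rel ?m (x - 1\<^sub>m ?m) (pair_mat T n D \<phi>)"
      using x double_coset_rel_sym[OF pc] by (auto simp: superclass_iff)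
    ultimately have "double_coset_rel ?m (x - 1\<^sub>m ?m) (y - 1\<^sub>m ?m)"
      using y double_coset_rel_trans by (auto simp: superclass_iff)
    then show "\<eta> x = \<eta> y" using inv x y by (auto simp: superclass_iff)
  qed
  moreover have "\<eta> \<in> Uset T n \<rightarrow>\<^sub>E UNIV" if "\<eta> \<in> scf T n" using that by (simp add: scf_def)
  ultimately show ?thesis by blast
qed

text \<open>The difference of the inverse and 1 is the inverse times \<open>- (x - 1)\<close>, and
  negation respects equivalence.\<close>

lemma uinv_double_coset_rel:
  assumes x: "x \<in> unitri m" and y: "y \<in> unitri m" and rel: "double_coset_rel m (x - 1\<^sub>m m) (y - 1\<^sub>m m)"
  shows "double_coset_rel m (uinv m x - 1\<^sub>m m) (uinv m y - 1\<^sub>m m)"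
proof -
  have *: "uinv m z - 1\<^sub>m m = uinv m z * - (z - 1\<^sub>m m)" "- (z - 1\<^sub>m m) \<in> carrier_mat m m"
    if z: "z \<in> unitri m" for z :: "'a mat"
  proof -
    have c: "z \<in> carrier_mat m m" "uinv m z \<in> carrier_mat m m" using z uinv by (auto intro: unitri_carrier)
    show "- (z - 1\<^sub>m m) \<in> carrier_mat m m" using c by (simp add: minus_carrier_mat)
    have "- (z - 1\<^sub>m m) = 1\<^sub>m m - z" using c by (intro eq_matI) auto
    then show "uinv m z - 1\<^sub>m m = uinv m z * - (z - 1\<^sub>m m)"
      using c uinv(2)[OF z] mult_minus_distrib_mat[OF c(2) one_carrier_mat c(1)] by simp
  qed
  have xc: "x - 1\<^sub>m m \<in> carrier_mat m m" by (simp add: minus_carrier_mat)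
  have xc': "uinv m x - 1\<^sub>m m \<in> carrier_mat m m" by (simp add: minus_carrier_mat)
  have "double_coset_rel m (uinv m x - 1\<^sub>m m) (- (x - 1\<^sub>m m))"
    unfolding *(1)[OF x]
    by (rule double_coset_rel_sym[OF *(2)[OF x] double_coset_rel_mult(1)[OF *(2)[OF x] uinv(1)[OF x]]])
  from double_coset_rel_trans[OF xc' this double_coset_rel_uminus[OF xc rel]]
  have "double_coset_rel m (uinv m x - 1\<^sub>m m) (- (y - 1\<^sub>m m))" .
  from double_coset_rel_trans[OF xc' this double_coset_rel_mult(1)[OF *(2)[OF y] uinv(1)[OF y]]]
  show ?thesis unfolding *(1)[OF y] .
qed

text \<open>The two differences are conjugate under \<open>y\<close>. Hence superclass functions are
  class functions.\<close>

lemma conjugate_double_coset_rel: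
  assumes x: "x \<in> unitri m" and y: "y \<in> unitri m"
  shows "double_coset_rel m (x * y - 1\<^sub>m m) (y * x - 1\<^sub>m m)"
proof (rule double_coset_relI[OF y uinv(1)[OF y]])
  have c: "x \<in> carrier_mat m m" "y \<in> carrier_mat m m" "uinv m y \<in> carrier_mat m m" "x * y \<in> carrier_mat m m"
    "y * x \<in> carrier_mat m m"
    using x y uinv(1)[OF y] by (auto intro!: mult_carrier_mat[of _ m m] simp: unitri_carrier)
  have "y * (x * y - 1\<^sub>m m) = y * x * y - y"
    using c by (simp add: mult_minus_distrib_mat[of y m m "x * y" m "1\<^sub>m m"] assoc_mult_mat[of y m m x m y m])
  then have "y * (x * y - 1\<^sub>m m) * uinv m y = y * x * y * uinv m y - y * uinv m y"
    using c minus_mult_distrib_mat[of "y * x * y" m m y "uinv m y" m] mult_carrier_mat[OF c(5) c(2)] by simp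
  then show "y * x - 1\<^sub>m m = y * (x * y - 1\<^sub>m m) * uinv m y"
    using uinv_cancel(3)[OF y c(5)] uinv(3)[OF y] by simp
qed

text \<open>Zero is equivalent only to itself. This makes the convolution unit a superclass
  function.\<close>

lemma double_coset_rel_minus_one_iff:
  assumes x: "x \<in> unitri m" and y: "y \<in> unitri m" and rel: "double_coset_rel m (x - 1\<^sub>m m) (y - 1\<^sub>m m)"
  shows "x = 1\<^sub>m m \<longleftrightarrow> y = 1\<^sub>m m"
proof -
  have *: "z = 1\<^sub>m m"
    if z: "z \<in> unitri m" and rel: "double_coset_rel m (z - 1\<^sub>m m) (1\<^sub>m m - 1\<^sub>m m)" for z :: "'a mat"
  proof -
    have zc: "z \<in> carrier_mat m m" using z by (rule unitri_carrier)
    have zero: "1\<^sub>m m - 1\<^sub>m m = (0\<^sub>m m m :: 'a mat)" by (intro eq_matI) auto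
    have "z - 1\<^sub>m m = 0\<^sub>m m m"
      using rel[unfolded zero] by (intro double_coset_rel_zero minus_carrier_mat one_carrier_mat)
    moreover have "z = 1\<^sub>m m + (z - 1\<^sub>m m)" using zc by (intro eq_matI) auto
    moreover have "1\<^sub>m m + 0\<^sub>m m m = (1\<^sub>m m :: 'a mat)" by (rule right_add_zero_mat) simp
    ultimately show ?thesis by metis
  qed
  have c: "x - 1\<^sub>m m \<in> carrier_mat m m" by (simp add: minus_carrier_mat)
  show ?thesis using *[OF x] *[OF y] rel double_coset_rel_sym[OF c rel] by metis
qed

lemma scfD:
  fixes \<eta> :: "'a::field mat \<Rightarrow> complex"
  assumes "(2::'a) \<noteq> 0" "\<eta> \<in> scf T n" "x \<in> Uset T n" "y \<in> Uset T n"
    "double_coset_rel (msize T n) (x - 1\<^sub>m (msize T n)) (y - 1\<^sub>m (msize T n))"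
  shows "\<eta> x = \<eta> y"
  using assms(2-5) unfolding scf_iff[OF assms(1)] by metis

lemma scfI:
  fixes f :: "'a::field mat \<Rightarrow> complex"
  assumes "(2::'a) \<noteq> 0" "\<And>x y. x \<in> Uset T n \<Longrightarrow> y \<in> Uset T n \<Longrightarrow>
    double_coset_rel (msize T n) (x - 1\<^sub>m (msize T n)) (y - 1\<^sub>m (msize T n)) \<Longrightarrow> f x = f y"
  shows "(\<lambda>z\<in>Uset T n. f z) \<in> scf T n"
  unfolding scf_iff[OF assms(1)]
proof (intro conjI ballI impI)
  fix x y :: "'a mat"
  assume xy: "x \<in> Uset T n" "y \<in> Uset T n"
    "double_coset_rel (msize T n) (x - 1\<^sub>m (msize T n)) (y - 1\<^sub>m (msize T n))"
  show "(\<lambda>z\<in>Uset T n. f z) x = (\<lambda>z\<in>Uset T n. f z) y" using assms(2)[OF xy] xy(1,2) by simp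
qed simp

lemma Ugrp_sel:
  "carrier (Ugrp T n) = Uset T n" "monoid.mult (Ugrp T n) = (*)" "monoid.one (Ugrp T n) = 1\<^sub>m (msize T n)"
  by (simp_all add: Ugrp_def)

lemma convolution_algebra_scf:
  assumes p: "of_nat p = (0::'a::{field, finite})" "odd p"
  shows "convolution_algebra (Ugrp T n :: 'a mat monoid) (scf T n)"
proof -
  let ?m = "msize T n"
  \<comment> \<open>If 2 were zero, an odd \<open>p\<close> would equal one in the field instead of
    zero.\<close>
  have two: "(2::'a) \<noteq> 0"
  proof
    assume "(2::'a) = 0"
    moreover obtain k where "p = 2 * k + 1" using p(2) by (elim oddE)
    ultimately show False using p(1) by simp
  qed
  note scfI = scfI[OF two] and scfD = scfD[OF two]
  have U: "x \<in> unitri ?m" if "x \<in> Uset T n" for x :: "'a mat" using that Uset_subset_unitri by (rule subsetD[rotated])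
  have cl: "x * y \<in> Uset T n" if "x \<in> Uset T n" "y \<in> Uset T n" for x y :: "'a mat"
    using subgroup.m_closed[OF subgroup_Uset that] by simp
  have icl: "uinv ?m x \<in> Uset T n" if "x \<in> Uset T n" for x :: "'a mat"
    using subgroup.m_inv_closed[OF subgroup_Uset that] by (simp add: uinv_def)
  show ?thesis
  proof (intro convolution_algebra.intro convolution_algebra_axioms.intro group_Ugrp, unfold Ugrp_sel)
    show "finite (Uset T n :: 'a mat set)" by (rule finite_Uset)
    show "scf T n \<subseteq> (Uset T n :: 'a mat set) \<rightarrow>\<^sub>E UNIV" by (simp add: scf_def)
    show "(\<lambda>z\<in>Uset T n. if z = (1\<^sub>m ?m :: 'a mat) then 1 else 0) \<in> scf T n"
      by (rule scfI) (simp only: double_coset_rel_minus_one_iff[OF U U])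
    fix \<xi> :: "'a mat \<Rightarrow> complex" assume \<xi>: "\<xi> \<in> scf T n"
    show "(\<lambda>z\<in>Uset T n. c * \<xi> z) \<in> scf T n" for c
      by (rule scfI) (simp only: scfD[OF \<xi>])
    have "\<xi> (uinv ?m x) = \<xi> (uinv ?m y)"
      if "x \<in> Uset T n" "y \<in> Uset T n" "double_coset_rel ?m (x - 1\<^sub>m ?m) (y - 1\<^sub>m ?m)" for x y
      by (rule scfD[OF \<xi> icl icl uinv_double_coset_rel[OF U U]]) (fact that)+
    from scfI[of T n "\<lambda>x. cnj (\<xi> (uinv ?m x))", OF arg_cong[where f = cnj, OF this]]
    show "(\<lambda>z\<in>Uset T n. cnj (\<xi> (inv\<^bsub>Ugrp T n\<^esub> z))) \<in> scf T n"
      by (simp add: inv_Ugrp cong: restrict_cong)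
    show "\<xi> (x * y) = \<xi> (y * x)" if "x \<in> Uset T n" "y \<in> Uset T n" for x y
      by (rule scfD[OF \<xi> cl cl conjugate_double_coset_rel[OF U U]]) (fact that)+
    fix \<zeta> :: "'a mat \<Rightarrow> complex" assume \<zeta>: "\<zeta> \<in> scf T n"
    show "(\<lambda>z\<in>Uset T n. \<xi> z + \<zeta> z) \<in> scf T n"
      by (rule scfI) (simp only: scfD[OF \<xi>] scfD[OF \<zeta>])
    have "(\<lambda>z\<in>Uset T n. \<Sum>x\<in>Uset T n. \<xi> x * \<zeta> (z * uinv ?m x)) \<in> scf T n"
      by (rule scfI, rule sum_convolution_invariant[OF p])
        (rule conjI; rule scfD[OF \<xi>] scfD[OF \<zeta>]; assumption)
    then show "(\<lambda>z\<in>Uset T n. \<Sum>x\<in>Uset T n. \<xi> x * \<zeta> (z * inv\<^bsub>Ugrp T n\<^esub> x)) \<in> scf T n"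
      by (simp add: inv_Ugrp cong: sum.cong)
  qed
qed

theorem theorem6p3:
  fixes T :: gtype and n p e :: nat
  assumes "prime p" and "odd p" and "e \<ge> 1"
    and "card (UNIV :: 'a::{field, finite} set) = p ^ e"
    and "n \<ge> 1"
  shows "algebra class_ring (scf_algebra T n :: (complex, 'a mat \<Rightarrow> complex) module)
    \<and> semisimple_ring (scf_algebra T n :: (complex, 'a mat \<Rightarrow> complex) module)"
proof -
  \<comment> \<open>Translation by one permutes the field, so comparing sums shows that its
    cardinality \<open>p ^ e\<close> is zero in it; hence so is \<open>p\<close>.\<close>
  have "(\<Sum>x\<in>UNIV. x + 1) = (\<Sum>x\<in>UNIV. (x::'a))"
    by (rule sum.reindex_bij_witness[of _ "\<lambda>x. x - 1" "\<lambda>x. x + 1"]) auto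
  then have "of_nat (card (UNIV :: 'a set)) = (0::'a)" by (simp add: sum.distrib)
  then have p0: "of_nat p = (0::'a)" using assms(3,4) by simp
  interpret C: convolution_algebra "Ugrp T n :: 'a mat monoid" "scf T n"
    by (rule convolution_algebra_scf[OF p0 \<open>odd p\<close>])
  have "C.alg = scf_algebra T n"
    unfolding C.alg_def C.conv_def scf_algebra_def convolution_def Ugrp_sel ..
  then show ?thesis using C.algebra_alg C.semisimple_alg by metis
qed

end
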